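(* Let $q=p^a$, let $f\in\mu_{q-1}[x_1^{\pm1},\dots,x_n^{\pm1}]$ be a non-constant Laurent polynomial, and let $\chi=\omega^{-d}$ with $d\in\mathbb{Z}^n/(q-1)$. Then $$T\text{-adic NP of }C_{f,\chi}(s,T)\ \ge\ a(p-1)H^\infty_{\triangle(f),d},$$ where NP is short for Newton polygon and $H^\infty_{\triangle(f),d}$ is the infinite $d$-twisted Hodge polygon of $\triangle(f)$.
   Context: $p$ is a prime, $\mathbb{Z}_{q^k}=W(\mathbb{F}_{q^k})$, $\mu_{q^k-1}\subset\mathbb{Z}_{q^k}$ the group of $(q^k-1)$-th roots of unity. The notation $f\in\mu_{q-1}[x_1^{\pm1},\dots,x_n^{\pm1}]$ means $f=\sum_{u\in I}a_ux^u$ with $I\subset\mathbb{Z}^n$ finite and $a_u\in\mu_{q-1}$. $\omega:\mathbb{F}_q^\times\to\mu_{q-1}$, $x\mapsto\hat x$, is the Teichmüller character; $\chi=\omega^{-d}$ is the character $x\mapsto\hat x^{-d}=\prod_i\hat x_i^{-d_i}$ of $(\mathbb{F}_q^\times)^n$, and $\chi_k=\chi\circ\mathrm{Norm}_{\mathbb{F}_{q^k}/\mathbb{F}_q}$, viewed as $\chi_k(x)=x^{-d(1+q+\cdots+q^{k-1})}$ on $\mu_{q^k-1}^n$. Let $\psi(x)=(1+T)^x$ for $x\in\mathbb{Z}_p$, $\psi_{q^k}=\psi\circ\mathrm{Tr}_{\mathbb{Z}_{q^k}/\mathbb{Z}_p}$, $S_f(T,\chi_k)=\sum_{x\in\mu_{q^k-1}^n}\chi_k(x)\psi_{q^k}(f(x))$,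 and $$C_{f,\chi}(s,T)=\exp\Big(\sum_{k\ge1}\frac{-1}{(q^k-1)^n}S_f(T,\chi_k)\frac{s^k}{k}\Big)\in1+s\mathbb{Z}_q[[T]][[s]].$$ The $T$-adic Newton polygon of $\sum_i a_i(T)s^i$ is the lower convex hull of the points $(i,\mathrm{ord}_T(a_i))$, viewed as a function on $\mathbb{R}_+$ (value $+\infty$ beyond the degree). Hodge polygon: let $\triangle=\triangle(f)$ be the convex hull in $\mathbb{R}^n$ of the origin and the exponents $u\in I$, $C(\triangle)$ the cone generated by $\triangle$, $M(\triangle)=C(\triangle)\cap\mathbb{Z}^n$, and $\deg_\triangle$ the degree function on $C(\triangle)$, which is $\mathbb{R}_+$-linear (linear on the cone over each face not containing $0$) and takes the value $1$ on each face $\delta\not\ni0$ of $\triangle$. For $d\in\mathbb{Z}^n/(q-1)$, regarded as a coset in $\mathbb{Z}^n$, $M_d(\triangle)=\frac1{q-1}(M(\triangle)\cap d)$. Let $b$ be the least positive integer with $p^bd=d$, and order the elements of $\bigcup_{i=0}^{b-1}M_{p^id}(\triangle)$ as $x_1,x_2,\dots$ with $\deg_\triangle(x_1)\le\deg_\triangle(x_2)\le\cdots$. The infinite $d$-twisted Hodge polygon $H^\infty_{\triangle,d}$ is the convex function on $\mathbb{R}_+$ with initial value $0$, linear between consecutive integers, with slopes $\frac1b\big(\deg_\triangle(x_{bi+1})+\cdots+\deg_\triangle(x_{b(i+1)})\big)$, $i=0,1,\dots$ (if these sets are empty, the polygon is $+\infty$ on $(0,\infty)$). *)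

theory Defs
  imports
    "HOL-Analysis.Analysis"
    "HOL-Computational_Algebra.Computational_Algebra"
    "HOL-Number_Theory.Number_Theory"
    "HOL-Library.Poly_Mapping"
begin

section \<open>Integer polynomials in countably many variables\<close>

text \<open>The variable indexed by \<open>(j, i)\<close> is the \<open>i\<close>-th component of the \<open>j\<close>-th generic Witt vector.\<close>

type_synonym ipoly = "((nat \<times> nat) \<Rightarrow>\<^sub>0 nat) \<Rightarrow>\<^sub>0 int"

definition ivar :: "nat \<Rightarrow> nat \<Rightarrow> ipoly" where
  "ivar j i = Poly_Mapping.single (Poly_Mapping.single (j, i) 1) 1"

definition imonom_eval :: "(nat \<times> nat \<Rightarrow> 'a) \<Rightarrow> ((nat \<times> nat) \<Rightarrow>\<^sub>0 nat) \<Rightarrow> 'a::comm_ring_1" where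
  "imonom_eval v m = (\<Prod>i\<in>Poly_Mapping.keys m. v i ^ Poly_Mapping.lookup m i)"

definition ipoly_eval :: "(nat \<times> nat \<Rightarrow> 'a) \<Rightarrow> ipoly \<Rightarrow> 'a::comm_ring_1" where
  "ipoly_eval v P = (\<Sum>m\<in>Poly_Mapping.keys P. of_int (Poly_Mapping.lookup P m) * imonom_eval v m)"

lemma imonom_eval_superset:
  assumes "finite A" "Poly_Mapping.keys m \<subseteq> A"
  shows "imonom_eval v m = (\<Prod>i\<in>A. v i ^ Poly_Mapping.lookup m i)"
  unfolding imonom_eval_def
  by (rule prod.mono_neutral_left) (use assms in \<open>auto simp: in_keys_iff\<close>)

lemma ipoly_eval_superset:
  assumes "finite A" "Poly_Mapping.keys P \<subseteq> A"
  shows "ipoly_eval v P = (\<Sum>m\<in>A. of_int (Poly_Mapping.lookup P m) * imonom_eval v m)"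
  unfolding ipoly_eval_def
  by (rule sum.mono_neutral_left) (use assms in \<open>auto simp: in_keys_iff\<close>)

lemma imonom_eval_add: "imonom_eval v (m + m') = imonom_eval v m * imonom_eval v m'"
proof -
  let ?A = "Poly_Mapping.keys m \<union> Poly_Mapping.keys m'"
  have "Poly_Mapping.keys (m + m') \<subseteq> ?A" by (rule Poly_Mapping.keys_add)
  then show ?thesis
    by (simp add: imonom_eval_superset[of ?A] lookup_add power_add prod.distrib)
qed

lemma ipoly_eval_0 [simp]: "ipoly_eval v 0 = 0"
  by (simp add: ipoly_eval_def)

lemma ipoly_eval_add: "ipoly_eval v (P + Q) = ipoly_eval v P + ipoly_eval v Q"
proof -
  let ?A = "Poly_Mapping.keys P \<union> Poly_Mapping.keys Q"
  have "Poly_Mapping.keys (P + Q) \<subseteq> ?A" by (rule Poly_Mapping.keys_add)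
  then show ?thesis
    by (simp add: ipoly_eval_superset[of ?A] lookup_add distrib_right sum.distrib)
qed

lemma ipoly_eval_single:
  "ipoly_eval v (Poly_Mapping.single m c) = of_int c * imonom_eval v m"
  by (simp add: ipoly_eval_superset[of "{m}"])

lemma ipoly_eval_ivar [simp]: "ipoly_eval v (ivar j i) = v (j, i)"
  by (simp add: ivar_def ipoly_eval_single imonom_eval_def)

lemma poly_mapping_add_induct [case_names zero single add]:
  fixes P :: "'a \<Rightarrow>\<^sub>0 'b::monoid_add"
  assumes "Q 0" "\<And>m c. Q (Poly_Mapping.single m c)" "\<And>P P'. Q P \<Longrightarrow> Q P' \<Longrightarrow> Q (P + P')"
  shows "Q P"
proof (induction P rule: update_induct)
  case const
  then show ?case by (rule assms(1))
next
  case (update f a b)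
  have "Poly_Mapping.update a b f = f + Poly_Mapping.single a b"
    using update by (intro poly_mapping_eqI) (auto simp: lookup_update lookup_add lookup_single in_keys_iff when_def)
  then show ?case using update assms by metis
qed

lemma ipoly_eval_mult: "ipoly_eval v (P * Q) = ipoly_eval v P * ipoly_eval v Q"
proof (induction P rule: poly_mapping_add_induct)
  case (single m c)
  show ?case
  proof (induction Q rule: poly_mapping_add_induct)
    case (single m' c')
    then show ?case by (simp add: mult_single ipoly_eval_single imonom_eval_add algebra_simps)
  qed (simp_all add: ipoly_eval_add distrib_left)
qed (simp_all add: ipoly_eval_add distrib_right)

lemma ipoly_eval_1 [simp]: "ipoly_eval v 1 = 1"
  by (simp add: ipoly_eval_single imonom_eval_def flip: single_one)

lemma ipoly_eval_uminus: "ipoly_eval v (- P) = - ipoly_eval v P"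
  using ipoly_eval_add[of v P "- P"] by (simp add: eq_neg_iff_add_eq_0 add.commute)

lemma ipoly_eval_diff: "ipoly_eval v (P - Q) = ipoly_eval v P - ipoly_eval v Q"
  using ipoly_eval_add[of v P "- Q"] by (simp add: ipoly_eval_uminus)

lemma ipoly_eval_power: "ipoly_eval v (P ^ n) = ipoly_eval v P ^ n"
  by (induction n) (simp_all add: ipoly_eval_mult)

lemma ipoly_eval_of_nat [simp]: "ipoly_eval v (of_nat n) = of_nat n"
  by (induction n) (simp_all add: ipoly_eval_add)

lemma ipoly_eval_of_int [simp]: "ipoly_eval v (of_int n) = of_int n"
  by (cases n) (simp_all add: ipoly_eval_uminus ipoly_eval_diff)

lemma ipoly_eval_sum: "ipoly_eval v (sum f A) = (\<Sum>x\<in>A. ipoly_eval v (f x))"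
  by (induction A rule: infinite_finite_induct) (simp_all add: ipoly_eval_add)

lemmas ipoly_eval_hom = ipoly_eval_add ipoly_eval_mult ipoly_eval_uminus ipoly_eval_diff
  ipoly_eval_power ipoly_eval_sum

lemma ipoly_induct [case_names const var add mult]:
  fixes P :: ipoly
  assumes c: "\<And>c. Q (of_int c)" and v: "\<And>j i. Q (ivar j i)"
    and a: "\<And>P P'. Q P \<Longrightarrow> Q P' \<Longrightarrow> Q (P + P')"
    and m: "\<And>P P'. Q P \<Longrightarrow> Q P' \<Longrightarrow> Q (P * P')"
  shows "Q P"
proof (induction P rule: poly_mapping_add_induct)
  case zero
  show ?case using c[of 0] by simp
next
  case (single m k)
  have ci: "of_int k = (Poly_Mapping.single 0 k :: ipoly)" for k
    by (simp flip: single_of_int)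
  have "Q (Poly_Mapping.single m 1)"
  proof (induction m rule: poly_mapping_add_induct)
    case zero
    then show ?case using c[of 1] by simp
  next
    case (single ji e)
    obtain j i where ji: "ji = (j, i)" by force
    show ?case
    proof (induction e)
      case 0
      then show ?case using c[of 1] by simp
    next
      case (Suc e)
      have "Poly_Mapping.single (Poly_Mapping.single ji (Suc e)) 1
        = ivar j i * Poly_Mapping.single (Poly_Mapping.single ji e) 1"
        by (simp add: ivar_def ji mult_single flip: single_add)
      then show ?case using Suc v m by metis
    qed
  next
    case (add m m')
    have "Poly_Mapping.single (m + m') 1 = Poly_Mapping.single m 1 * (Poly_Mapping.single m' 1 :: ipoly)"
      by (simp add: mult_single)
    then show ?case using add assms by metis
  qed
  moreover have "Poly_Mapping.single m k = of_int k * Poly_Mapping.single m 1"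
    by (simp add: ci mult_single)
  ultimately show ?case using c m by metis
qed (use a in blast)

lemma ipoly_eval_comp:
  "ipoly_eval v (ipoly_eval w P) = ipoly_eval (\<lambda>i. ipoly_eval v (w i)) P"
  by (induction P rule: ipoly_induct) (simp_all add: ipoly_eval_hom)

lemma ipoly_lookup_of_nat_mult: "Poly_Mapping.lookup (of_nat n * (P :: ipoly)) m = of_nat n * Poly_Mapping.lookup P m"
  by (induction n) (simp_all add: lookup_add distrib_right)

lemma ipoly_torsion_free:
  fixes P Q :: ipoly
  assumes "of_nat n * P = of_nat n * Q" "n > 0"
  shows "P = Q"
proof (rule poly_mapping_eqI)
  fix m
  have "of_nat n * Poly_Mapping.lookup P m = of_nat n * Poly_Mapping.lookup Q m"
    using assms(1) by (metis ipoly_lookup_of_nat_mult)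
  then show "Poly_Mapping.lookup P m = Poly_Mapping.lookup Q m" using assms(2) by simp
qed

section \<open>Ghost components and Dwork's lemma\<close>

lemma power_prime_cong_step:
  fixes x y :: "'a::comm_ring_1"
  assumes "of_nat p ^ m dvd x - y" "m > 0"
  shows "of_nat p ^ Suc m dvd x ^ p - y ^ p"
proof -
  have d: "of_nat p dvd x - y"
    using assms by (meson dvd_power dvd_trans)
  have dk: "of_nat p dvd x ^ k - y ^ k" for k
    using d by (metis dvd_trans power_diff_sumr2 dvd_triv_left)
  have eq: "(\<Sum>i<p. y ^ (p - Suc i) * x ^ i) = (\<Sum>i<p. y ^ (p - Suc i) * (x ^ i - y ^ i)) + of_nat p * y ^ (p - 1)"
  proof -
    have "(\<Sum>i<p. y ^ (p - Suc i) * y ^ i) = (\<Sum>i<p. y ^ (p - 1))"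
      by (intro sum.cong refl) (auto simp flip: power_add)
    then show ?thesis by (simp add: right_diff_distrib sum_subtractf)
  qed
  have "of_nat p dvd (\<Sum>i<p. y ^ (p - Suc i) * x ^ i)"
    unfolding eq by (intro dvd_add dvd_sum dvd_mult[OF dk] dvd_triv_left)
  then have "of_nat p ^ m * of_nat p dvd (x - y) * (\<Sum>i<p. y ^ (p - Suc i) * x ^ i)"
    using assms(1) by (rule mult_dvd_mono[rotated])
  then show ?thesis by (simp add: power_diff_sumr2 mult.commute)
qed

lemma power_prime_cong:
  fixes x y :: "'a::comm_ring_1"
  assumes "of_nat p dvd x - y"
  shows "of_nat p ^ Suc n dvd x ^ (p ^ n) - y ^ (p ^ n)"
proof (induction n)
  case (Suc n)
  have "of_nat p ^ Suc (Suc n) dvd (x ^ (p ^ n)) ^ p - (y ^ (p ^ n)) ^ p"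
    by (rule power_prime_cong_step[OF Suc]) simp
  then show ?case by (simp add: mult.commute flip: power_mult)
qed (use assms in simp)

lemma freshman_cong:
  fixes x y :: "'a::comm_ring_1"
  assumes "prime p"
  shows "of_nat p dvd (x + y) ^ p - (x ^ p + y ^ p)"
proof -
  have p: "p > 0" using assms prime_gt_0_nat by blast
  have "(x + y) ^ p = (\<Sum>k\<le>p. of_nat (p choose k) * x ^ k * y ^ (p - k))"
    by (rule binomial_ring)
  also have "{..p} = insert 0 (insert p {0<..<p})" using p by auto
  also have "(\<Sum>k\<in>\<dots>. of_nat (p choose k) * x ^ k * y ^ (p - k))
      = y ^ p + (x ^ p + (\<Sum>k\<in>{0<..<p}. of_nat (p choose k) * x ^ k * y ^ (p - k)))"
    using p by simp
  finally have eq: "(x + y) ^ p - (x ^ p + y ^ p)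
     = (\<Sum>k\<in>{0<..<p}. of_nat (p choose k) * x ^ k * y ^ (p - k))" by simp
  have "p dvd (p choose k)" if "k \<in> {0<..<p}" for k
    using that assms by (intro dvd_choose_prime) auto
  then have "(of_nat p :: 'a) dvd of_nat (p choose k)" if "k \<in> {0<..<p}" for k
    using that by (metis dvd_def of_nat_mult)
  then show ?thesis unfolding eq
    by (intro dvd_sum dvd_mult2)
qed

definition ghost :: "nat \<Rightarrow> (nat \<Rightarrow> 'a::comm_ring_1) \<Rightarrow> nat \<Rightarrow> 'a" where
  "ghost p x n = (\<Sum>i\<le>n. of_nat p ^ i * x i ^ (p ^ (n - i)))"

text \<open>The lift of Frobenius that raises every variable to the \<open>p\<close>-th power.\<close>

definition ifrob :: "nat \<Rightarrow> ipoly \<Rightarrow> ipoly" where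
  "ifrob p = ipoly_eval (\<lambda>(j, i). ivar j i ^ p)"

lemma ifrob_cong:
  assumes "prime p"
  shows "of_nat p dvd ifrob p P - P ^ p"
proof (induction P rule: ipoly_induct)
  case (const c)
  have "int p dvd c - c ^ p"
  proof (cases "int p dvd c")
    case True
    then show ?thesis
      using assms prime_gt_0_nat[OF assms] by (metis dvd_diff dvd_power dvd_trans)
  next
    case False
    define m where "m = nat (c mod int p)"
    have m: "int m = c mod int p"
      using prime_gt_0_nat[OF assms] by (simp add: m_def)
    have "\<not> int p dvd int m" unfolding m using False by (simp add: dvd_mod_iff)
    then have "\<not> p dvd m" by simp
    then have "[m ^ (p - 1) = 1] (mod p)"
      by (rule fermat_theorem[OF assms])
    then have "[int m ^ (p - 1) = 1] (mod int p)"
      by (metis cong_int_iff of_nat_1 of_nat_power)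
    then have "[(c mod int p) ^ (p - 1) = 1] (mod int p)"
      by (simp only: m)
    then have "[c ^ (p - 1) = 1] (mod int p)"
      by (simp add: cong_def power_mod)
    then have "[c * c ^ (p - 1) = c * 1] (mod int p)" by (rule cong_scalar_left)
    then have "[c ^ p = c] (mod int p)"
      using prime_gt_0_nat[OF assms] by (metis mult_1_right power_eq_if not_gr_zero)
    then show ?thesis by (simp add: cong_iff_dvd_diff dvd_diff_commute)
  qed
  then obtain k where "c - c ^ p = int p * k" by (elim dvdE)
  then have "(of_int (c - c ^ p) :: ipoly) = of_nat p * of_int k"
    by (simp only: of_int_mult of_int_of_nat_eq)
  then show ?case by (simp add: ifrob_def)
next
  case (var j i)
  then show ?case by (simp add: ifrob_def)
next
  case (add P P')
  have "of_nat p dvd (ifrob p P - P ^ p) + (ifrob p P' - P' ^ p) - ((P + P') ^ p - (P ^ p + P' ^ p))"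
    by (intro dvd_diff dvd_add add freshman_cong assms)
  then show ?case by (simp add: ifrob_def ipoly_eval_hom algebra_simps)
next
  case (mult P P')
  have "of_nat p dvd (ifrob p P - P ^ p) * ifrob p P' + P ^ p * (ifrob p P' - P' ^ p)"
    by (intro dvd_add dvd_mult dvd_mult2 mult)
  then show ?case by (simp add: ifrob_def ipoly_eval_hom algebra_simps)
qed

lemma ghost_eval: "ipoly_eval v (ghost p x n) = ghost p (\<lambda>i. ipoly_eval v (x i)) n"
  by (simp add: ghost_def ipoly_eval_hom)

lemma ghost_split:
  "ghost p x n = (\<Sum>i<n. of_nat p ^ i * x i ^ (p ^ (n - i))) + of_nat p ^ n * x n"
  by (simp add: ghost_def flip: lessThan_Suc_atMost)

lemma ghost_cong: 
  assumes "\<And>i. i \<le> n \<Longrightarrow> x i = y i" shows "ghost p x n = ghost p y n"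
  unfolding ghost_def using assms by (intro sum.cong) auto

lemma ghost_inj:
  fixes x y :: "nat \<Rightarrow> ipoly"
  assumes "p > 0" "\<And>n. ghost p x n = ghost p y n"
  shows "x = y"
proof
  fix n show "x n = y n"
  proof (induction n rule: less_induct)
    case (less n)
    have "(\<Sum>i<n. of_nat p ^ i * x i ^ (p ^ (n - i))) = (\<Sum>i<n. of_nat p ^ i * y i ^ (p ^ (n - i)))"
      using less by (intro sum.cong) auto
    then have "of_nat (p ^ n) * x n = of_nat (p ^ n) * y n"
      using assms(2)[of n] by (simp add: ghost_split)
    then show ?case by (rule ipoly_torsion_free) (use assms in simp)
  qed
qed

function dwork_seq :: "nat \<Rightarrow> (nat \<Rightarrow> ipoly) \<Rightarrow> nat \<Rightarrow> ipoly" where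
  "dwork_seq p g n = (SOME t. g n = (\<Sum>i<n. of_nat p ^ i * dwork_seq p g i ^ (p ^ (n - i))) + of_nat p ^ n * t)"
  by auto
termination by (relation "Wellfounded.measure (\<lambda>(p, g, n). n)") auto

declare dwork_seq.simps [simp del]

lemma dwork:
  fixes g :: "nat \<Rightarrow> ipoly"
  assumes p: "prime p" and g: "\<And>n. of_nat p ^ Suc n dvd g (Suc n) - ifrob p (g n)"
  shows "ghost p (dwork_seq p g) n = g n"
proof (induction n)
  case 0
  have "\<exists>t. g 0 = (\<Sum>i<0. of_nat p ^ i * dwork_seq p g i ^ (p ^ (0 - i))) + of_nat p ^ 0 * t"
    by simp
  from someI_ex[OF this] show ?case
    by (simp add: ghost_def dwork_seq.simps[of p g 0])
next
  case (Suc n)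
  let ?s = "dwork_seq p g"
  have "of_nat p ^ Suc n dvd (\<Sum>i\<le>n. of_nat p ^ i * (ifrob p (?s i) ^ p ^ (n - i) - (?s i ^ p) ^ p ^ (n - i)))"
  proof (intro dvd_sum)
    fix i assume "i \<in> {..n}"
    then have "(of_nat p :: ipoly) ^ Suc n = of_nat p ^ i * of_nat p ^ Suc (n - i)"
      by (simp add: Suc_diff_le flip: power_add power_Suc)
    then show "of_nat p ^ Suc n dvd of_nat p ^ i * (ifrob p (?s i) ^ p ^ (n - i) - (?s i ^ p) ^ p ^ (n - i))"
      using power_prime_cong[OF ifrob_cong[OF p]] by (metis dvd_refl mult_dvd_mono)
  qed
  also have "\<dots> = ifrob p (g n) - (\<Sum>i\<le>n. of_nat p ^ i * ?s i ^ p ^ (Suc n - i))"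
  proof -
    have "ifrob p (g n) = (\<Sum>i\<le>n. of_nat p ^ i * ifrob p (?s i) ^ p ^ (n - i))"
      unfolding Suc[symmetric] ifrob_def ghost_eval by (simp add: ghost_def)
    moreover have "(?s i ^ p) ^ p ^ (n - i) = ?s i ^ p ^ (Suc n - i)" if "i \<le> n" for i
      using that by (simp add: Suc_diff_le flip: power_mult)
    ultimately show ?thesis by (simp add: right_diff_distrib sum_subtractf)
  qed
  finally have "of_nat p ^ Suc n dvd (g (Suc n) - ifrob p (g n)) +
       (ifrob p (g n) - (\<Sum>i\<le>n. of_nat p ^ i * ?s i ^ p ^ (Suc n - i)))"
    using g by (intro dvd_add)
  then obtain t where "g (Suc n) - (\<Sum>i\<le>n. of_nat p ^ i * ?s i ^ p ^ (Suc n - i)) = of_nat p ^ Suc n * t"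
    by (auto elim!: dvdE)
  then have "\<exists>t. g (Suc n) = (\<Sum>i<Suc n. of_nat p ^ i * ?s i ^ (p ^ (Suc n - i))) + of_nat p ^ Suc n * t"
    by (intro exI[of _ t]) (simp add: lessThan_Suc_atMost algebra_simps del: power_Suc)
  from someI_ex[OF this] show ?case
    by (simp add: ghost_split[of p _ "Suc n"] dwork_seq.simps[of p g "Suc n"] del: power_Suc)
qed

lemma dwork_ex1:
  assumes p: "prime p" and g: "\<And>n. of_nat p ^ Suc n dvd g (Suc n) - ifrob p (g n)"
  shows "\<exists>!s. \<forall>n. ghost p s n = (g n :: ipoly)"
  using dwork[OF assms] ghost_inj[OF prime_gt_0_nat[OF p]] by metis



section \<open>The ring of $p$-typical Witt vectors\<close>

text \<open>The universal Witt polynomials are the unique families of integer polynomials inducing the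
  ring operations on ghost components.\<close>

definition witt_add_poly :: "nat \<Rightarrow> nat \<Rightarrow> ipoly" where
  "witt_add_poly p = (THE S. \<forall>n. ghost p S n = ghost p (ivar 0) n + ghost p (ivar 1) n)"

definition witt_mult_poly :: "nat \<Rightarrow> nat \<Rightarrow> ipoly" where
  "witt_mult_poly p = (THE S. \<forall>n. ghost p S n = ghost p (ivar 0) n * ghost p (ivar 1) n)"

definition witt_neg_poly :: "nat \<Rightarrow> nat \<Rightarrow> ipoly" where
  "witt_neg_poly p = (THE S. \<forall>n. ghost p S n = - ghost p (ivar 0) n)"

lemma ghost_ivar_Suc:
  "ghost p (ivar j) (Suc n) = ifrob p (ghost p (ivar j) n) + of_nat p ^ Suc n * ivar j (Suc n)"
proof -
  have "ifrob p (ghost p (ivar j) n) = (\<Sum>i\<le>n. of_nat p ^ i * (ivar j i ^ p) ^ p ^ (n - i))"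
    by (simp add: ghost_def ifrob_def ipoly_eval_hom)
  also have "\<dots> = (\<Sum>i\<le>n. of_nat p ^ i * ivar j i ^ p ^ (Suc n - i))"
    by (intro sum.cong refl) (simp add: Suc_diff_le flip: power_mult)
  finally show ?thesis by (simp add: ghost_split[of p _ "Suc n"] lessThan_Suc_atMost)
qed

lemma ifrob_hom:
  "ifrob p (P + Q) = ifrob p P + ifrob p Q" "ifrob p (P * Q) = ifrob p P * ifrob p Q"
  "ifrob p (- P) = - ifrob p P"
  by (simp_all add: ifrob_def ipoly_eval_hom)

context
  fixes p :: nat
  assumes p: "prime p"
begin

lemma witt_add_poly: "ghost p (witt_add_poly p) n = ghost p (ivar 0) n + ghost p (ivar 1) n"
proof -
  have "\<exists>!S. \<forall>n. ghost p S n = ghost p (ivar 0) n + ghost p (ivar 1) n"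
    proof (rule dwork_ex1[OF p])
    fix n
    show "of_nat p ^ Suc n dvd ghost p (ivar 0) (Suc n) + ghost p (ivar 1) (Suc n) -
        ifrob p (ghost p (ivar 0) n + ghost p (ivar 1) n)"
      by (rule dvdI[of _ _ "ivar 0 (Suc n) + ivar 1 (Suc n)"]) (simp add: ghost_ivar_Suc ifrob_hom algebra_simps)
  qed
  from theI'[OF this] show ?thesis unfolding witt_add_poly_def by blast
qed

lemma witt_mult_poly: "ghost p (witt_mult_poly p) n = ghost p (ivar 0) n * ghost p (ivar 1) n"
proof -
  have "\<exists>!S. \<forall>n. ghost p S n = ghost p (ivar 0) n * ghost p (ivar 1) n"
  proof (rule dwork_ex1[OF p])
    fix n
    have *: "c dvd (a + c * b) * (a' + c * b') - a * a'" for a b c a' b' :: ipoly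
      by (rule dvdI[of _ _ "a * b' + a' * b + b * c * b'"]) (simp add: algebra_simps)
    show "of_nat p ^ Suc n dvd ghost p (ivar 0) (Suc n) * ghost p (ivar 1) (Suc n) -
             ifrob p (ghost p (ivar 0) n * ghost p (ivar 1) n)"
      unfolding ghost_ivar_Suc ifrob_hom by (rule *)
  qed
  from theI'[OF this] show ?thesis unfolding witt_mult_poly_def by blast
qed

lemma witt_neg_poly: "ghost p (witt_neg_poly p) n = - ghost p (ivar 0) n"
proof -
  have "\<exists>!S. \<forall>n. ghost p S n = - ghost p (ivar 0) n"
    proof (rule dwork_ex1[OF p])
    fix n
    show "of_nat p ^ Suc n dvd - ghost p (ivar 0) (Suc n) - ifrob p (- ghost p (ivar 0) n)"
      by (rule dvdI[of _ _ "- ivar 0 (Suc n)"]) (simp add: ghost_ivar_Suc ifrob_hom algebra_simps)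
  qed
  from theI'[OF this] show ?thesis unfolding witt_neg_poly_def by blast
qed

end

definition wpair :: "(nat \<Rightarrow> 'a) \<Rightarrow> (nat \<Rightarrow> 'a) \<Rightarrow> nat \<times> nat \<Rightarrow> 'a" where
  "wpair x y = (\<lambda>(j, i). if j = 0 then x i else y i)"

definition wadd :: "nat \<Rightarrow> (nat \<Rightarrow> 'a) \<Rightarrow> (nat \<Rightarrow> 'a) \<Rightarrow> nat \<Rightarrow> 'a::comm_ring_1" where
  "wadd p x y n = ipoly_eval (wpair x y) (witt_add_poly p n)"

definition wmult :: "nat \<Rightarrow> (nat \<Rightarrow> 'a) \<Rightarrow> (nat \<Rightarrow> 'a) \<Rightarrow> nat \<Rightarrow> 'a::comm_ring_1" where
  "wmult p x y n = ipoly_eval (wpair x y) (witt_mult_poly p n)"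

definition wneg :: "nat \<Rightarrow> (nat \<Rightarrow> 'a) \<Rightarrow> nat \<Rightarrow> 'a::comm_ring_1" where
  "wneg p x n = ipoly_eval (wpair x x) (witt_neg_poly p n)"

definition wone :: "nat \<Rightarrow> 'a::comm_ring_1" where
  "wone n = (if n = 0 then 1 else 0)"

lemma wpair_eval: "ipoly_eval v (wpair x y i) = wpair (\<lambda>n. ipoly_eval v (x n)) (\<lambda>n. ipoly_eval v (y n)) i"
  by (cases i) (simp add: wpair_def)

lemma eval_w:
  "ipoly_eval v (wadd p x y n) = wadd p (\<lambda>i. ipoly_eval v (x i)) (\<lambda>i. ipoly_eval v (y i)) n"
  "ipoly_eval v (wmult p x y n) = wmult p (\<lambda>i. ipoly_eval v (x i)) (\<lambda>i. ipoly_eval v (y i)) n"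
  "ipoly_eval v (wneg p x n) = wneg p (\<lambda>i. ipoly_eval v (x i)) n"
  "ipoly_eval v (wone n) = wone n"
  by (simp_all add: wadd_def wmult_def wneg_def wone_def ipoly_eval_comp wpair_eval)

lemma ghost_0 [simp]: "p > 0 \<Longrightarrow> ghost p (\<lambda>_. 0) n = 0"
  by (simp add: ghost_def power_0_left)

lemma ghost_wone [simp]: "p > 0 \<Longrightarrow> ghost p wone n = 1"
proof -
  assume p: "p > 0"
  have "ghost p wone n = (\<Sum>i\<le>n. if i = 0 then 1 else 0 :: 'a)"
    unfolding ghost_def using p by (intro sum.cong) (auto simp: wone_def power_0_left)
  then show ?thesis by simp
qed

lemma ghost_w:
  assumes "prime p"
  shows "ghost p (wadd p x y) n = ghost p x n + ghost p y n"
    "ghost p (wmult p x y) n = ghost p x n * ghost p y n"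
    "ghost p (wneg p x) n = - ghost p x n"
  unfolding wadd_def[abs_def] wmult_def[abs_def] wneg_def[abs_def]
  unfolding ghost_eval[symmetric] witt_add_poly[OF assms] witt_mult_poly[OF assms]
    witt_neg_poly[OF assms] ipoly_eval_hom
  by (simp_all add: ghost_eval wpair_def)

definition wtriple :: "(nat \<Rightarrow> 'a) \<Rightarrow> (nat \<Rightarrow> 'a) \<Rightarrow> (nat \<Rightarrow> 'a) \<Rightarrow> nat \<times> nat \<Rightarrow> 'a" where
  "wtriple x y z = (\<lambda>(j, i). if j = 0 then x i else if j = 1 then y i else z i)"

text \<open>An identity between Witt vector operations need only be checked on the generic Witt
  vectors, where it follows from the same identity between ghost components.\<close>

lemma generic:
  assumes "p > 0" "\<And>n. ghost p f n = ghost p g n"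
  shows "(\<lambda>n. ipoly_eval (wtriple x y z) (f n)) = (\<lambda>n. ipoly_eval (wtriple x y z) (g n))"
  using ghost_inj[OF assms] by simp

lemma wtriple_simps [simp]:
  "wtriple x y z (0, i) = x i" "wtriple x y z (Suc 0, i) = y i" "wtriple x y z (2, i) = z i"
  by (simp_all add: wtriple_def)

context
  fixes p :: nat
  assumes p: "prime p"
begin

lemma p0: "p > 0" using p prime_gt_0_nat by blast

lemma w_ring:
  fixes x y z :: "nat \<Rightarrow> 'a::comm_ring_1"
  shows "wadd p (wadd p x y) z = wadd p x (wadd p y z)"
    "wadd p x y = wadd p y x"
    "wadd p (\<lambda>_. 0) x = x"
    "wadd p (wneg p x) x = (\<lambda>_. 0)"
    "wmult p (wmult p x y) z = wmult p x (wmult p y z)"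
    "wmult p x y = wmult p y x"
    "wmult p wone x = x"
    "wmult p (wadd p x y) z = wadd p (wmult p x z) (wmult p y z)"
proof -
  note g = generic[of p _ _ x y z, OF p0]
  let ?X = "ivar 0" and ?Y = "ivar 1" and ?Z = "ivar 2"
  note * = ghost_w[OF p] p0 eval_w
  show "wadd p (wadd p x y) z = wadd p x (wadd p y z)"
    using g[of "wadd p (wadd p ?X ?Y) ?Z" "wadd p ?X (wadd p ?Y ?Z)"] by (simp add: * add.assoc)
  show "wadd p x y = wadd p y x"
    using g[of "wadd p ?X ?Y" "wadd p ?Y ?X"] by (simp add: * add.commute)
  show "wadd p (\<lambda>_. 0) x = x"
    using g[of "wadd p (\<lambda>_. 0) ?X" ?X] by (simp add: *)
  show "wadd p (wneg p x) x = (\<lambda>_. 0)"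
    using g[of "wadd p (wneg p ?X) ?X" "\<lambda>_. 0"] by (simp add: *)
  show "wmult p (wmult p x y) z = wmult p x (wmult p y z)"
    using g[of "wmult p (wmult p ?X ?Y) ?Z" "wmult p ?X (wmult p ?Y ?Z)"] by (simp add: * mult.assoc)
  show "wmult p x y = wmult p y x"
    using g[of "wmult p ?X ?Y" "wmult p ?Y ?X"] by (simp add: * mult.commute)
  show "wmult p wone x = x"
    using g[of "wmult p wone ?X" ?X] by (simp add: *)
  show "wmult p (wadd p x y) z = wadd p (wmult p x z) (wmult p y z)"
    using g[of "wmult p (wadd p ?X ?Y) ?Z" "wadd p (wmult p ?X ?Z) (wmult p ?Y ?Z)"]
    by (simp add: * distrib_right)
qed

end

text \<open>Over a ring \<open>'a\<close> of prime characteristic the prime \<open>p\<close> of the construction is \<open>CHAR('a)\<close>.\<close>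

datatype 'a witt = Witt (witt_nth: "nat \<Rightarrow> 'a")

instantiation witt :: (comm_ring_prime_char) comm_ring_1
begin

definition "0 = Witt (\<lambda>_. 0)"
definition "1 = Witt wone"
definition "x + y = Witt (wadd CHAR('a) (witt_nth x) (witt_nth y))" for x y :: "'a witt"
definition "x * y = Witt (wmult CHAR('a) (witt_nth x) (witt_nth y))" for x y :: "'a witt"
definition "- x = Witt (wneg CHAR('a) (witt_nth x))" for x :: "'a witt"
definition "x - y = x + - y" for x y :: "'a witt"

instance
proof
  fix x y z :: "'a witt"
  note d = zero_witt_def one_witt_def plus_witt_def times_witt_def uminus_witt_def minus_witt_def
  note w = w_ring[OF CHAR_prime]
  show "x + y + z = x + (y + z)" by (simp add: d w(1))
  show "x + y = y + x" by (simp add: d w(2))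
  show "0 + x = x" by (simp add: d w(3))
  show "- x + x = 0" by (simp add: d w(4))
  show "x - y = x + - y" by (simp add: d)
  show "x * y * z = x * (y * z)" by (simp add: d w(5))
  show "x * y = y * x" by (simp add: d w(6))
  show "1 * x = x" by (simp add: d w(7))
  show "(x + y) * z = x * z + y * z" by (simp add: d w(8))
  show "(0 :: 'a witt) \<noteq> 1" by (auto simp: d wone_def fun_eq_iff)
qed

end

text \<open>Frobenius and Verschiebung show that the Witt vectors over a domain of prime characteristic
  are a domain of characteristic 0.\<close>

definition frob_poly :: "nat \<Rightarrow> nat \<Rightarrow> ipoly" where
  "frob_poly p = (THE S. \<forall>n. ghost p S n = ghost p (ivar 0) (Suc n))"

definition wfrob :: "nat \<Rightarrow> (nat \<Rightarrow> 'a) \<Rightarrow> nat \<Rightarrow> 'a::comm_ring_1" where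
  "wfrob p x n = ipoly_eval (wpair x x) (frob_poly p n)"

definition wver :: "(nat \<Rightarrow> 'a) \<Rightarrow> nat \<Rightarrow> 'a::zero" where
  "wver x n = (case n of 0 \<Rightarrow> 0 | Suc m \<Rightarrow> x m)"

definition wnat :: "nat \<Rightarrow> nat \<Rightarrow> nat \<Rightarrow> 'a::comm_ring_1" where
  "wnat p m = (wadd p wone ^^ m) (\<lambda>_. 0)"

lemma eval_wfrob: "ipoly_eval v (wfrob p x n) = wfrob p (\<lambda>i. ipoly_eval v (x i)) n"
  by (simp add: wfrob_def ipoly_eval_comp wpair_eval)

lemma eval_wver: "ipoly_eval v (wver x n) = wver (\<lambda>i. ipoly_eval v (x i)) n"
  by (simp add: wver_def split: nat.split)

lemma wnat_Suc: "wnat p (Suc m) = wadd p wone (wnat p m)"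
  by (simp add: wnat_def)

lemma eval_wnat: "ipoly_eval v (wnat p m n) = wnat p m n"
proof (induction m arbitrary: n)
  case 0
  then show ?case by (simp add: wnat_def)
next
  case (Suc m)
  then show ?case by (simp add: wnat_Suc eval_w)
qed

lemma ghost_wver:
  assumes "p > 0"
  shows "ghost p (wver x) n = (case n of 0 \<Rightarrow> 0 | Suc m \<Rightarrow> of_nat p * ghost p x m)"
proof (cases n)
  case 0
  then show ?thesis by (simp add: ghost_def wver_def)
next
  case (Suc m)
  then show ?thesis using assms
    by (simp add: ghost_def sum.atMost_Suc_shift wver_def power_0_left sum_distrib_left mult.assoc
        del: sum.atMost_Suc)
qed

lemma frob_poly:
  assumes p: "prime p"
  shows "ghost p (frob_poly p) n = ghost p (ivar 0) (Suc n)"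
proof -
  have "\<exists>!S. \<forall>n. ghost p S n = ghost p (ivar 0) (Suc n)"
  proof (rule dwork_ex1[OF p])
    fix n
    show "of_nat p ^ Suc n dvd ghost p (ivar 0) (Suc (Suc n)) - ifrob p (ghost p (ivar 0) (Suc n))"
      unfolding ghost_ivar_Suc[of p 0 "Suc n"] by simp
  qed
  from theI'[OF this] show ?thesis unfolding frob_poly_def by blast
qed

lemma wfrob_ghost:
  assumes p: "prime p"
  shows "ghost p (wfrob p x) n = ghost p x (Suc n)"
  unfolding wfrob_def[abs_def] ghost_eval[symmetric] frob_poly[OF p]
  by (simp add: ghost_eval wpair_def)

lemma frob_poly_cong:
  assumes p: "prime p"
  shows "of_nat p dvd frob_poly p n - ivar 0 n ^ p"
proof (induction n rule: less_induct)
  case (less n)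
  let ?F = "frob_poly p" and ?X = "ivar 0"
  note gF = frob_poly[OF p, of n]
  have "of_nat p ^ Suc n dvd (\<Sum>i<n. of_nat p ^ i * (?F i ^ p ^ (n - i) - (?X i ^ p) ^ p ^ (n - i)))"
  proof (intro dvd_sum)
    fix i assume i: "i \<in> {..<n}"
    then have "(of_nat p :: ipoly) ^ Suc n = of_nat p ^ i * of_nat p ^ Suc (n - i)"
      by (simp add: Suc_diff_le flip: power_add power_Suc)
    then show "of_nat p ^ Suc n dvd of_nat p ^ i * (?F i ^ p ^ (n - i) - (?X i ^ p) ^ p ^ (n - i))"
      using power_prime_cong[OF less[of i]] i by (metis dvd_refl lessThan_iff mult_dvd_mono)
  qed
  moreover have "ghost p ?X (Suc n) = (\<Sum>i<n. of_nat p ^ i * (?X i ^ p) ^ p ^ (n - i))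
     + of_nat p ^ n * ?X n ^ p + of_nat p ^ Suc n * ?X (Suc n)"
  proof -
    have "(?X i ^ p) ^ p ^ (n - i) = ?X i ^ p ^ (Suc n - i)" if "i < n" for i
      using that by (simp add: Suc_diff_le flip: power_mult)
    then show ?thesis by (simp add: ghost_split[of p _ "Suc n"] Suc_diff_le)
  qed
  then have "(\<Sum>i<n. of_nat p ^ i * (?F i ^ p ^ (n - i) - (?X i ^ p) ^ p ^ (n - i))) =
       (of_nat p ^ Suc n * ?X (Suc n) + of_nat p ^ n * ?X n ^ p) - of_nat p ^ n * ?F n"
    using gF unfolding ghost_split[of p ?F] right_diff_distrib sum_subtractf
    by (simp add: algebra_simps del: power_Suc)
  ultimately have "of_nat p ^ Suc n dvd
       (of_nat p ^ Suc n * ?X (Suc n) + of_nat p ^ n * ?X n ^ p) - of_nat p ^ n * ?F n"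
    by simp
  then have "of_nat p ^ Suc n dvd
       of_nat p ^ Suc n * ?X (Suc n) - ((of_nat p ^ Suc n * ?X (Suc n) + of_nat p ^ n * ?X n ^ p) - of_nat p ^ n * ?F n)"
    by (intro dvd_diff[OF dvd_triv_left])
  then have "of_nat p ^ Suc n dvd of_nat p ^ n * (?F n - ?X n ^ p)"
    by (simp add: algebra_simps del: power_Suc)
  then obtain t where "of_nat p ^ n * (?F n - ?X n ^ p) = of_nat p ^ Suc n * t" by (elim dvdE)
  then have "of_nat (p ^ n) * (?F n - ?X n ^ p) = of_nat (p ^ n) * (of_nat p * t)"
    by (simp add: algebra_simps)
  then have "?F n - ?X n ^ p = of_nat p * t"
    by (rule ipoly_torsion_free) (use p prime_gt_0_nat in auto)
  then show ?case by simp
qed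

lemma wfrob_char:
  fixes x :: "nat \<Rightarrow> 'a::comm_ring_1"
  assumes p: "prime p" and "of_nat p = (0 :: 'a)"
  shows "wfrob p x n = x n ^ p"
proof -
  obtain t where "frob_poly p n - ivar 0 n ^ p = of_nat p * t"
    using frob_poly_cong[OF p, of n] by (elim dvdE)
  then have "frob_poly p n = ivar 0 n ^ p + of_nat p * t" by (simp add: algebra_simps)
  then show ?thesis by (simp add: wfrob_def ipoly_eval_hom assms(2) wpair_def)
qed

lemma wver_mult:
  assumes "prime p"
  shows "wmult p (wver x) y = wver (wmult p x (wfrob p y))"
proof -
  let ?X = "ivar 0" and ?Y = "ivar 1"
  have "p > 0" using assms prime_gt_0_nat by blast
  then show ?thesis
    using generic[of p "wmult p (wver ?X) ?Y" "wver (wmult p ?X (wfrob p ?Y))" x y y]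
    by (simp add: ghost_w[OF assms] ghost_wver wfrob_ghost[OF assms] eval_w eval_wver eval_wfrob split: nat.split)
qed

lemma ghost_wnat: "prime p \<Longrightarrow> ghost p (wnat p m) n = of_nat m"
  by (induction m) (simp_all add: wnat_Suc ghost_w prime_gt_0_nat, simp add: wnat_def prime_gt_0_nat)

lemma wnat_p:
  assumes "prime p"
  shows "wnat p p = wfrob p (wver wone :: nat \<Rightarrow> 'a::comm_ring_1)"
proof -
  have "p > 0" using assms prime_gt_0_nat by blast
  then show ?thesis
    using generic[of p "wnat p p" "wfrob p (wver wone)" "\<lambda>_. 0 :: 'a" "\<lambda>_. 0" "\<lambda>_. 0"]
    by (simp add: ghost_wnat[OF assms] ghost_wver wfrob_ghost[OF assms] eval_w eval_wver eval_wfrob eval_wnat)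
qed

lemma w_nth_0:
  assumes "prime p"
  shows "wadd p x y 0 = x 0 + y 0" "wmult p x y 0 = x 0 * y 0"
  using ghost_w(1,2)[OF assms, of x y 0] by (simp_all add: ghost_def)

lemma of_nat_witt: "witt_nth (of_nat m :: 'a::comm_ring_prime_char witt) = wnat CHAR('a) m"
  by (induction m) (simp_all add: wnat_Suc zero_witt_def one_witt_def plus_witt_def, simp add: wnat_def)

lemma wnat_nth_0: "prime p \<Longrightarrow> wnat p m 0 = of_nat m"
  by (induction m) (simp_all add: wnat_Suc w_nth_0 wone_def, simp add: wnat_def)

lemma wmult_nonzero:
  fixes x y :: "nat \<Rightarrow> 'a::idom_prime_char"
  assumes "x m \<noteq> 0" "y n \<noteq> 0"
  shows "wmult CHAR('a) x y \<noteq> (\<lambda>_. 0)"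
proof -
  let ?p = "CHAR('a)"
  have F: "wfrob ?p x = (\<lambda>n. x n ^ ?p)" for x :: "nat \<Rightarrow> 'a"
    by (rule ext, rule wfrob_char) auto
  have V: "x = wver (\<lambda>n. x (Suc n))" if "x 0 = 0" for x :: "nat \<Rightarrow> 'a"
    using that by (auto simp: wver_def fun_eq_iff split: nat.split)
  have V0: "wver x \<noteq> (\<lambda>_. 0)" if "x \<noteq> (\<lambda>_. 0)" for x :: "nat \<Rightarrow> 'a"
  proof
    assume "wver x = (\<lambda>_. 0)"
    from fun_cong[OF this, of "Suc n" for n] have "x n = 0" for n by (simp add: wver_def)
    with that show False by auto
  qed
  have *: "wmult ?p x y \<noteq> (\<lambda>_. 0)" if "x 0 \<noteq> 0" "y n \<noteq> 0" for x y :: "nat \<Rightarrow> 'a" and n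
    using that
  proof (induction n arbitrary: x y)
    case 0
    then have "wmult ?p x y 0 \<noteq> 0" by (simp add: w_nth_0)
    then show ?case by metis
  next
    case (Suc n)
    show ?case
    proof (cases "y 0 = 0")
      case True
      have "wmult ?p x y = wmult ?p (wver (\<lambda>n. y (Suc n))) x"
        using V[of y, OF True] w_ring(6)[OF CHAR_prime] by metis
      also have "\<dots> = wver (wmult ?p (wfrob ?p x) (\<lambda>n. y (Suc n)))"
        by (simp add: wver_mult w_ring(6)[OF CHAR_prime, of "wfrob ?p x"])
      finally have *: "wmult ?p x y = \<dots>" .
      show ?thesis unfolding *
        by (rule V0, rule Suc.IH) (use Suc.prems in \<open>auto simp: F\<close>)
    next
      case False
      then have "wmult ?p x y 0 \<noteq> 0" using Suc.prems by (simp add: w_nth_0)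
      then show ?thesis by metis
    qed
  qed
  show ?thesis using assms
  proof (induction m arbitrary: x y)
    case 0
    then show ?case using * by blast
  next
    case (Suc m)
    show ?case
    proof (cases "x 0 = 0")
      case True
      have "wmult ?p x y = wmult ?p (wver (\<lambda>n. x (Suc n))) y"
        using V[of x, OF True] by metis
      also have "\<dots> = wver (wmult ?p (\<lambda>n. x (Suc n)) (wfrob ?p y))"
        by (simp add: wver_mult)
      finally have *: "wmult ?p x y = \<dots>" .
      show ?thesis unfolding *
        by (rule V0, rule Suc.IH) (use Suc.prems in \<open>auto simp: F\<close>)
    next
      case False
      then show ?thesis using * Suc.prems by blast
    qed
  qed
qed

instance witt :: (idom_prime_char) idom
proof
  fix a b :: "'a witt"
  assume "a \<noteq> 0" "b \<noteq> 0"
  then obtain m n where "witt_nth a m \<noteq> 0" "witt_nth b n \<noteq> 0"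
    by (metis ext witt.collapse zero_witt_def)
  from wmult_nonzero[of "witt_nth a" m "witt_nth b" n, OF this] show "a * b \<noteq> 0" by (simp add: times_witt_def zero_witt_def)
qed

instance witt :: (idom_prime_char) ring_char_0
proof -
  let ?p = "CHAR('a)"
  have "CHAR('a witt) = 0"
  proof (rule ccontr)
    assume "CHAR('a witt) \<noteq> 0"
    then have pr: "prime CHAR('a witt)" by (intro prime_CHAR_semidom) auto
    have "of_nat CHAR('a witt) = (0 :: 'a witt)" by (rule of_nat_CHAR)
    then have "wnat ?p CHAR('a witt) = (\<lambda>_. 0 :: 'a)"
      by (metis of_nat_witt witt.sel zero_witt_def)
    then have z: "wnat ?p CHAR('a witt) n = (0 :: 'a)" for n by metis
    have "of_nat CHAR('a witt) = (0 :: 'a)" using z[of 0] by (simp add: wnat_nth_0)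
    then have "?p dvd CHAR('a witt)" by (simp add: of_nat_eq_0_iff_char_dvd)
    then have "CHAR('a witt) = ?p" using primes_dvd_imp_eq[OF _ pr, of ?p] by auto
    then show False using z[of 1] by (simp add: wnat_p wfrob_char wver_def wone_def)
  qed
  then have inj: "m = n" if "of_nat n = (of_nat m :: 'a witt)" "n \<le> m" for m n
  proof -
    have "of_nat (m - n) = (0 :: 'a witt)" using that by (simp add: of_nat_diff)
    then have "m - n = 0"
      unfolding of_nat_eq_0_iff_char_dvd \<open>CHAR('a witt) = 0\<close> by simp
    then show "m = n" using that by simp
  qed
  show "OFCLASS('a witt, ring_char_0_class)"
  proof
    show "inj (of_nat :: nat \<Rightarrow> 'a witt)"
      by (rule injI) (metis inj nat_le_linear)
  qed
qed

instance fract :: ("{idom, ring_char_0}") field_char_0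
proof
  have "of_nat n = Fract (of_nat n :: 'a) 1" for n
    by (induction n) (simp_all add: Zero_fract_def One_fract_def)
  then show "inj (of_nat :: nat \<Rightarrow> 'a fract)"
    by (auto simp: inj_def eq_fract)
qed

lemma wmult_teich:
  assumes "prime p"
  shows "wmult p (\<lambda>i. if i = 0 then x else 0) (\<lambda>i. if i = 0 then y else 0) =
    (\<lambda>i. if i = 0 then x * y else 0 :: 'a::comm_ring_1)"
proof -
  have "p > 0" using assms prime_gt_0_nat by blast
  have gh: "ghost p (\<lambda>i. if i = 0 then t else 0) n = t ^ p ^ n" for t :: ipoly and n
  proof -
    have "ghost p (\<lambda>i. if i = 0 then t else 0) n = (\<Sum>i\<le>n. if i = 0 then t ^ p ^ n else 0)"
      unfolding ghost_def using \<open>p > 0\<close> by (intro sum.cong) (auto simp: power_0_left)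
    then show ?thesis by simp
  qed
  let ?x = "ivar 0 0" and ?y = "ivar 1 0"
  have "ipoly_eval v (if i = 0 then t else 0) = (if i = 0 then ipoly_eval v t else (0 :: 'a))" for v t and i :: nat
    by simp
  then show ?thesis
    using generic[of p "wmult p (\<lambda>i. if i = 0 then ?x else 0) (\<lambda>i. if i = 0 then ?y else 0)"
        "\<lambda>i. if i = 0 then ?x * ?y else 0" "\<lambda>_. x" "\<lambda>_. y" "\<lambda>_. x"] \<open>p > 0\<close>
    by (simp add: ghost_w[OF assms] gh power_mult_distrib eval_w ipoly_eval_mult cong: if_cong)
qed


section \<open>Unramified rings, roots of unity and characters\<close>

text \<open>The type \<open>'k\<close> is meant to be an algebraically closed field of characteristic \<open>p\<close>, so that
  \<open>GF N\<close> is its subfield with \<open>N\<close> elements for every power \<open>N\<close> of \<open>p\<close>. All rings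
  $\mathbb{Z}_N = W(\mathbb{F}_N)$ are regarded as subrings of the fraction field of \<open>'k witt\<close>, which
  has characteristic 0 and so accommodates the denominators in binomial coefficients and in exp.\<close>

definition GF :: "nat \<Rightarrow> 'k::field_prime_char set" where
  "GF N = {x. x ^ N = x}"

definition Zq :: "nat \<Rightarrow> 'k::field_prime_char witt fract set" where
  "Zq N = {to_fract w |w. \<forall>i. witt_nth w i \<in> GF N}"

definition mu :: "nat \<Rightarrow> 'k::field_prime_char witt fract set" where
  "mu N = {x \<in> Zq N. x ^ (N - 1) = 1}"

definition teichmuller :: "'k::field_prime_char \<Rightarrow> 'k witt fract" where
  "teichmuller x = to_fract (Witt (\<lambda>i. if i = 0 then x else 0))"

text \<open>The character $\chi_k$ on $\mu_{q^k-1}^n$ for $\chi = \omega^{-d}$. It depends only on the class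
  of \<open>d\<close> modulo \<open>q - 1\<close>, so the class is given by an arbitrary representative.\<close>

definition chi :: "nat \<Rightarrow> int ^ 'n \<Rightarrow> nat \<Rightarrow> 'k::field_prime_char witt fract ^ 'n \<Rightarrow> 'k witt fract" where
  "chi q d k x = (\<Prod>i\<in>UNIV. (x $ i) powi (- (d $ i) * (\<Sum>j<k. int q ^ j)))"

lemma teichmuller_mult: "teichmuller (x * y) = teichmuller x * teichmuller y"
  by (simp add: teichmuller_def wmult_teich times_witt_def flip: to_fract_mult)

lemma teichmuller_1: "teichmuller 1 = 1"
  by (simp add: teichmuller_def one_witt_def wone_def[abs_def] flip: to_fract_1)

lemma teichmuller_power: "teichmuller (x ^ n) = teichmuller x ^ n"
  by (induction n) (simp_all add: teichmuller_mult teichmuller_1)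

text \<open>Under the identification of $\mathbb{F}_{q^k}^\times$ with $\mu_{q^k-1}$ by Teichmueller lifts,
  \<open>chi\<close> is the composition of $\omega^{-d}$ with the norm $y \mapsto \prod_{j<k} y^{q^j}$.\<close>

lemma chi_teichmuller:
  "chi q d k (\<chi> i. teichmuller (y i)) =
    (\<Prod>i\<in>UNIV. teichmuller (\<Prod>j<k. y i ^ (q ^ j)) powi (- (d $ i)))"
proof -
  have "teichmuller (\<Prod>j<k. y i ^ q ^ j) powi (- (d $ i)) =
      teichmuller (y i) powi (- (d $ i) * (\<Sum>j<k. int q ^ j))" for i
  proof -
    have "teichmuller (\<Prod>j<k. y i ^ q ^ j) = teichmuller (y i) powi int (\<Sum>j<k. q ^ j)"
      unfolding power_int_of_nat teichmuller_power[symmetric] by (simp add: power_sum)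
    then show ?thesis
      by (simp add: mult.commute flip: power_int_mult)
  qed
  then show ?thesis by (simp add: chi_def)
qed


section \<open>The $T$-adic exponential sum and its generating function\<close>

text \<open>The trace of multiplication by \<open>x\<close> on the finite free \<open>A\<close>-module \<open>B\<close>, computed from any
  basis \<open>e\<close> as the trace of the matrix \<open>M\<close>.\<close>

definition is_basis :: "'r::comm_ring_1 set \<Rightarrow> 'r set \<Rightarrow> nat \<Rightarrow> (nat \<Rightarrow> 'r) \<Rightarrow> bool" where
  "is_basis A B m e \<longleftrightarrow> (\<forall>i<m. e i \<in> B) \<and>
     (\<forall>y\<in>B. \<exists>!c. c \<in> {..<m} \<rightarrow>\<^sub>E A \<and> y = (\<Sum>i<m. c i * e i))"

definition ring_trace :: "'r::comm_ring_1 set \<Rightarrow> 'r set \<Rightarrow> 'r \<Rightarrow> 'r" where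
  "ring_trace A B x = (THE t. \<exists>m e M. is_basis A B m e \<and>
     (\<forall>j<m. (\<forall>i<m. M i j \<in> A) \<and> x * e j = (\<Sum>i<m. M i j * e i)) \<and> t = (\<Sum>i<m. M i i))"

text \<open>A Laurent polynomial is the finitely supported family of its coefficients.\<close>

definition laurent_eval :: "(int ^ 'n \<Rightarrow>\<^sub>0 'r) \<Rightarrow> 'r ^ 'n \<Rightarrow> 'r::field" where
  "laurent_eval f x =
     (\<Sum>u\<in>Poly_Mapping.keys f. Poly_Mapping.lookup f u * (\<Prod>i\<in>UNIV. (x $ i) powi (u $ i)))"

text \<open>Power series in \<open>T\<close> with coefficients in the fraction field; \<open>fps_binomial x\<close> is $(1+T)^x$.\<close>

definition exp_sum ::
  "nat \<Rightarrow> int ^ 'n \<Rightarrow> (int ^ 'n \<Rightarrow>\<^sub>0 'k::field_prime_char witt fract) \<Rightarrow> nat \<Rightarrow> 'k witt fract fps" where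
  "exp_sum q d f k = (\<Sum>x | \<forall>i. x $ i \<in> mu (q ^ k).
     fps_const (chi q d k x) *
     fps_binomial (ring_trace (Zq CHAR('k)) (Zq (q ^ k)) (laurent_eval f x)))"

text \<open>The outer variable is \<open>s\<close>, the inner one \<open>T\<close>. The library's \<open>fps_exp\<close> needs coefficients in a
  field, hence the explicit exponential series.\<close>

definition C_series ::
  "nat \<Rightarrow> int ^ 'n \<Rightarrow> (int ^ 'n \<Rightarrow>\<^sub>0 'k::field_prime_char witt fract) \<Rightarrow> 'k witt fract fps fps" where
  "C_series q d f =
     Abs_fps (\<lambda>m. fps_const (1 / fact m)) oo
     Abs_fps (\<lambda>k. if k = 0 then 0 else
       fps_const (- 1 / of_nat (q ^ k - 1) ^ CARD('n)) * exp_sum q d f k * fps_const (1 / of_nat k))"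

text \<open>\<open>subdegree 0 = 0\<close>, whereas $\mathrm{ord}_T(0) = \infty$: zero coefficients contribute no point.
  Where the hull has no point the value is \<open>Inf {} = \<infinity>\<close>.\<close>

definition newton_polygon :: "'a::zero fps fps \<Rightarrow> real \<Rightarrow> ereal" where
  "newton_polygon F t = Inf {ereal y |y.
     (t, y) \<in> convex hull {(real i, real (subdegree (fps_nth F i))) |i. fps_nth F i \<noteq> 0}}"


section \<open>The infinite twisted Hodge polygon\<close>

definition real_vec :: "int ^ 'n \<Rightarrow> real ^ 'n" where
  "real_vec u = (\<chi> i. of_int (u $ i))"

definition newton_polytope :: "(int ^ 'n \<Rightarrow>\<^sub>0 'r::zero) \<Rightarrow> (real ^ 'n) set" where
  "newton_polytope f = convex hull (insert 0 (real_vec ` Poly_Mapping.keys f))"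

text \<open>The degree function is determined on the cone over \<open>D\<close> by these properties; its values
  elsewhere are irrelevant.\<close>

definition is_degree_function :: "(real ^ 'n) set \<Rightarrow> (real ^ 'n \<Rightarrow> real) \<Rightarrow> bool" where
  "is_degree_function D g \<longleftrightarrow>
     (\<forall>x\<in>convex_cone hull D. \<forall>c\<ge>0. g (c *\<^sub>R x) = c * g x) \<and>
     (\<forall>\<delta>. \<delta> face_of D \<and> 0 \<notin> \<delta> \<longrightarrow>
        (\<forall>x\<in>\<delta>. g x = 1) \<and>
        (\<forall>x\<in>convex_cone hull \<delta>. \<forall>y\<in>convex_cone hull \<delta>. g (x + y) = g x + g y))"

definition deg_fun :: "(real ^ 'n) set \<Rightarrow> real ^ 'n \<Rightarrow> real" where
  "deg_fun D = (SOME g. is_degree_function D g)"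

definition M_set :: "(real ^ 'n) set \<Rightarrow> (int ^ 'n) set" where
  "M_set D = {u. real_vec u \<in> convex_cone hull D}"

definition M_twist :: "nat \<Rightarrow> (real ^ 'n) set \<Rightarrow> int ^ 'n \<Rightarrow> (real ^ 'n) set" where
  "M_twist q D d = {(1 / (real q - 1)) *\<^sub>R real_vec u |u.
     u \<in> M_set D \<and> (\<forall>j. [u $ j = d $ j] (mod (int q - 1)))}"

definition twist_order :: "nat \<Rightarrow> nat \<Rightarrow> int ^ 'n \<Rightarrow> nat" where
  "twist_order p q d = (LEAST b. b > 0 \<and> (\<forall>j. [int p ^ b * d $ j = d $ j] (mod (int q - 1))))"

definition twisted_points :: "nat \<Rightarrow> nat \<Rightarrow> (real ^ 'n) set \<Rightarrow> int ^ 'n \<Rightarrow> (real ^ 'n) set" where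
  "twisted_points p q D d = (\<Union>i<twist_order p q d. M_twist q D (\<chi> j. int p ^ i * d $ j))"

text \<open>An enumeration by nondecreasing degree, starting at index 0. The point set is either empty or
  infinite, and the sequence of degrees does not depend on the choice.\<close>

definition point_enum :: "nat \<Rightarrow> nat \<Rightarrow> (real ^ 'n) set \<Rightarrow> int ^ 'n \<Rightarrow> nat \<Rightarrow> real ^ 'n" where
  "point_enum p q D d = (SOME x. bij_betw x UNIV (twisted_points p q D d) \<and>
     incseq (\<lambda>i. deg_fun D (x i)))"

definition hodge_slope :: "nat \<Rightarrow> nat \<Rightarrow> (real ^ 'n) set \<Rightarrow> int ^ 'n \<Rightarrow> nat \<Rightarrow> real" where
  "hodge_slope p q D d i = (let b = twist_order p q d in
     1 / real b * (\<Sum>j<b. deg_fun D (point_enum p q D d (b * i + j))))"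

definition hodge_polygon :: "nat \<Rightarrow> nat \<Rightarrow> (real ^ 'n) set \<Rightarrow> int ^ 'n \<Rightarrow> real \<Rightarrow> ereal" where
  "hodge_polygon p q D d t =
     (if twisted_points p q D d = {} then (if t = 0 then 0 else \<infinity>)
      else let m = nat \<lfloor>t\<rfloor> in
        ereal ((\<Sum>i<m. hodge_slope p q D d i) + (t - real m) * hodge_slope p q D d m))"

end

theory Submission
  imports Defs "Jordan_Normal_Form.Determinant"
begin

text \<open>
  Only orders in $T$ occur in the statement, so the argument takes place over the power series ring
  $K[[T]]$ where $K$ is the fraction field of the Witt vectors, a field of characteristic 0. There
  $L = \log(1+T)$ is a series of order 1 and $(1+T)^z = \exp(zL)$ for all $z \in K$. For $x \in \mu_{q^k-1}^n$ the terms $z_u = a_u x^u$ of $f(x)$ are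
  Teichmueller elements and the trace of $f(x)$ is the sum of all $z_u^{p^t}$ with $t < ak$
  (\<open>ring_trace_frob_sum\<close>, \<open>trace_laurent_eval\<close>). Hence $\psi_{q^k}(f(x))$ is the product over
  $t < ak$ of $F_t(x^{p^t})$, where $F_t(x) = \prod_u \exp(a_u^{p^t} x^u L)$, and the coefficient of
  $x^v$ in $F_t$ has order at least $\deg v$. Modulo $T^N$ the exponential may be truncated, which
  makes every $F_t$ a Laurent polynomial and all sums below finite.

  Summing over $x$ with the character selects exponents (\<open>character_orthogonality\<close>). If these are
  written as telescoping sums of terms $p^t (p r_{t+1} - r_t)$, the result is Dwork's trace formula:
  $S_k / (q^k-1)^n$ is the trace of the $k$-th power of a product of $a$ matrices with entries
  $(F_t)_{p r' - r}$. These are assembled into one cyclic block matrix $B$ indexed by pairs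
  $(i, u)$ with $i < a$ and $u = (q-1) r$. Then $B^{ak}$ has trace $a S_k / (q^k-1)^n$, the other
  powers of $B$ have trace 0 (\<open>mpow_B\<close>, \<open>trace_level_0\<close>, \<open>exp_sum_cong\<close>), and Newton's
  identities give $C_{f,\chi}(s^a, T) = \det(1 - sB)$ modulo $T^N$ (\<open>fredholm_determinant\<close>).

  The coefficient of $s^{am}$ in $\det(1 - sB)$ is a sum of signed products of the entries
  $B(x, \pi x)$ over sets $S$ of $am$ indices and permutations $\pi$ of $S$. With $w(u) = \deg(u)/(q-1)$
  an entry of $B$ has order at least $p\,w(u') - w(u)$, because $\deg$ is subadditive. As $\pi$
  permutes $S$, the product has order at least $(p-1) \sum_S w$ (\<open>ord_C_series\<close>). Every twisted lattice
  point belongs to exactly $a/b$ of the $a$ levels, so the smallest such sum is at least $a$ times the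
  value of the Hodge polygon at $m$ (\<open>weight_bound\<close>). The Hodge polygon is convex, hence the maximum
  of its supporting lines, and a line below the vertices is below the Newton polygon.

  The degree function is specified by its behaviour on faces; on the cone it is the gauge of
  the polytope (\<open>deg_fun_eq_gauge\<close>), which is where subadditivity and the finiteness of its sublevel
  sets come from.
\<close>

section \<open>Newton's identities for $\det(1 - sB)$\<close>


lemma fps_deriv_prod:
  fixes g :: "'i \<Rightarrow> 'a::comm_ring_1 fps"
  assumes "finite S"
  shows "fps_deriv (\<Prod>i\<in>S. g i) = (\<Sum>i\<in>S. fps_deriv (g i) * (\<Prod>j\<in>S - {i}. g j))"
  using assms
proof (induction S)
  case (insert x S)
  have "(\<Prod>j\<in>insert x S - {i}. g j) = g x * (\<Prod>j\<in>S - {i}. g j)" if "i \<in> S" for i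
  proof -
    have "insert x S - {i} = insert x (S - {i})" using that insert by auto
    then show ?thesis using insert by simp
  qed
  then have "(\<Sum>i\<in>S. fps_deriv (g i) * (\<Prod>j\<in>insert x S - {i}. g j))
      = g x * (\<Sum>i\<in>S. fps_deriv (g i) * (\<Prod>j\<in>S - {i}. g j))"
    by (simp add: sum_distrib_left mult.left_commute)
  moreover have "insert x S - {x} = S" using insert by auto
  ultimately show ?case using insert by (simp add: algebra_simps)
qed simp

text \<open>Jacobi's formula. Differentiating the Leibniz expansion differentiates one row at a time; the
  determinant with row \<open>i\<close> differentiated is then expanded along that row, whose cofactors are those of
  \<open>N\<close>.\<close>

lemma fps_deriv_det:
  fixes N :: "'a::comm_ring_1 fps Matrix.mat"
  assumes N: "N \<in> carrier_mat n n"
  shows "fps_deriv (Determinant.det N) =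
    (\<Sum>i<n. \<Sum>j<n. fps_deriv (N $$ (i, j)) * cofactor N i j)"
proof -
  define R where "R i = Matrix.mat n n (\<lambda>(k, j). if k = i then fps_deriv (N $$ (i, j)) else N $$ (k, j))" for i
  have R: "R i \<in> carrier_mat n n" for i by (simp add: R_def)
  have "fps_deriv (Determinant.det N) = (\<Sum>\<pi>\<in>{\<pi>. \<pi> permutes {0..<n}}.
      signof \<pi> * (\<Sum>i\<in>{0..<n}. fps_deriv (N $$ (i, \<pi> i)) * (\<Prod>j\<in>{0..<n} - {i}. N $$ (j, \<pi> j))))"
    unfolding det_def'[OF N] fps_deriv_sum
    by (intro sum.cong refl) (simp add: fps_deriv_prod sign_def)
  also have "\<dots> = (\<Sum>i\<in>{0..<n}. \<Sum>\<pi>\<in>{\<pi>. \<pi> permutes {0..<n}}.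
      signof \<pi> * (fps_deriv (N $$ (i, \<pi> i)) * (\<Prod>j\<in>{0..<n} - {i}. N $$ (j, \<pi> j))))"
    unfolding sum_distrib_left by (rule sum.swap)
  also have "\<dots> = (\<Sum>i\<in>{0..<n}. Determinant.det (R i))"
  proof (intro sum.cong refl)
    fix i assume i: "i \<in> {0..<n}"
    have "fps_deriv (N $$ (i, \<pi> i)) * (\<Prod>j\<in>{0..<n} - {i}. N $$ (j, \<pi> j)) = (\<Prod>j=0..<n. R i $$ (j, \<pi> j))"
      if "\<pi> permutes {0..<n}" for \<pi>
    proof -
      have "\<pi> j < n" if "j < n" for j using \<open>\<pi> permutes _\<close> that by (metis atLeastLessThan_iff permutes_in_image zero_le)
      then have "(\<Prod>j=0..<n. R i $$ (j, \<pi> j)) = fps_deriv (N $$ (i, \<pi> i)) * (\<Prod>j\<in>{0..<n} - {i}. R i $$ (j, \<pi> j))"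
        using i by (subst prod.remove[of _ i]) (auto simp: R_def)
      moreover have "(\<Prod>j\<in>{0..<n} - {i}. R i $$ (j, \<pi> j)) = (\<Prod>j\<in>{0..<n} - {i}. N $$ (j, \<pi> j))"
        using \<open>\<And>j. j < n \<Longrightarrow> \<pi> j < n\<close> by (intro prod.cong) (auto simp: R_def)
      ultimately show ?thesis by simp
    qed
    then show "(\<Sum>\<pi>\<in>{\<pi>. \<pi> permutes {0..<n}}.
        signof \<pi> * (fps_deriv (N $$ (i, \<pi> i)) * (\<Prod>j\<in>{0..<n} - {i}. N $$ (j, \<pi> j)))) = Determinant.det (R i)"
      unfolding det_def'[OF R] by (intro sum.cong) auto
  qed
  also have "\<dots> = (\<Sum>i\<in>{0..<n}. \<Sum>j<n. fps_deriv (N $$ (i, j)) * cofactor N i j)"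
  proof (intro sum.cong refl)
    fix i assume i: "i \<in> {0..<n}"
    have "mat_delete (R i) i j = mat_delete N i j" if "j < n" for j
      using N i that by (auto simp: mat_delete_def R_def intro!: eq_matI)
    then show "Determinant.det (R i) = (\<Sum>j<n. fps_deriv (N $$ (i, j)) * cofactor N i j)"
      using i by (subst laplace_expansion_row[OF R, of i]) (auto simp: R_def cofactor_def intro!: sum.cong)
  qed
  finally show ?thesis by (simp add: atLeast0LessThan)
qed

text \<open>The powers of a matrix whose index set is a finite set rather than a type or an initial segment of
  the naturals: the matrix of interest is indexed by lattice points in a set that depends on the
  truncation.\<close>

primrec mpow :: "'x set \<Rightarrow> ('x \<Rightarrow> 'x \<Rightarrow> 'r::comm_ring_1) \<Rightarrow> nat \<Rightarrow> 'x \<Rightarrow> 'x \<Rightarrow> 'r" where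
  "mpow X b 0 x y = (if x = y then 1 else 0)"
| "mpow X b (Suc k) x y = (\<Sum>z\<in>X. mpow X b k x z * b z y)"

lemma prod_fps_const: "(\<Prod>i\<in>S. fps_const (g i)) = fps_const (\<Prod>i\<in>S. g i :: 'a::comm_ring_1)"
  by (induction S rule: infinite_finite_induct) auto

text \<open>The matrix \<open>1 - s b\<close> has the inverse $\sum_k s^k b^k$, so its adjugate is the determinant times this
  series, and Jacobi's formula turns into Newton's identities. The last claim expands the Leibniz
  formula: \<open>S\<close> is the set of rows that contribute \<open>- s b\<close> instead of the 1 on the diagonal.\<close>

lemma fredholm_index:
  fixes b :: "nat \<Rightarrow> nat \<Rightarrow> 'a::comm_ring_1" and n :: nat
  defines "D \<equiv> Determinant.det (Matrix.mat n n (\<lambda>(i, j). (if i = j then 1 else 0) - fps_X * fps_const (b i j)))"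
  shows "fps_nth D 0 = 1"
    and "of_nat (Suc m) * fps_nth D (Suc m) =
      - (\<Sum>k\<le>m. (\<Sum>i<n. mpow {..<n} b (Suc k) i i) * fps_nth D (m - k))"
    and "fps_nth D m = (\<Sum>\<pi>\<in>{\<pi>. \<pi> permutes {0..<n}}. \<Sum>S\<in>{S. S \<subseteq> {0..<n} \<and> card S = m \<and> (\<forall>i\<in>{0..<n} - S. \<pi> i = i)}.
       of_int (sign \<pi>) * (-1) ^ m * (\<Prod>i\<in>S. b i (\<pi> i)))"
proof -
  define N where "N = Matrix.mat n n (\<lambda>(i, j). (if i = j then 1 else 0) - fps_X * fps_const (b i j))"
  have N: "N \<in> carrier_mat n n" by (simp add: N_def)
  have D: "D = Determinant.det N" by (simp add: D_def N_def)
  show form: "fps_nth D m = (\<Sum>\<pi>\<in>{\<pi>. \<pi> permutes {0..<n}}. \<Sum>S\<in>{S. S \<subseteq> {0..<n} \<and> card S = m \<and> (\<forall>i\<in>{0..<n} - S. \<pi> i = i)}.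
       of_int (sign \<pi>) * (-1) ^ m * (\<Prod>i\<in>S. b i (\<pi> i)))" for m
  proof -
    have "fps_nth (signof \<pi> * (\<Prod>i=0..<n. N $$ (i, \<pi> i))) m =
      (\<Sum>S\<in>{S. S \<subseteq> {0..<n} \<and> card S = m \<and> (\<forall>i\<in>{0..<n} - S. \<pi> i = i)}.
       of_int (sign \<pi>) * (-1) ^ m * (\<Prod>i\<in>S. b i (\<pi> i)))" (is "?l = ?r") if \<pi>: "\<pi> permutes {0..<n}" for \<pi>
    proof -
      have \<pi>n: "\<pi> j < n" if "j < n" for j using \<pi> that by (metis atLeastLessThan_iff permutes_in_image zero_le)
      have sg: "signof \<pi> = fps_const (of_int (sign \<pi>) :: 'a)"
        by (simp add: sign_def flip: fps_const_neg)
      have "(\<Prod>i=0..<n. N $$ (i, \<pi> i)) = (\<Prod>i=0..<n. fps_X * fps_const (- b i (\<pi> i)) + (if i = \<pi> i then 1 else 0))"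
        using \<pi>n by (intro prod.cong) (auto simp: N_def simp flip: fps_const_neg)
      also have "\<dots> = (\<Sum>S\<in>Pow {0..<n}. (\<Prod>i\<in>S. fps_X * fps_const (- b i (\<pi> i))) *
          (\<Prod>i\<in>{0..<n} - S. if i = \<pi> i then 1 else 0))"
        by (rule prod_add) simp
      also have "\<dots> = (\<Sum>S\<in>Pow {0..<n}. fps_const ((-1) ^ card S * (\<Prod>i\<in>S. b i (\<pi> i)) *
           (if \<forall>i\<in>{0..<n} - S. \<pi> i = i then 1 else 0)) * fps_X ^ card S)"
      proof (intro sum.cong refl)
        fix S assume "S \<in> Pow {0..<n}"
        have 1: "(\<Prod>i\<in>S. fps_X * fps_const (- b i (\<pi> i))) = fps_X ^ card S * fps_const (\<Prod>i\<in>S. - b i (\<pi> i))"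
          by (simp only: prod.distrib prod_fps_const prod_constant)
        have 2: "(\<Prod>i\<in>S. - b i (\<pi> i)) = (-1) ^ card S * (\<Prod>i\<in>S. b i (\<pi> i))"
          using prod_uminus[of "\<lambda>i. b i (\<pi> i)" S] by simp
        have 3: "(\<Prod>i\<in>{0..<n} - S. if i = \<pi> i then 1 else 0) =
            fps_const (if \<forall>i\<in>{0..<n} - S. \<pi> i = i then 1 else 0 :: 'a)"
        proof (cases "\<forall>i\<in>{0..<n} - S. \<pi> i = i")
          case True
          then show ?thesis by (subst prod.neutral) auto
        next
          case False
          then obtain i where "i \<in> {0..<n} - S" "\<pi> i \<noteq> i" by blast
          then have "(\<Prod>i\<in>{0..<n} - S. if i = \<pi> i then 1 else 0 :: 'a fps) = 0"
            by (intro prod_zero) (auto intro!: bexI[of _ i])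
          then show ?thesis using False by simp
        qed
        show "(\<Prod>i\<in>S. fps_X * fps_const (- b i (\<pi> i))) * (\<Prod>i\<in>{0..<n} - S. if i = \<pi> i then 1 else 0) =
          fps_const ((-1) ^ card S * (\<Prod>i\<in>S. b i (\<pi> i)) *
           (if \<forall>i\<in>{0..<n} - S. \<pi> i = i then 1 else 0)) * fps_X ^ card S"
          unfolding 1 2 3 fps_const_mult[symmetric] by (simp only: mult_ac)
      qed
      finally have "?l = of_int (sign \<pi>) * (\<Sum>S\<in>Pow {0..<n}. if m = card S then ((-1) ^ card S * (\<Prod>i\<in>S. b i (\<pi> i)) *
           (if \<forall>i\<in>{0..<n} - S. \<pi> i = i then 1 else 0)) else 0)"
        unfolding sg by (simp add: fps_sum_nth fps_X_power_nth if_distrib[of "\<lambda>x. _ * x"] cong: if_cong del: of_int_mult mult_eq_if)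
      also have "\<dots> = ?r"
        unfolding sum_distrib_left
        by (intro sum.mono_neutral_cong_right) (auto simp: mult.assoc)
      finally show ?thesis .
    qed
    then show ?thesis unfolding D det_def'[OF N] fps_sum_nth by (intro sum.cong) auto
  qed
  have "{S. S \<subseteq> {0..<n} \<and> card S = 0 \<and> (\<forall>i\<in>{0..<n} - S. \<pi> i = i)} = (if \<forall>i\<in>{0..<n}. \<pi> i = i then {{}} else {})" for \<pi> :: "nat \<Rightarrow> nat"
  proof -
    have "S = {}" if "S \<subseteq> {0..<n}" "card S = 0" for S
      using that by (metis card_0_eq finite_atLeastLessThan finite_subset)
    then show ?thesis by auto
  qed
  moreover have "(\<forall>i\<in>{0..<n}. \<pi> i = i) \<longleftrightarrow> \<pi> = id" if "\<pi> permutes {0..<n}" for \<pi>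
    using that by (auto simp: permutes_def fun_eq_iff)
  ultimately have "fps_nth D 0 = (\<Sum>\<pi>\<in>{\<pi>. \<pi> permutes {0..<n}}. if \<pi> = id then 1 else 0)"
    unfolding form by (intro sum.cong) (auto simp: sign_id)
  then show "fps_nth D 0 = 1"
    by (simp add: finite_permutations permutes_id)
  define G where "G = Matrix.mat n n (\<lambda>(i, j). Abs_fps (\<lambda>k. mpow {..<n} b k i j))"
  have G: "G \<in> carrier_mat n n" by (simp add: G_def)
  have GN: "G * N = 1\<^sub>m n"
  proof (rule eq_matI)
    fix i j assume "i < dim_row (1\<^sub>m n :: 'a fps Matrix.mat)" "j < dim_col (1\<^sub>m n :: 'a fps Matrix.mat)"
    then have ij: "i < n" "j < n" by auto
    have "(G * N) $$ (i, j) = (\<Sum>l = 0..<n. Abs_fps (\<lambda>k. mpow {..<n} b k i l) * ((if l = j then 1 else 0) - fps_X * fps_const (b l j)))"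
      using ij by (simp add: G_def N_def scalar_prod_def)
    also have "\<dots> = Abs_fps (\<lambda>k. mpow {..<n} b k i j) - fps_X * (\<Sum>l = 0..<n. Abs_fps (\<lambda>k. mpow {..<n} b k i l) * fps_const (b l j))"
    proof -
      have "(\<Sum>l = 0..<n. Abs_fps (\<lambda>k. mpow {..<n} b k i l) * (if l = j then 1 else 0)) =
          (\<Sum>l = 0..<n. if l = j then Abs_fps (\<lambda>k. mpow {..<n} b k i l) else 0)"
        by (intro sum.cong) auto
      then show ?thesis using ij
        by (simp add: right_diff_distrib sum_subtractf sum_distrib_left mult_ac)
    qed
    also have "\<dots> = (if i = j then 1 else 0)"
    proof (rule fps_ext)
      fix k
      show "fps_nth (Abs_fps (\<lambda>k. mpow {..<n} b k i j) - fps_X * (\<Sum>l = 0..<n. Abs_fps (\<lambda>k. mpow {..<n} b k i l) * fps_const (b l j))) k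
        = fps_nth (if i = j then 1 else 0) k"
        by (cases k) (auto simp: fps_sum_nth atLeast0LessThan)
    qed
    finally show "(G * N) $$ (i, j) = (1\<^sub>m n) $$ (i, j)" using ij by simp
  qed (use G N in auto)
  have A: "adj_mat N \<in> carrier_mat n n" by (rule adj_mat[OF N])
  have "adj_mat N = G * N * adj_mat N" using GN A by simp
  also have "\<dots> = G * (Determinant.det N \<cdot>\<^sub>m 1\<^sub>m n)"
    using adj_mat[OF N] G N by (simp add: assoc_mult_mat[OF G N A])
  also have "\<dots> = Determinant.det N \<cdot>\<^sub>m G" using G
    by (simp add: mult_smult_distrib[OF G one_carrier_mat])
  finally have "adj_mat N = D \<cdot>\<^sub>m G" unfolding D .
  then have cof: "cofactor N i j = D * Abs_fps (\<lambda>k. mpow {..<n} b k j i)" if "i < n" "j < n" for i j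
    using that N by (auto simp: adj_mat_def G_def dest!: arg_cong[where f = "\<lambda>A. A $$ (j, i)"])
  have "fps_deriv D = (\<Sum>i<n. \<Sum>j<n. - (fps_const (b i j) * (D * Abs_fps (\<lambda>k. mpow {..<n} b k j i))))"
  proof -
    have "fps_deriv (N $$ (i, j)) = - fps_const (b i j)" if "i < n" "j < n" for i j
      using that by (simp add: N_def del: fps_const_neg)
    then show ?thesis
      by (simp add: D fps_deriv_det[OF N] cof[unfolded D] del: fps_const_neg)
  qed
  also have "\<dots> = - D * (\<Sum>j<n. \<Sum>i<n. fps_const (b i j) * Abs_fps (\<lambda>k. mpow {..<n} b k j i))"
    by (subst sum.swap) (simp add: sum_distrib_left sum_negf mult_ac)
  also have "(\<Sum>j<n. \<Sum>i<n. fps_const (b i j) * Abs_fps (\<lambda>k. mpow {..<n} b k j i))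
      = Abs_fps (\<lambda>k. \<Sum>j<n. mpow {..<n} b (Suc k) j j)"
    by (rule fps_ext) (simp add: fps_sum_nth mult_ac)
  finally have "fps_nth (fps_deriv D) m = - (\<Sum>i=0..m. (\<Sum>j<n. mpow {..<n} b (Suc i) j j) * fps_nth D (m - i))"
    by (simp add: mult.commute[of D] fps_mult_nth)
  then show "of_nat (Suc m) * fps_nth D (Suc m) =
      - (\<Sum>k\<le>m. (\<Sum>i<n. mpow {..<n} b (Suc k) i i) * fps_nth D (m - k))"
    by (simp add: atMost_atLeast0)
qed

lemma mpow_reindex:
  assumes "bij_betw e Y X" "x \<in> Y" "y \<in> Y"
  shows "mpow X b k (e x) (e y) = mpow Y (\<lambda>x y. b (e x) (e y)) k x y"
  using assms(3)
proof (induction k arbitrary: y)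
  case 0
  then show ?case using assms by (auto simp: bij_betw_def inj_on_def)
next
  case (Suc k)
  have "(\<Sum>z\<in>X. mpow X b k (e x) z * b z (e y)) = (\<Sum>z\<in>Y. mpow X b k (e x) (e z) * b (e z) (e y))"
    using assms(1) by (rule sum.reindex_bij_betw[symmetric])
  then show ?case using Suc by simp
qed

text \<open>The Leibniz expansion of a coefficient is stated through an arbitrary property \<open>H\<close> closed under sums
  and negation. This hides signs and multiplicities, and bounds on the order in $T$ are of this kind.\<close>

theorem fredholm_determinant:
  fixes b :: "'x \<Rightarrow> 'x \<Rightarrow> 'r::comm_ring_1"
  assumes "finite X"
  shows "\<exists>D :: nat \<Rightarrow> 'r. D 0 = 1
    \<and> (\<forall>m. of_nat (Suc m) * D (Suc m) = - (\<Sum>k\<le>m. (\<Sum>x\<in>X. mpow X b (Suc k) x x) * D (m - k)))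
    \<and> (\<forall>m H. H 0 \<longrightarrow> (\<forall>u v. H u \<longrightarrow> H v \<longrightarrow> H (u + v)) \<longrightarrow> (\<forall>u. H u \<longrightarrow> H (- u)) \<longrightarrow>
      (\<forall>S \<pi>. S \<subseteq> X \<longrightarrow> card S = m \<longrightarrow> bij_betw \<pi> S S \<longrightarrow> H (\<Prod>x\<in>S. b x (\<pi> x))) \<longrightarrow> H (D m))"
proof -
  obtain e where e: "bij_betw e {0..<card X} X" using ex_bij_betw_nat_finite[OF assms] by blast
  define n where "n = card X"
  have e': "bij_betw e {..<n} X" using e by (simp add: n_def atLeast0LessThan)
  define c where "c = (\<lambda>i j. b (e i) (e j))"
  define D where "D = fps_nth (Determinant.det (Matrix.mat n n (\<lambda>(i, j). (if i = j then 1 else 0) - fps_X * fps_const (c i j))))"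
  have tr: "(\<Sum>x\<in>X. mpow X b k x x) = (\<Sum>i<n. mpow {..<n} c k i i)" for k
    unfolding c_def
    by (subst sum.reindex_bij_betw[OF e', symmetric]) (auto intro!: sum.cong mpow_reindex[OF e'])
  show ?thesis
  proof (intro exI[of _ D] conjI allI impI)
    show "D 0 = 1" unfolding D_def by (rule fredholm_index)
    show "of_nat (Suc m) * D (Suc m) = - (\<Sum>k\<le>m. (\<Sum>x\<in>X. mpow X b (Suc k) x x) * D (m - k))" for m
      unfolding D_def tr by (rule fredholm_index)
    fix m and H :: "'r \<Rightarrow> bool"
    assume H0: "H 0" and "\<forall>u v. H u \<longrightarrow> H v \<longrightarrow> H (u + v)" and "\<forall>u. H u \<longrightarrow> H (- u)"
      and "\<forall>S \<pi>. S \<subseteq> X \<longrightarrow> card S = m \<longrightarrow> bij_betw \<pi> S S \<longrightarrow> H (\<Prod>x\<in>S. b x (\<pi> x))"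
    then have Ha: "H u \<Longrightarrow> H v \<Longrightarrow> H (u + v)" and Hm: "H u \<Longrightarrow> H (- u)"
      and HS: "S \<subseteq> X \<Longrightarrow> card S = m \<Longrightarrow> bij_betw \<pi> S S \<Longrightarrow> H (\<Prod>x\<in>S. b x (\<pi> x))" for u v S \<pi>
      by blast+
    have Hs: "H (\<Sum>x\<in>A. g x)" if "\<And>x. x \<in> A \<Longrightarrow> H (g x)" for A and g :: "'z \<Rightarrow> 'r"
      using that by (induction A rule: infinite_finite_induct) (auto intro: H0 Ha)
    show "H (D m)" unfolding D_def fredholm_index(3)
    proof (intro Hs)
      fix \<pi> S assume "\<pi> \<in> {\<pi>. \<pi> permutes {0..<n}}" and "S \<in> {S. S \<subseteq> {0..<n} \<and> card S = m \<and> (\<forall>i\<in>{0..<n} - S. \<pi> i = i)}"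
      then have \<pi>: "\<pi> permutes {0..<n}" and S: "S \<subseteq> {0..<n}" "card S = m" "\<And>i. i \<in> {0..<n} - S \<Longrightarrow> \<pi> i = i" by auto
      have inj: "inj \<pi>" using \<pi> by (rule permutes_inj)
      have fin: "finite S" using S finite_subset by blast
      have "\<pi> i \<in> S" if "i \<in> S" for i
      proof (rule ccontr)
        assume *: "\<pi> i \<notin> S"
        have "\<pi> i \<in> {0..<n}" using permutes_in_image[OF \<pi>, of i] that S(1) by auto
        then have "\<pi> (\<pi> i) = \<pi> i" using * S(3) by blast
        then have "\<pi> i = i" by (rule injD[OF inj])
        then show False using * that by simp
      qed
      then have "\<pi> ` S \<subseteq> S" by blast
      moreover have injS: "inj_on \<pi> S" using inj by (rule inj_on_subset) simp
      ultimately have bij: "bij_betw \<pi> S S"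
        using endo_inj_surj[OF fin] by (simp add: bij_betw_def)
      have eS: "bij_betw e S (e ` S)" using e S(1) by (auto simp: bij_betw_def n_def intro: inj_on_subset)
      let ?\<pi> = "e \<circ> \<pi> \<circ> inv_into S e"
      have "bij_betw ?\<pi> (e ` S) (e ` S)"
        by (rule bij_betw_trans[OF bij_betw_inv_into[OF eS] bij_betw_trans[OF bij eS]])
      moreover have "card (e ` S) = m" using bij_betw_same_card[OF eS] S(2) by simp
      moreover have "e ` S \<subseteq> X" using e S(1) by (auto simp: bij_betw_def n_def)
      ultimately have "H (\<Prod>x\<in>e ` S. b x (?\<pi> x))" by (intro HS)
      also have "(\<Prod>x\<in>e ` S. b x (?\<pi> x)) = (\<Prod>i\<in>S. c i (\<pi> i))"
        using eS by (subst prod.reindex) (auto simp: bij_betw_def c_def)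
      finally have "H (\<Prod>i\<in>S. c i (\<pi> i))" .
      moreover have "of_int (sign \<pi>) * (-1) ^ m * (\<Prod>i\<in>S. c i (\<pi> i)) \<in> {\<Prod>i\<in>S. c i (\<pi> i), - (\<Prod>i\<in>S. c i (\<pi> i))}"
        by (cases "even m") (auto simp: sign_def)
      ultimately show "H (of_int (sign \<pi>) * (-1) ^ m * (\<Prod>i\<in>S. c i (\<pi> i)))" using Hm by auto
    qed
  qed
qed


section \<open>Frobenius and Verschiebung on Witt vectors\<close>

definition witt_frob :: "'k::field_prime_char witt \<Rightarrow> 'k witt" where
  "witt_frob w = Witt (\<lambda>i. witt_nth w i ^ CHAR('k))"

definition witt_ver :: "'k::field_prime_char witt \<Rightarrow> 'k witt" where
  "witt_ver w = Witt (wver (witt_nth w))"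

definition witt_teich :: "'k::field_prime_char \<Rightarrow> 'k witt" where
  "witt_teich x = Witt (\<lambda>i. if i = 0 then x else 0)"

lemma teichmuller_eq: "teichmuller x = to_fract (witt_teich x)"
  by (simp add: teichmuller_def witt_teich_def)

lemma witt_nth_teich: "witt_nth (witt_teich x) i = (if i = 0 then x else 0)"
  by (simp add: witt_teich_def)

lemma witt_frob_wfrob:
  fixes w :: "'k::field_prime_char witt"
  shows "witt_frob w = Witt (wfrob CHAR('k) (witt_nth w))"
proof -
  have "wfrob CHAR('k) (witt_nth w) i = witt_nth w i ^ CHAR('k)" for i
    by (rule wfrob_char) auto
  then show ?thesis by (simp add: witt_frob_def fun_eq_iff)
qed

text \<open>On ghost components Frobenius is the shift and Verschiebung is multiplication by \<open>p\<close> after the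
  inverse shift, so all four identities are evident there.\<close>

lemma generic_frob:
  fixes x y :: "nat \<Rightarrow> 'a::comm_ring_1"
  assumes p: "prime p"
  shows "wfrob p (wadd p x y) = wadd p (wfrob p x) (wfrob p y)"
    and "wfrob p (wmult p x y) = wmult p (wfrob p x) (wfrob p y)"
    and "wfrob p (wone :: nat \<Rightarrow> 'a) = wone"
    and "wver (wadd p x y) = wadd p (wver x) (wver y)"
proof -
  have p0: "p > 0" using p prime_gt_0_nat by blast
  let ?X = "ivar 0" and ?Y = "ivar 1"
  note s = ghost_w[OF p] wfrob_ghost[OF p] eval_w eval_wfrob eval_wver ghost_wver[OF p0] p0
  show "wfrob p (wadd p x y) = wadd p (wfrob p x) (wfrob p y)"
    using generic[of p "wfrob p (wadd p ?X ?Y)" "wadd p (wfrob p ?X) (wfrob p ?Y)" x y y] by (simp add: s)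
  show "wfrob p (wmult p x y) = wmult p (wfrob p x) (wfrob p y)"
    using generic[of p "wfrob p (wmult p ?X ?Y)" "wmult p (wfrob p ?X) (wfrob p ?Y)" x y y] by (simp add: s)
  show "wfrob p (wone :: nat \<Rightarrow> 'a) = wone"
    using generic[of p "wfrob p wone" "wone" x y y] by (simp add: s)
  show "wver (wadd p x y) = wadd p (wver x) (wver y)"
    using generic[of p "wver (wadd p ?X ?Y)" "wadd p (wver ?X) (wver ?Y)" x y y]
    by (simp add: s distrib_left split: nat.split)
qed

lemma witt_frob_hom:
  fixes x y :: "'k::field_prime_char witt"
  shows "witt_frob (x + y) = witt_frob x + witt_frob y"
    and "witt_frob (x * y) = witt_frob x * witt_frob y"
    and "witt_frob (0 :: 'k witt) = 0" and "witt_frob (1 :: 'k witt) = 1"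
proof -
  have "prime CHAR('k)" by simp
  note g = generic_frob[OF this]
  show "witt_frob (x + y) = witt_frob x + witt_frob y"
    by (simp add: witt_frob_wfrob plus_witt_def g)
  show "witt_frob (x * y) = witt_frob x * witt_frob y"
    by (simp add: witt_frob_wfrob times_witt_def g)
  show "witt_frob (1 :: 'k witt) = 1"
    by (simp add: witt_frob_wfrob one_witt_def g)
  show "witt_frob (0 :: 'k witt) = 0"
    by (simp add: witt_frob_def zero_witt_def power_0_left)
qed

lemma witt_frob_sum: "witt_frob (\<Sum>i\<in>I. g i) = (\<Sum>i\<in>I. witt_frob (g i))"
  by (induction I rule: infinite_finite_induct) (auto simp: witt_frob_hom)

lemma witt_frob_pow_hom:
  "(witt_frob ^^ n) (x + y) = (witt_frob ^^ n) x + (witt_frob ^^ n) y"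
  "(witt_frob ^^ n) (x * y) = (witt_frob ^^ n) x * (witt_frob ^^ n) y"
  "(witt_frob ^^ n) 0 = 0" "(witt_frob ^^ n) 1 = 1"
  "(witt_frob ^^ n) (\<Sum>i\<in>I. g i) = (\<Sum>i\<in>I. (witt_frob ^^ n) (g i))"
  by (induction n) (simp_all add: witt_frob_hom witt_frob_sum)

lemma witt_frob_pow_uminus: "(witt_frob ^^ n) (- x) = - (witt_frob ^^ n) x"
proof -
  have "(witt_frob ^^ n) (- x) + (witt_frob ^^ n) x = 0"
    by (simp flip: witt_frob_pow_hom(1) add: witt_frob_pow_hom(3))
  then show ?thesis by (simp add: eq_neg_iff_add_eq_0)
qed

lemma witt_nth_frob_pow:
  fixes w :: "'k::field_prime_char witt"
  shows "witt_nth ((witt_frob ^^ n) w) i = witt_nth w i ^ (CHAR('k) ^ n)"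
  by (induction n) (simp_all add: witt_frob_def flip: power_mult add: mult.commute)

lemma witt_eqI: "(\<And>i. witt_nth x i = witt_nth y i) \<Longrightarrow> x = y"
  by (metis ext witt.collapse)

lemma witt_nth_ver: "witt_nth (witt_ver w) i = (case i of 0 \<Rightarrow> 0 | Suc j \<Rightarrow> witt_nth w j)"
  by (simp add: witt_ver_def wver_def)

lemma witt_nth_0_hom:
  fixes x y :: "'k::field_prime_char witt"
  shows "witt_nth (x + y) 0 = witt_nth x 0 + witt_nth y 0"
    and "witt_nth (x * y) 0 = witt_nth x 0 * witt_nth y 0"
    and "witt_nth (0 :: 'k witt) i = 0"
    and "witt_nth (- x) 0 = - witt_nth x 0"
    and "witt_nth (x - y) 0 = witt_nth x 0 - witt_nth y 0"
proof -
  show 1: "witt_nth (x + y) 0 = witt_nth x 0 + witt_nth y 0" for x y :: "'k witt"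
    by (simp add: plus_witt_def w_nth_0)
  show "witt_nth (x * y) 0 = witt_nth x 0 * witt_nth y 0"
    by (simp add: times_witt_def w_nth_0)
  show 0: "witt_nth (0 :: 'k witt) i = 0" for i by (simp add: zero_witt_def)
  have "witt_nth (- x) 0 + witt_nth x 0 = 0" for x :: "'k witt"
    using 0 by (simp flip: 1)
  then show 2: "witt_nth (- x) 0 = - witt_nth x 0" for x :: "'k witt" by (simp add: eq_neg_iff_add_eq_0)
  show "witt_nth (x - y) 0 = witt_nth x 0 - witt_nth y 0" unfolding minus_witt_def 1 2 by simp
qed

lemma witt_nth_0_sum:
  fixes g :: "'i \<Rightarrow> 'k::field_prime_char witt"
  shows "witt_nth (\<Sum>i\<in>I. g i) 0 = (\<Sum>i\<in>I. witt_nth (g i) 0)"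
  by (induction I rule: infinite_finite_induct) (auto simp: witt_nth_0_hom)

text \<open>In characteristic \<open>p\<close> the Witt vector \<open>p\<close> is the Verschiebung of 1, and $V(1) x = V(F(x))$.\<close>

lemma prime_times_witt:
  fixes x :: "'k::field_prime_char witt"
  shows "of_nat CHAR('k) * x = witt_ver (witt_frob x)"
proof -
  let ?p = "CHAR('k)"
  have p: "prime ?p" by simp
  have "wnat ?p ?p = (wver wone :: nat \<Rightarrow> 'k)"
  proof
    fix n
    show "wnat ?p ?p n = (wver wone n :: 'k)"
      unfolding wnat_p[OF p] by (subst wfrob_char) (auto simp: wver_def wone_def power_0_left split: nat.split)
  qed
  then have "of_nat ?p = witt_ver (1 :: 'k witt)"
    by (intro witt_eqI) (simp add: of_nat_witt witt_ver_def one_witt_def)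
  then show ?thesis
    by (simp add: witt_ver_def times_witt_def one_witt_def wver_mult[OF p] witt_frob_wfrob w_ring(7)[OF p])
qed

text \<open>Splitting off the first coordinate does not change the others: both sides have the same ghost
  components.\<close>

lemma witt_decompose:
  fixes w :: "'k::field_prime_char witt"
  shows "w = witt_teich (witt_nth w 0) + witt_ver (Witt (\<lambda>i. witt_nth w (Suc i)))"
proof -
  let ?p = "CHAR('k)"
  have p: "prime ?p" and p0: "?p > 0" by (simp_all add: prime_gt_0_nat)
  define t :: "nat \<Rightarrow> ipoly" where "t = (\<lambda>i. if i = 0 then ivar 0 0 else 0)"
  define u :: "nat \<Rightarrow> ipoly" where "u = (\<lambda>i. ivar 0 (Suc i))"
  have gt: "ghost ?p t n = ivar 0 0 ^ ?p ^ n" for n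
  proof -
    have "ghost ?p t n = (\<Sum>i\<le>n. if i = 0 then ivar 0 0 ^ ?p ^ n else 0)"
      unfolding ghost_def t_def using p0 by (intro sum.cong) (auto simp: power_0_left)
    then show ?thesis by simp
  qed
  have gu: "ghost ?p (ivar 0) n = ghost ?p t n + ghost ?p (wver u) n" for n
  proof (cases n)
    case 0
    then show ?thesis by (simp add: gt ghost_wver[OF p0]) (simp add: ghost_def)
  next
    case (Suc m)
    have "ghost ?p (ivar 0) (Suc m) = ivar 0 0 ^ ?p ^ Suc m + of_nat ?p * ghost ?p u m"
      by (simp add: ghost_def sum.atMost_Suc_shift sum_distrib_left u_def mult.assoc
          del: sum.atMost_Suc)
    then show ?thesis by (simp add: Suc gt ghost_wver[OF p0])
  qed
  have *: "(\<lambda>n. ipoly_eval (wtriple (witt_nth w) (witt_nth w) (witt_nth w)) (ivar 0 n)) =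
     (\<lambda>n. ipoly_eval (wtriple (witt_nth w) (witt_nth w) (witt_nth w)) (wadd ?p t (wver u) n))"
    by (rule generic[OF p0]) (simp only: ghost_w[OF p] gu)
  have "witt_nth w = wadd ?p (\<lambda>i. if i = 0 then witt_nth w 0 else 0) (wver (\<lambda>i. witt_nth w (Suc i)))"
  proof -
    have "ipoly_eval v (if i = 0 then z else 0) = (if i = 0 then ipoly_eval v z else (0 :: 'k))" for v z and i :: nat
      by simp
    then have "(\<lambda>n. ipoly_eval (wtriple (witt_nth w) (witt_nth w) (witt_nth w)) (wadd ?p t (wver u) n)) =
        wadd ?p (\<lambda>i. if i = 0 then witt_nth w 0 else 0) (wver (\<lambda>i. witt_nth w (Suc i)))"
      by (simp add: eval_w eval_wver t_def u_def cong: if_cong)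
    moreover have "(\<lambda>n. ipoly_eval (wtriple (witt_nth w) (witt_nth w) (witt_nth w)) (ivar 0 n)) = witt_nth w"
      by simp
    ultimately show ?thesis by (rule trans[OF sym trans[OF *], rotated])
  qed
  then have "Witt (witt_nth w) = Witt (wadd ?p (\<lambda>i. if i = 0 then witt_nth w 0 else 0) (wver (\<lambda>i. witt_nth w (Suc i))))"
    by (rule arg_cong)
  also have "\<dots> = witt_teich (witt_nth w 0) + witt_ver (Witt (\<lambda>i. witt_nth w (Suc i)))"
    by (simp add: plus_witt_def witt_ver_def witt_teich_def)
  finally show ?thesis unfolding witt.collapse .
qed

lemma witt_frob_pow_teich:
  fixes x :: "'k::field_prime_char"
  shows "(witt_frob ^^ n) (witt_teich x) = witt_teich (x ^ (CHAR('k) ^ n))"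
  by (rule witt_eqI) (simp add: witt_nth_frob_pow witt_nth_teich power_0_left)


section \<open>Finite fields and roots of unity\<close>

text \<open>The linear factors are distinct, since a double root would be a root of the derivative.\<close>

lemma card_roots_separable:
  fixes P :: "'a::alg_closed_field poly"
  assumes "P \<noteq> 0" and sep: "\<And>x. poly P x = 0 \<Longrightarrow> poly (pderiv P) x \<noteq> 0"
  shows "card {x. poly P x = 0} = degree P"
proof -
  obtain A where A: "size A = degree P" "P = Polynomial.smult (lead_coeff P) (\<Prod>x\<in>#A. [:-x, 1:])"
    using alg_closed_imp_factorization[OF assms(1)] by blast
  have lc: "lead_coeff P \<noteq> 0" using assms(1) by simp
  have roots: "{x. poly P x = 0} = set_mset A"
  proof -
    have "poly P x = lead_coeff P * (\<Prod>y\<in>#A. x - y)" for x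
      by (subst A(2)) (simp add: poly_prod_mset)
    then show ?thesis using lc by (auto simp: prod_mset_zero_iff)
  qed
  have "count A x = 1" if x: "x \<in># A" for x
  proof (rule ccontr)
    assume "count A x \<noteq> 1"
    moreover have "count A x > 0" using x by (simp add: count_greater_zero_iff)
    ultimately have "count A x \<ge> 2" by linarith
    then have "x \<in># A - {#x#}" by (simp flip: count_greater_zero_iff)
    then obtain B where "A = add_mset x (add_mset x B)"
      using x by (metis insert_DiffM)
    then have "\<exists>R. P = [:-x, 1:] * ([:-x, 1:] * R)"
      using A(2) by (intro exI[of _ "Polynomial.smult (lead_coeff P) (\<Prod>y\<in>#B. [:-y, 1:])"])
        (simp only: image_mset_add_mset prod_mset.add_mset mult_smult_right)
    then obtain R where R: "P = [:-x, 1:] * ([:-x, 1:] * R)" by blast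
    have "poly (pderiv P) x = 0" "poly P x = 0"
      unfolding R pderiv_mult by simp_all
    then show False using sep by blast
  qed
  then have "A = mset_set (set_mset A)"
    by (intro multiset_eqI) (auto simp: count_mset_set' not_in_iff)
  then have "size A = card (set_mset A)" by (metis size_mset_set)
  then show ?thesis using roots A(1) by simp
qed

lemma degree_monom_minus:
  assumes "degree Q < n"
  shows "degree (Polynomial.monom 1 n - Q :: 'a::comm_ring_1 poly) = n"
proof -
  have "degree (Polynomial.monom 1 n + - Q) = degree (Polynomial.monom (1 :: 'a) n)"
    using assms by (intro degree_add_eq_left) (simp add: degree_monom_eq)
  then show ?thesis by (simp add: degree_monom_eq)
qed

lemma card_GF:
  assumes "m > 0"
  shows "card (GF (CHAR('k) ^ m) :: 'k::{alg_closed_field, field_prime_char} set) = CHAR('k) ^ m"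
    and "finite (GF (CHAR('k) ^ m) :: 'k set)"
proof -
  let ?N = "CHAR('k) ^ m"
  have p2: "CHAR('k) \<ge> 2" using prime_ge_2_nat[of "CHAR('k)"] by simp
  have N: "?N > 1" by (rule one_less_power) (use p2 assms in auto)
  define P :: "'k poly" where "P = Polynomial.monom 1 ?N - Polynomial.monom 1 1"
  have deg: "degree P = ?N" unfolding P_def using N by (intro degree_monom_minus) (simp add: degree_monom_eq)
  have ev: "poly P x = x ^ ?N - x" for x by (simp add: P_def poly_monom)
  have "of_nat ?N = (0 :: 'k)" using assms by (simp add: power_0_left)
  then have "pderiv P = - 1"
    by (simp add: P_def pderiv_diff pderiv_monom flip: one_pCons)
  then have sep: "poly (pderiv P) x \<noteq> 0" for x by simp
  have "P \<noteq> 0" using deg N by auto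
  then have "card {x. poly P x = 0} = ?N" using card_roots_separable[OF \<open>P \<noteq> 0\<close>] sep deg by metis
  moreover have "{x. poly P x = 0} = GF ?N" by (auto simp: ev GF_def)
  ultimately show "card (GF ?N :: 'k set) = ?N" by simp
  then show "finite (GF ?N :: 'k set)" using N by (intro card_ge_0_finite) linarith
qed

lemma GF_closed:
  fixes x y :: "'k::field_prime_char"
  shows "0 \<in> (GF (CHAR('k) ^ Suc m) :: 'k set)" "1 \<in> (GF (CHAR('k) ^ m) :: 'k set)"
    and "x \<in> GF (CHAR('k) ^ m) \<Longrightarrow> y \<in> GF (CHAR('k) ^ m) \<Longrightarrow> x + y \<in> GF (CHAR('k) ^ m)"
    and "x \<in> GF (CHAR('k) ^ m) \<Longrightarrow> y \<in> GF (CHAR('k) ^ m) \<Longrightarrow> x * y \<in> GF (CHAR('k) ^ m)"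
    and "x \<in> GF (CHAR('k) ^ m) \<Longrightarrow> - x \<in> GF (CHAR('k) ^ m)"
    and "x \<in> GF (CHAR('k) ^ m) \<Longrightarrow> inverse x \<in> GF (CHAR('k) ^ m)"
    and "x \<in> GF CHAR('k) \<Longrightarrow> x \<in> GF (CHAR('k) ^ m)"
proof -
  have p0: "CHAR('k) > 0" by (simp add: prime_gt_0_nat)
  have add: "(x + y) ^ CHAR('k) ^ m = x ^ CHAR('k) ^ m + y ^ CHAR('k) ^ m" for x y :: 'k
    by (rule freshmans_dream') auto
  show "0 \<in> (GF (CHAR('k) ^ Suc m) :: 'k set)" "1 \<in> (GF (CHAR('k) ^ m) :: 'k set)"
    using p0 by (auto simp: GF_def power_0_left)
  show "x \<in> GF (CHAR('k) ^ m) \<Longrightarrow> y \<in> GF (CHAR('k) ^ m) \<Longrightarrow> x + y \<in> GF (CHAR('k) ^ m)"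
    by (simp add: GF_def add)
  show "x \<in> GF (CHAR('k) ^ m) \<Longrightarrow> y \<in> GF (CHAR('k) ^ m) \<Longrightarrow> x * y \<in> GF (CHAR('k) ^ m)"
    by (simp add: GF_def power_mult_distrib)
  have "(- x) ^ CHAR('k) ^ m + x ^ CHAR('k) ^ m = 0"
    using p0 by (simp flip: add add: power_0_left)
  then show "x \<in> GF (CHAR('k) ^ m) \<Longrightarrow> - x \<in> GF (CHAR('k) ^ m)"
    by (simp add: GF_def eq_neg_iff_add_eq_0)
  show "x \<in> GF (CHAR('k) ^ m) \<Longrightarrow> inverse x \<in> GF (CHAR('k) ^ m)"
    by (simp add: GF_def power_inverse)
  show "x \<in> GF (CHAR('k) ^ m)" if "x \<in> GF CHAR('k)"
    using that by (induction m) (auto simp: GF_def power_mult)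
qed

lemma teichmuller_inj: "teichmuller x = teichmuller y \<longleftrightarrow> x = y"
  by (metis teichmuller_eq to_fract_eq_iff witt_nth_teich)

text \<open>The Teichmueller lifts of the $N-1$ units of the field with $N$ elements are distinct roots of
  $X^{N-1} - 1$ in a field, so they are all its roots.\<close>

lemma mu_eq:
  assumes "m > 0"
  shows "mu (CHAR('k) ^ m) = teichmuller ` (GF (CHAR('k) ^ m) - {0 :: 'k::{alg_closed_field, field_prime_char}})" (is ?t1)
    and "mu (CHAR('k) ^ m) = {z :: 'k witt fract. z ^ (CHAR('k) ^ m - 1) = 1}" (is ?t2)
    and "finite (mu (CHAR('k) ^ m) :: 'k witt fract set)"
    and "card (mu (CHAR('k) ^ m) :: 'k witt fract set) = CHAR('k) ^ m - 1"
proof -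
  let ?N = "CHAR('k) ^ m"
  have p2: "CHAR('k) \<ge> 2" using prime_ge_2_nat[of "CHAR('k)"] by simp
  have N: "?N > 1" by (rule one_less_power) (use p2 assms in auto)
  let ?T = "teichmuller ` (GF ?N - {0 :: 'k})"
  have cT: "card ?T = ?N - 1"
  proof -
    have "card ?T = card (GF ?N - {0 :: 'k})"
      by (intro card_image inj_onI) (simp add: teichmuller_inj)
    also have "\<dots> = ?N - 1"
      using card_GF[OF assms, where 'k = 'k] N by (subst card_Diff_singleton) (auto simp: GF_def)
    finally show ?thesis .
  qed
  have sub1: "?T \<subseteq> mu ?N"
  proof (rule image_subsetI)
    fix x :: 'k assume "x \<in> GF ?N - {0}"
    then have x: "x \<in> GF ?N" "x \<noteq> 0" by auto
    have "x * x ^ (?N - 1) = x ^ Suc (?N - 1)" by (rule power_Suc[symmetric])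
    also have "Suc (?N - 1) = ?N" using N by simp
    also have "x ^ ?N = x * 1" using x(1) by (simp add: GF_def)
    finally have "x ^ (?N - 1) = 1" using x(2) by (simp only: mult_cancel_left) simp
    then have "teichmuller x ^ (?N - 1) = 1" by (simp add: teichmuller_1 flip: teichmuller_power)
    moreover have "teichmuller x \<in> Zq ?N"
      unfolding teichmuller_eq Zq_def using x N by (auto simp: witt_nth_teich GF_def power_0_left)
    ultimately show "teichmuller x \<in> mu ?N" by (simp add: mu_def)
  qed
  have sub2: "mu ?N \<subseteq> {z :: 'k witt fract. z ^ (?N - 1) = 1}" by (auto simp: mu_def)
  define P :: "'k witt fract poly" where "P = Polynomial.monom 1 (?N - 1) - 1"
  have deg: "degree P = ?N - 1" unfolding P_def using N by (intro degree_monom_minus) (simp add: degree_monom_eq)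
  have "P \<noteq> 0" using deg N by auto
  moreover have R: "{z. poly P z = 0} = {z. z ^ (?N - 1) = 1}" by (auto simp: P_def poly_monom)
  ultimately have fin: "finite {z :: 'k witt fract. z ^ (?N - 1) = 1}"
    and le: "card {z :: 'k witt fract. z ^ (?N - 1) = 1} \<le> ?N - 1"
    using poly_roots_finite[of P] card_poly_roots_bound[of P] deg by auto
  have "?T = {z. z ^ (?N - 1) = 1}"
    using sub1 sub2 fin le cT by (intro card_seteq) auto
  then show ?t1 ?t2 using sub1 sub2 by auto
  then show "finite (mu ?N :: 'k witt fract set)" "card (mu ?N :: 'k witt fract set) = ?N - 1"
    using fin cT by auto
qed

text \<open>If the exponent is not divisible by the order of the group, some element \<open>w\<close> of the group has a power
  different from 1, because a polynomial of smaller degree cannot vanish on the whole group.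
  Multiplication by \<open>w\<close> permutes the group and multiplies the sum by that power.\<close>

lemma mu_orthogonality:
  fixes v :: int
  assumes "m > 0"
  shows "(\<Sum>z\<in>mu (CHAR('k) ^ m). z powi v :: 'k::{alg_closed_field, field_prime_char} witt fract) =
    (if int (CHAR('k) ^ m - 1) dvd v then of_nat (CHAR('k) ^ m - 1) else 0)"
proof -
  define n where "n = CHAR('k) ^ m - 1"
  let ?\<mu> = "mu (CHAR('k) ^ m) :: 'k witt fract set"
  have p2: "CHAR('k) \<ge> 2" using prime_ge_2_nat[of "CHAR('k)"] by simp
  have "CHAR('k) ^ m > 1" by (rule one_less_power) (use p2 assms in auto)
  then have N: "n > 0" by (simp add: n_def)
  have mu: "z \<in> ?\<mu> \<longleftrightarrow> z ^ n = 1" for z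
    using mu_eq(2)[OF assms, where 'k = 'k] by (auto simp: n_def)
  have card: "card ?\<mu> = n" unfolding n_def by (rule mu_eq(4)[OF assms])
  have nz: "z \<noteq> 0" if "z \<in> ?\<mu>" for z using that N by (auto simp: mu power_0_left)
  have red: "z powi v = z ^ nat (v mod int n)" if "z \<in> ?\<mu>" for z
  proof -
    have "0 \<le> v mod int n" using N by (intro pos_mod_sign) (simp only: of_nat_0_less_iff)
    then have "v = int n * (v div int n) + int (nat (v mod int n))"
      by (simp only: int_nat_eq if_True mult_div_mod_eq)
    then have "z powi v = z powi (int n * (v div int n)) * z powi int (nat (v mod int n))"
      using nz[OF that] by (metis power_int_add)
    also have "z powi (int n * (v div int n)) = 1"
      using that by (simp only: power_int_mult power_int_of_nat mu power_int_1_left)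
    finally show ?thesis
      using \<open>0 \<le> v mod int n\<close> by (metis mult_1 power_int_of_nat)
  qed
  show ?thesis
  proof (cases "int n dvd v")
    case True
    then show ?thesis using red card unfolding n_def[symmetric] by (simp add: dvd_eq_mod_eq_0)
  next
    case False
    define r where "r = nat (v mod int n)"
    have r: "0 < r" "r < n"
    proof -
      have "v mod int n \<noteq> 0" using False by (simp add: dvd_eq_mod_eq_0)
      moreover have "0 \<le> v mod int n" "v mod int n < int n" using N by simp_all
      ultimately show "0 < r" "r < n" by (simp_all add: r_def)
    qed
    have "\<exists>w\<in>?\<mu>. w ^ r \<noteq> 1"
    proof (rule ccontr)
      assume "\<not> (\<exists>w\<in>?\<mu>. w ^ r \<noteq> 1)"
      then have all: "w ^ r = 1" if "w \<in> ?\<mu>" for w using that by blast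
      define P :: "'k witt fract poly" where "P = Polynomial.monom 1 r - 1"
      have deg: "degree P = r" unfolding P_def using r by (intro degree_monom_minus) (simp add: degree_monom_eq)
      have "P \<noteq> 0" using deg r by auto
      then have "card {z. poly P z = 0} \<le> r" "finite {z. poly P z = 0}"
        using card_poly_roots_bound[of P] poly_roots_finite[of P] deg by auto
      moreover have "?\<mu> \<subseteq> {z. poly P z = 0}" using all by (auto simp: P_def poly_monom)
      ultimately have "card ?\<mu> \<le> r" by (meson card_mono le_trans)
      then show False using card r by simp
    qed
    then obtain w where w: "w \<in> ?\<mu>" "w ^ r \<noteq> 1" by blast
    let ?S = "\<Sum>z\<in>?\<mu>. z ^ r"
    have bij: "bij_betw ((*) w) ?\<mu> ?\<mu>"
    proof (rule bij_betwI[where g = "(*) (inverse w)"])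
      have "w \<noteq> 0" using nz w by blast
      then show "\<And>x. inverse w * (w * x) = x" "\<And>x. w * (inverse w * x) = x" by simp_all
      show "(*) w \<in> ?\<mu> \<rightarrow> ?\<mu>" "(*) (inverse w) \<in> ?\<mu> \<rightarrow> ?\<mu>"
        using w(1) by (auto simp: mu power_mult_distrib power_inverse)
    qed
    have "w ^ r * ?S = (\<Sum>z\<in>?\<mu>. (w * z) ^ r)" by (simp add: sum_distrib_left power_mult_distrib)
    also have "\<dots> = ?S" by (rule sum.reindex_bij_betw[OF bij])
    finally have "(w ^ r - 1) * ?S = 0" by (simp add: left_diff_distrib)
    then have "?S = 0" using w(2) by simp
    then show ?thesis using False red unfolding n_def[symmetric] by (simp add: r_def)
  qed
qed


section \<open>The trace of an unramified extension\<close>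

lemma is_basis_unique:
  assumes "is_basis A B m e" "\<And>i. i < m \<Longrightarrow> a i \<in> A" "\<And>i. i < m \<Longrightarrow> b i \<in> A"
    and "(\<Sum>i<m. a i * e i) \<in> B" and "(\<Sum>i<m. a i * e i) = (\<Sum>i<m. b i * e i)" and "i < m"
  shows "a i = b i"
proof -
  let ?y = "\<Sum>i<m. a i * e i"
  have "\<exists>!c. c \<in> {..<m} \<rightarrow>\<^sub>E A \<and> ?y = (\<Sum>i<m. c i * e i)"
    using assms(1,4) unfolding is_basis_def by blast
  moreover have "restrict a {..<m} \<in> {..<m} \<rightarrow>\<^sub>E A" "restrict b {..<m} \<in> {..<m} \<rightarrow>\<^sub>E A"
    using assms(2,3) by auto
  moreover have "?y = (\<Sum>i<m. restrict a {..<m} i * e i)" "?y = (\<Sum>i<m. restrict b {..<m} i * e i)"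
    using assms(5) by (auto intro!: sum.cong)
  ultimately have "restrict a {..<m} = restrict b {..<m}" by blast
  then show ?thesis using assms(6) by (metis lessThan_iff restrict_apply)
qed

lemma is_basis_expand:
  assumes "is_basis A B m e" "y \<in> B"
  obtains c where "\<And>i. i < m \<Longrightarrow> c i \<in> A" "y = (\<Sum>i<m. c i * e i)"
  using assms unfolding is_basis_def by (metis PiE_mem lessThan_iff)

lemma basis_change_inverse:
  fixes A B :: "'r::comm_ring_1 set" and e e' :: "nat \<Rightarrow> 'r"
  assumes b: "is_basis A B m e"
    and A: "0 \<in> A" "1 \<in> A" "\<And>x y. x \<in> A \<Longrightarrow> y \<in> A \<Longrightarrow> x + y \<in> A" "\<And>x y. x \<in> A \<Longrightarrow> y \<in> A \<Longrightarrow> x * y \<in> A"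
    and P: "\<And>i j. i < m \<Longrightarrow> j < m' \<Longrightarrow> P j i \<in> A" "\<And>j. j < m' \<Longrightarrow> e' j = (\<Sum>i<m. P j i * e i)"
    and Q: "\<And>i j. i < m' \<Longrightarrow> j < m \<Longrightarrow> Q j i \<in> A" "\<And>j. j < m \<Longrightarrow> e j = (\<Sum>i<m'. Q j i * e' i)"
    and ij: "i < m" "j < m"
  shows "(\<Sum>k<m'. Q j k * P k i) = (if i = j then 1 else 0)"
proof (rule is_basis_unique[OF b, where a = "\<lambda>i. \<Sum>k<m'. Q j k * P k i" and b = "\<lambda>i. if i = j then 1 else 0"])
  have sumA: "(\<Sum>i\<in>I. g i) \<in> A" if "\<And>i. i \<in> I \<Longrightarrow> g i \<in> A" for I and g :: "nat \<Rightarrow> 'r"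
    using that by (induction I rule: infinite_finite_induct) (auto intro: A)
  show "(\<Sum>k<m'. Q j k * P k i) \<in> A" if "i < m" for i
    by (rule sumA, rule A(4)) (use P(1) Q(1) ij that in auto)
  have "(\<Sum>i<m. (\<Sum>k<m'. Q j k * P k i) * e i) = (\<Sum>k<m'. Q j k * e' k)"
    by (simp add: P(2) sum_distrib_left sum_distrib_right mult.assoc) (rule sum.swap)
  also have "\<dots> = e j" using Q(2) ij by simp
  finally have eq: "(\<Sum>i<m. (\<Sum>k<m'. Q j k * P k i) * e i) = e j" .
  then show "(\<Sum>i<m. (\<Sum>k<m'. Q j k * P k i) * e i) \<in> B" using b ij by (simp add: is_basis_def)
  have "(\<Sum>i<m. (if i = j then 1 else 0) * e i) = (\<Sum>i<m. if i = j then e i else 0)"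
    by (intro sum.cong) auto
  then show "(\<Sum>i<m. (\<Sum>k<m'. Q j k * P k i) * e i) = (\<Sum>i<m. (if i = j then 1 else 0) * e i)"
    using eq ij by simp
qed (use A ij in auto)

text \<open>If \<open>P\<close> and \<open>Q\<close> are the mutually inverse base change matrices then $M' = Q M P$ has the trace of \<open>M\<close>.
  The computation does not presuppose that the bases have the same length.\<close>

lemma basis_trace_unique:
  fixes A B :: "'r::comm_ring_1 set"
  assumes b: "is_basis A B m e" and b': "is_basis A B m' e'"
    and A: "0 \<in> A" "1 \<in> A" "\<And>x y. x \<in> A \<Longrightarrow> y \<in> A \<Longrightarrow> x + y \<in> A" "\<And>x y. x \<in> A \<Longrightarrow> y \<in> A \<Longrightarrow> x * y \<in> A"
    and B: "\<And>y y'. y \<in> B \<Longrightarrow> y' \<in> B \<Longrightarrow> y * y' \<in> B" and x: "x \<in> B"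
    and M: "\<And>i j. i < m \<Longrightarrow> j < m \<Longrightarrow> M i j \<in> A" "\<And>j. j < m \<Longrightarrow> x * e j = (\<Sum>i<m. M i j * e i)"
    and M': "\<And>i j. i < m' \<Longrightarrow> j < m' \<Longrightarrow> M' i j \<in> A" "\<And>j. j < m' \<Longrightarrow> x * e' j = (\<Sum>i<m'. M' i j * e' i)"
  shows "(\<Sum>i<m. M i i) = (\<Sum>i<m'. M' i i)"
proof -
  have sumA: "(\<Sum>i\<in>I. g i) \<in> A" if "\<And>i. i \<in> I \<Longrightarrow> g i \<in> A" for I and g :: "nat \<Rightarrow> 'r"
    using that by (induction I rule: infinite_finite_induct) (auto intro: A)
  have e: "e i \<in> B" if "i < m" for i using b that by (simp add: is_basis_def)
  have e': "e' i \<in> B" if "i < m'" for i using b' that by (simp add: is_basis_def)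
  have "\<exists>c. (\<forall>i<m. c i \<in> A) \<and> e' j = (\<Sum>i<m. c i * e i)" if "j < m'" for j
    by (rule is_basis_expand[OF b e'[OF that]]) blast
  then obtain P where P: "\<And>i j. i < m \<Longrightarrow> j < m' \<Longrightarrow> P j i \<in> A" "\<And>j. j < m' \<Longrightarrow> e' j = (\<Sum>i<m. P j i * e i)"
    by metis
  have "\<exists>c. (\<forall>i<m'. c i \<in> A) \<and> e j = (\<Sum>i<m'. c i * e' i)" if "j < m" for j
    by (rule is_basis_expand[OF b' e[OF that]]) blast
  then obtain Q where Q: "\<And>i j. i < m' \<Longrightarrow> j < m \<Longrightarrow> Q j i \<in> A" "\<And>j. j < m \<Longrightarrow> e j = (\<Sum>i<m'. Q j i * e' i)"
    by metis
  note PQ = basis_change_inverse[OF b A P Q] and QP = basis_change_inverse[OF b' A Q P]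
  have PM: "(\<Sum>k<m'. M' k j * P k i) = (\<Sum>l<m. P j l * M i l)" if "i < m" "j < m'" for i j
  proof (rule is_basis_unique[OF b, where a = "\<lambda>i. \<Sum>k<m'. M' k j * P k i" and b = "\<lambda>i. \<Sum>l<m. P j l * M i l"])
    have eq: "(\<Sum>i<m. (\<Sum>k<m'. M' k j * P k i) * e i) = (\<Sum>k<m'. M' k j * e' k)"
      by (simp add: P(2) sum_distrib_left sum_distrib_right mult.assoc) (rule sum.swap)
    then have eq: "(\<Sum>i<m. (\<Sum>k<m'. M' k j * P k i) * e i) = x * e' j" using M'(2) that by simp
    then show "(\<Sum>i<m. (\<Sum>k<m'. M' k j * P k i) * e i) \<in> B" using B x e' that by simp
    have "x * e' j = (\<Sum>l<m. P j l * (x * e l))"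
      using P(2)[OF that(2)] by (simp add: sum_distrib_left mult_ac)
    also have "\<dots> = (\<Sum>i<m. (\<Sum>l<m. P j l * M i l) * e i)"
      by (simp add: M(2) sum_distrib_left sum_distrib_right mult.assoc) (rule sum.swap)
    finally show "(\<Sum>i<m. (\<Sum>k<m'. M' k j * P k i) * e i) = (\<Sum>i<m. (\<Sum>l<m. P j l * M i l) * e i)"
      using eq by simp
  qed (use A P(1) M(1) M'(1) that in \<open>auto intro!: sumA\<close>)
  have "(\<Sum>j<m'. M' j j) = (\<Sum>j<m'. \<Sum>k<m'. M' k j * (if j = k then 1 else 0))"
    by (simp add: if_distrib cong: if_cong)
  also have "\<dots> = (\<Sum>j<m'. \<Sum>k<m'. M' k j * (\<Sum>i<m. P k i * Q i j))"
    using QP by (intro sum.cong refl) auto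
  also have "\<dots> = (\<Sum>j<m'. \<Sum>i<m. (\<Sum>k<m'. M' k j * P k i) * Q i j)"
    by (simp add: sum_distrib_left sum_distrib_right mult.assoc) (intro sum.cong refl sum.swap)
  also have "\<dots> = (\<Sum>j<m'. \<Sum>i<m. (\<Sum>l<m. P j l * M i l) * Q i j)"
    using PM by (intro sum.cong refl) auto
  also have "\<dots> = (\<Sum>j<m'. \<Sum>i<m. \<Sum>l<m. M i l * (Q i j * P j l))"
    by (simp add: sum_distrib_left sum_distrib_right mult_ac)
  also have "\<dots> = (\<Sum>i<m. \<Sum>j<m'. \<Sum>l<m. M i l * (Q i j * P j l))"
    by (rule sum.swap)
  also have "\<dots> = (\<Sum>i<m. \<Sum>l<m. M i l * (\<Sum>j<m'. Q i j * P j l))"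
    unfolding sum_distrib_left by (intro sum.cong refl sum.swap)
  also have "\<dots> = (\<Sum>i<m. \<Sum>l<m. M i l * (if l = i then 1 else 0))"
    using PQ by (intro sum.cong refl) auto
  also have "\<dots> = (\<Sum>i<m. M i i)" by (simp add: if_distrib cong: if_cong)
  finally show ?thesis by simp
qed

lemma ring_trace_eq:
  assumes b: "is_basis A B m e"
    and A: "0 \<in> A" "1 \<in> A" "\<And>x y. x \<in> A \<Longrightarrow> y \<in> A \<Longrightarrow> x + y \<in> A" "\<And>x y. x \<in> A \<Longrightarrow> y \<in> A \<Longrightarrow> x * y \<in> A"
    and B: "\<And>y y'. y \<in> B \<Longrightarrow> y' \<in> B \<Longrightarrow> y * y' \<in> B" and x: "x \<in> B"
    and M: "\<And>i j. i < m \<Longrightarrow> j < m \<Longrightarrow> M i j \<in> A" "\<And>j. j < m \<Longrightarrow> x * e j = (\<Sum>i<m. M i j * e i)"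
  shows "ring_trace A B x = (\<Sum>i<m. M i i)"
  unfolding ring_trace_def
proof (rule the_equality)
  show "\<exists>m' e' M'. is_basis A B m' e' \<and>
     (\<forall>j<m'. (\<forall>i<m'. M' i j \<in> A) \<and> x * e' j = (\<Sum>i<m'. M' i j * e' i)) \<and> (\<Sum>i<m. M i i) = (\<Sum>i<m'. M' i i)"
    using b M by (intro exI[of _ m] exI[of _ e] exI[of _ M]) auto
next
  fix t
  assume "\<exists>m' e' M'. is_basis A B m' e' \<and>
     (\<forall>j<m'. (\<forall>i<m'. M' i j \<in> A) \<and> x * e' j = (\<Sum>i<m'. M' i j * e' i)) \<and> t = (\<Sum>i<m'. M' i i)"
  then obtain m' e' M' where "is_basis A B m' e'" and "\<And>i j. i < m' \<Longrightarrow> j < m' \<Longrightarrow> M' i j \<in> A"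
    and "\<And>j. j < m' \<Longrightarrow> x * e' j = (\<Sum>i<m'. M' i j * e' i)" and t: "t = (\<Sum>i<m'. M' i i)"
    by blast
  then show "t = (\<Sum>i<m. M i i)"
    unfolding t by (intro basis_trace_unique[OF _ b A B x, symmetric] basis_trace_unique[OF b _ A B x, symmetric] M) auto
qed

text \<open>A longest family of independent elements spans, since an element outside its span would prolong it.
  Comparing cardinalities then shows that it has length \<open>m\<close>.\<close>

lemma GF_basis:
  assumes "m > 0"
  obtains \<epsilon> :: "nat \<Rightarrow> 'k::{alg_closed_field, field_prime_char}"
  where "\<And>i. i < m \<Longrightarrow> \<epsilon> i \<in> GF (CHAR('k) ^ m)"
    and "\<And>y. y \<in> GF (CHAR('k) ^ m) \<Longrightarrow> \<exists>a. (\<forall>i<m. a i \<in> GF CHAR('k)) \<and> y = (\<Sum>i<m. a i * \<epsilon> i)"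
    and "\<And>a. (\<And>i. i < m \<Longrightarrow> a i \<in> GF CHAR('k)) \<Longrightarrow> (\<Sum>i<m. a i * \<epsilon> i) = 0 \<Longrightarrow> \<forall>i<m. a i = 0"
proof -
  let ?p = "CHAR('k)"
  let ?F = "GF ?p :: 'k set" and ?G = "GF (?p ^ m) :: 'k set"
  have F1: "?F = GF (?p ^ 1)" by simp
  have cF: "card ?F = ?p" "finite ?F" using card_GF[of 1, where 'k = 'k] by simp_all
  have p2: "?p \<ge> 2" using prime_ge_2_nat[of ?p] by simp
  note cG = card_GF[OF assms, where 'k = 'k]
  have Fcl: "x + y \<in> ?F" "x * y \<in> ?F" if "x \<in> ?F" "y \<in> ?F" for x y
    using that GF_closed(3,4)[of x 1 y] by auto
  have Fcl': "- x \<in> ?F" "inverse x \<in> ?F" if "x \<in> ?F" for x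
    using that GF_closed(5,6)[of x 1] by auto
  have F0: "0 \<in> ?F" "1 \<in> ?F" using GF_closed(1)[of 0, where 'k = 'k] GF_closed(2)[of 1, where 'k = 'k] by auto
  have FG: "?F \<subseteq> ?G" using GF_closed(7) by blast
  define ind where "ind s \<epsilon> \<longleftrightarrow> (\<forall>i<s. \<epsilon> i \<in> ?G) \<and>
     (\<forall>a. (\<forall>i<s. a i \<in> ?F) \<longrightarrow> (\<Sum>i<s. a i * \<epsilon> i) = 0 \<longrightarrow> (\<forall>i<s. a i = 0))" for s and \<epsilon> :: "nat \<Rightarrow> 'k"
  have comb: "(\<Sum>i<s. a i * \<epsilon> i) \<in> ?G" if "ind s \<epsilon>" "\<And>i. i < s \<Longrightarrow> a i \<in> ?F" for s \<epsilon> a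
  proof -
    have "a i * \<epsilon> i \<in> ?G" if "i < s" for i
      using that \<open>ind s \<epsilon>\<close> \<open>\<And>i. i < s \<Longrightarrow> a i \<in> ?F\<close> FG GF_closed(4) unfolding ind_def by blast
    then show ?thesis
    proof (induction s)
      case 0
      then show ?case using F0 FG by auto
    next
      case (Suc s)
      then show ?case by (auto intro!: GF_closed(3))
    qed
  qed
  have inj: "inj_on (\<lambda>a. \<Sum>i<s. a i * \<epsilon> i) ({..<s} \<rightarrow>\<^sub>E ?F)" if "ind s \<epsilon>" for s \<epsilon>
  proof (rule inj_onI)
    fix a b assume ab: "a \<in> {..<s} \<rightarrow>\<^sub>E ?F" "b \<in> {..<s} \<rightarrow>\<^sub>E ?F" "(\<Sum>i<s. a i * \<epsilon> i) = (\<Sum>i<s. b i * \<epsilon> i)"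
    have "(\<Sum>i<s. (a i + - b i) * \<epsilon> i) = 0"
      using ab(3) by (simp add: left_diff_distrib sum_subtractf)
    moreover have "a i + - b i \<in> ?F" if "i < s" for i
      using that ab(1,2) by (intro Fcl Fcl') auto
    ultimately have "\<forall>i<s. a i + - b i = 0"
      using \<open>ind s \<epsilon>\<close> unfolding ind_def by meson
    then show "a = b" using ab(1,2) by (intro PiE_ext) auto
  qed
  have cimg: "card ((\<lambda>a. \<Sum>i<s. a i * \<epsilon> i) ` ({..<s} \<rightarrow>\<^sub>E ?F)) = ?p ^ s" if "ind s \<epsilon>" for s \<epsilon>
    using card_image[OF inj[OF that]] cF by (simp add: card_PiE)
  have img: "(\<lambda>a. \<Sum>i<s. a i * \<epsilon> i) ` ({..<s} \<rightarrow>\<^sub>E ?F) \<subseteq> ?G" if "ind s \<epsilon>" for s \<epsilon>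
    by (rule image_subsetI, rule comb[OF that]) auto
  have bound: "s \<le> m" if "ind s \<epsilon>" for s \<epsilon>
  proof -
    have "?p ^ s \<le> ?p ^ m" using card_mono[OF cG(2) img[OF that]] cimg[OF that] cG(1) by simp
    then show ?thesis using p2 by (simp add: power_le_imp_le_exp)
  qed
  have step: "\<exists>\<epsilon>'. ind (Suc s) \<epsilon>'" if i: "ind s \<epsilon>" and y: "y \<in> ?G" and no: "\<And>a. (\<forall>i<s. a i \<in> ?F) \<Longrightarrow> y \<noteq> (\<Sum>i<s. a i * \<epsilon> i)" for s \<epsilon> y
  proof -
    define \<epsilon>' where "\<epsilon>' = \<epsilon>(s := y)"
    have same: "(\<Sum>i<s. a i * \<epsilon>' i) = (\<Sum>i<s. a i * \<epsilon> i)" for a by (auto simp: \<epsilon>'_def intro!: sum.cong)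
    have "ind (Suc s) \<epsilon>'"
      unfolding ind_def
    proof (intro conjI allI impI)
      fix i assume "i < Suc s"
      then show "\<epsilon>' i \<in> ?G" using i y by (auto simp: \<epsilon>'_def ind_def less_Suc_eq)
    next
      fix a i assume a: "\<forall>i<Suc s. a i \<in> ?F" and z: "(\<Sum>i<Suc s. a i * \<epsilon>' i) = 0" and "i < Suc s"
      have z': "(\<Sum>i<s. a i * \<epsilon> i) + a s * y = 0" using z same by (simp add: \<epsilon>'_def)
      have as: "a s = 0"
      proof (rule ccontr)
        assume nz: "a s \<noteq> 0"
        have "y = (\<Sum>i<s. (- (inverse (a s) * a i)) * \<epsilon> i)"
        proof -
          have "a s * y = - (\<Sum>i<s. a i * \<epsilon> i)" using z' by (simp add: eq_neg_iff_add_eq_0 add.commute)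
          then have "inverse (a s) * (a s * y) = inverse (a s) * - (\<Sum>i<s. a i * \<epsilon> i)" by simp
          then show ?thesis using nz by (simp add: sum_distrib_left sum_negf mult.assoc flip: mult.assoc)
        qed
        moreover have "\<forall>i<s. - (inverse (a s) * a i) \<in> ?F" using a by (intro allI impI Fcl Fcl') auto
        ultimately show False using no[of "\<lambda>i. - (inverse (a s) * a i)"] by simp
      qed
      then have "(\<Sum>i<s. a i * \<epsilon> i) = 0" using z' by simp
      moreover have "\<forall>i<s. a i \<in> ?F" using a by simp
      ultimately have "\<forall>i<s. a i = 0" using i unfolding ind_def by meson
      then show "a i = 0" using as \<open>i < Suc s\<close> by (auto simp: less_Suc_eq)
    qed
    then show ?thesis by blast
  qed
  have "\<exists>s. (\<exists>\<epsilon>. ind s \<epsilon>) \<and> (\<forall>s'. (\<exists>\<epsilon>. ind s' \<epsilon>) \<longrightarrow> s' \<le> s)"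
  proof (rule ex_has_greatest_nat)
    show "\<exists>\<epsilon>. ind 0 \<epsilon>" by (simp add: ind_def)
    show "\<forall>s. (\<exists>\<epsilon>. ind s \<epsilon>) \<longrightarrow> s < Suc m" using bound by (meson le_imp_less_Suc)
  qed
  then obtain s \<epsilon> where ind: "ind s \<epsilon>" and max: "\<And>s' \<epsilon>'. ind s' \<epsilon>' \<Longrightarrow> s' \<le> s" by blast
  have span: "\<exists>a. (\<forall>i<s. a i \<in> ?F) \<and> y = (\<Sum>i<s. a i * \<epsilon> i)" if "y \<in> ?G" for y
    using step[OF ind that] max by (metis not_less_eq_eq order_refl)
  have "(\<lambda>a. \<Sum>i<s. a i * \<epsilon> i) ` ({..<s} \<rightarrow>\<^sub>E ?F) = ?G"
  proof (rule antisym[OF img[OF ind]], rule subsetI)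
    fix y assume "y \<in> ?G"
    then obtain a where a: "\<forall>i<s. a i \<in> ?F" "y = (\<Sum>i<s. a i * \<epsilon> i)" using span by blast
    then have "y = (\<Sum>i<s. restrict a {..<s} i * \<epsilon> i)" by (auto intro!: sum.cong)
    moreover have "restrict a {..<s} \<in> {..<s} \<rightarrow>\<^sub>E ?F" using a by auto
    ultimately show "y \<in> (\<lambda>a. \<Sum>i<s. a i * \<epsilon> i) ` ({..<s} \<rightarrow>\<^sub>E ?F)" by blast
  qed
  then have "?p ^ s = ?p ^ m" using cimg[OF ind] cG(1) by simp
  then have sm: "s = m" using p2 by (simp add: power_inject_exp)
  show ?thesis
  proof (rule that)
    show "\<epsilon> i \<in> ?G" if "i < m" for i using ind that sm by (simp add: ind_def)
    show "\<exists>a. (\<forall>i<m. a i \<in> ?F) \<and> y = (\<Sum>i<m. a i * \<epsilon> i)" if "y \<in> ?G" for y using span[OF that] sm by simp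
    show "\<forall>i<m. a i = 0" if "\<And>i. i < m \<Longrightarrow> a i \<in> ?F" "(\<Sum>i<m. a i * \<epsilon> i) = 0" for a
      using ind that sm by (simp add: ind_def)
  qed
qed


text \<open>The ring of Witt vectors of the field with $p^m$ elements, described as the fixed points of a power
  of Frobenius: since that is a ring endomorphism, the ring structure is immediate.\<close>

definition frob_fixed :: "nat \<Rightarrow> 'k::field_prime_char witt set" where
  "frob_fixed m = {w. (witt_frob ^^ m) w = w}"

lemma frob_fixed_iff:
  fixes w :: "'k::field_prime_char witt"
  shows "w \<in> frob_fixed m \<longleftrightarrow> (\<forall>i. witt_nth w i \<in> GF (CHAR('k) ^ m))"
proof
  assume "w \<in> frob_fixed m"
  then have "witt_nth ((witt_frob ^^ m) w) i = witt_nth w i" for i by (simp add: frob_fixed_def)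
  then show "\<forall>i. witt_nth w i \<in> GF (CHAR('k) ^ m)" by (simp add: witt_nth_frob_pow GF_def)
next
  assume "\<forall>i. witt_nth w i \<in> GF (CHAR('k) ^ m)"
  then show "w \<in> frob_fixed m"
    unfolding frob_fixed_def by (auto intro!: witt_eqI simp: witt_nth_frob_pow GF_def)
qed

lemma Zq_eq: "Zq (CHAR('k) ^ m) = to_fract ` (frob_fixed m :: 'k::field_prime_char witt set)"
  unfolding Zq_def by (auto simp: frob_fixed_iff)

lemma frob_fixed_closed:
  "0 \<in> frob_fixed m" "1 \<in> frob_fixed m"
  "x \<in> frob_fixed m \<Longrightarrow> y \<in> frob_fixed m \<Longrightarrow> x + y \<in> frob_fixed m"
  "x \<in> frob_fixed m \<Longrightarrow> y \<in> frob_fixed m \<Longrightarrow> x * y \<in> frob_fixed m"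
  "x \<in> frob_fixed m \<Longrightarrow> - x \<in> frob_fixed m"
  "x \<in> frob_fixed m \<Longrightarrow> y \<in> frob_fixed m \<Longrightarrow> x - y \<in> frob_fixed m"
  unfolding minus_witt_def
  by (simp_all add: frob_fixed_def witt_frob_pow_hom witt_frob_pow_uminus del: add_uminus_conv_diff)

lemma frob_fixed_sum: "(\<And>i. i \<in> I \<Longrightarrow> g i \<in> frob_fixed m) \<Longrightarrow> (\<Sum>i\<in>I. g i) \<in> frob_fixed m"
  by (simp add: frob_fixed_def witt_frob_pow_hom)

lemma frob_fixed_1: "w \<in> frob_fixed 1 \<Longrightarrow> (witt_frob ^^ l) w = w"
  by (induction l) (auto simp: frob_fixed_def)

lemma frob_fixed_1_mono: "w \<in> frob_fixed 1 \<Longrightarrow> w \<in> frob_fixed m"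
  using frob_fixed_1 by (simp add: frob_fixed_def)

lemma frob_fixed_teich: "x \<in> GF (CHAR('k) ^ m) \<Longrightarrow> witt_teich (x :: 'k::field_prime_char) \<in> frob_fixed m"
  by (simp add: frob_fixed_def witt_frob_pow_teich GF_def)

text \<open>Frobenius is bijective on the fixed ring: $w = V(u)$ and $u = F(w')$, and $V F$ is multiplication by \<open>p\<close>.\<close>

lemma frob_fixed_divide_prime:
  fixes w :: "'k::field_prime_char witt"
  assumes "m > 0" "w \<in> frob_fixed m" "witt_nth w 0 = 0"
  shows "\<exists>w'\<in>frob_fixed m. w = of_nat CHAR('k) * w'"
proof -
  let ?p = "CHAR('k)"
  define u where "u = Witt (\<lambda>i. witt_nth w (Suc i))"
  have u: "w = witt_ver u"
    using assms(3) by (intro witt_eqI) (simp add: u_def witt_nth_ver split: nat.split)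
  have uf: "u \<in> frob_fixed m" using assms(2) by (auto simp: frob_fixed_iff u_def)
  define w' where "w' = (witt_frob ^^ (m - 1)) u"
  have "witt_frob w' = (witt_frob ^^ Suc (m - 1)) u" by (simp add: w'_def)
  also have "\<dots> = u" using uf assms(1) by (simp add: frob_fixed_def)
  finally have "w = of_nat ?p * w'" by (simp add: prime_times_witt u)
  moreover have "w' \<in> frob_fixed m"
    unfolding w'_def frob_fixed_def using uf
    by (simp add: frob_fixed_def) (metis funpow_add comp_apply add.commute)
  ultimately show ?thesis by blast
qed

lemma frob_fixed_1_decompose:
  fixes w :: "'k::field_prime_char witt"
  assumes "w \<in> frob_fixed 1"
  shows "w = witt_teich (witt_nth w 0) + of_nat CHAR('k) * Witt (\<lambda>i. witt_nth w (Suc i))"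
    and "Witt (\<lambda>i. witt_nth w (Suc i)) \<in> frob_fixed 1"
proof -
  show *: "Witt (\<lambda>i. witt_nth w (Suc i)) \<in> frob_fixed 1"
    using assms by (auto simp: frob_fixed_iff)
  show "w = witt_teich (witt_nth w 0) + of_nat CHAR('k) * Witt (\<lambda>i. witt_nth w (Suc i))"
    using witt_decompose[of w] frob_fixed_1[OF *, of 1] unfolding prime_times_witt by simp
qed

lemma witt_eq_0_if_prime_divisible:
  fixes w :: "'k::field_prime_char witt"
  assumes "\<And>n. \<exists>z. w = of_nat CHAR('k) ^ n * z"
  shows "w = 0"
proof -
  have "witt_nth (of_nat CHAR('k) ^ n * z) i = 0" if "i < n" for n i and z :: "'k witt"
    using that
  proof (induction n arbitrary: i)
    case (Suc n)
    have "of_nat CHAR('k) ^ Suc n * z = witt_ver (witt_frob (of_nat CHAR('k) ^ n * z))"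
      by (simp only: power_Suc mult.assoc flip: prime_times_witt)
    with Suc show ?case
      by (simp add: witt_nth_ver witt_frob_def power_0_left del: power_Suc split: nat.split)
  qed simp
  then have "witt_nth w i = 0" for i using assms[of "Suc i"] by (metis lessI)
  then show ?thesis by (intro witt_eqI) (simp add: witt_nth_0_hom)
qed

text \<open>Teichmueller lifts of a basis of the residue field form a basis. Modulo \<open>p\<close> every \<open>y\<close> is a combination
  of the lifts with Teichmueller coefficients; dividing the remainder by \<open>p\<close> and repeating yields digits
  for each coefficient. Frobenius fixes $W(\mathbb{F}_p)$, so a Witt vector over $\mathbb{F}_p$ is the
  \<open>p\<close>-adic series with its coordinates as digits, and the coefficients can be written down without taking
  limits. Conversely, all coefficients of a relation are divisible by \<open>p\<close>, and dividing by \<open>p\<close> gives another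
  relation.\<close>

theorem witt_basis:
  assumes "m > 0"
  obtains e :: "nat \<Rightarrow> 'k::{alg_closed_field, field_prime_char} witt"
  where "\<And>i. i < m \<Longrightarrow> e i \<in> frob_fixed m"
    and "\<And>y. y \<in> frob_fixed m \<Longrightarrow> \<exists>c. (\<forall>i<m. c i \<in> frob_fixed 1) \<and> y = (\<Sum>i<m. c i * e i)"
    and "\<And>c. (\<And>i. i < m \<Longrightarrow> c i \<in> frob_fixed 1) \<Longrightarrow> (\<Sum>i<m. c i * e i) = 0 \<Longrightarrow> \<forall>i<m. c i = 0"
proof -
  let ?p = "CHAR('k)"
  obtain \<epsilon> :: "nat \<Rightarrow> 'k" where \<epsilon>: "\<And>i. i < m \<Longrightarrow> \<epsilon> i \<in> GF (?p ^ m)"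
    and span: "\<And>y. y \<in> GF (?p ^ m) \<Longrightarrow> \<exists>a. (\<forall>i<m. a i \<in> GF ?p) \<and> y = (\<Sum>i<m. a i * \<epsilon> i)"
    and ind: "\<And>a. (\<And>i. i < m \<Longrightarrow> a i \<in> GF ?p) \<Longrightarrow> (\<Sum>i<m. a i * \<epsilon> i) = 0 \<Longrightarrow> \<forall>i<m. a i = 0"
    using GF_basis[OF assms, where 'k = 'k] by blast
  define e where "e i = witt_teich (\<epsilon> i)" for i
  have e: "e i \<in> frob_fixed m" if "i < m" for i
    unfolding e_def by (rule frob_fixed_teich[OF \<epsilon>[OF that]])
  have comb0: "witt_nth (\<Sum>i<m. c i * e i) 0 = (\<Sum>i<m. witt_nth (c i) 0 * \<epsilon> i)" for c
    by (simp add: witt_nth_0_sum witt_nth_0_hom e_def witt_nth_teich)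
  have combf: "(\<Sum>i<m. c i * e i) \<in> frob_fixed m" if "\<And>i. i < m \<Longrightarrow> c i \<in> frob_fixed 1" for c
    by (rule frob_fixed_sum, rule frob_fixed_closed(4)[OF frob_fixed_1_mono[OF that] e]) auto
  have pnz: "of_nat ?p \<noteq> (0 :: 'k witt)" by simp
  show ?thesis
  proof (rule that)
    show "e i \<in> frob_fixed m" if "i < m" for i using e[OF that] .
  next
    fix y :: "'k witt" assume y: "y \<in> frob_fixed m"
    have "\<exists>a y'. (\<forall>i<m. a i \<in> GF ?p) \<and> y' \<in> frob_fixed m \<and>
        y = (\<Sum>i<m. witt_teich (a i) * e i) + of_nat ?p * y'" if y: "y \<in> frob_fixed m" for y
    proof -
      have "witt_nth y 0 \<in> GF (?p ^ m)" using y by (simp add: frob_fixed_iff)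
      then obtain a where a: "\<forall>i<m. a i \<in> GF ?p" "witt_nth y 0 = (\<Sum>i<m. a i * \<epsilon> i)" using span by blast
      let ?s = "\<Sum>i<m. witt_teich (a i) * e i"
      have "witt_teich (a i) \<in> frob_fixed 1" if "i < m" for i
        using a(1) that by (intro frob_fixed_teich) auto
      then have "y - ?s \<in> frob_fixed m" using y by (intro frob_fixed_closed(6) combf) auto
      moreover have "witt_nth (y - ?s) 0 = 0"
        using a(2) by (simp add: witt_nth_0_hom comb0 witt_nth_teich)
      ultimately obtain y' where "y' \<in> frob_fixed m" "y - ?s = of_nat ?p * y'"
        using frob_fixed_divide_prime[OF assms] by blast
      then show ?thesis using a(1) by (intro exI[of _ a] exI[of _ y']) (simp add: algebra_simps)
    qed
    then obtain a r where a: "\<And>y i. y \<in> frob_fixed m \<Longrightarrow> i < m \<Longrightarrow> a y i \<in> GF ?p"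
      and r: "\<And>y. y \<in> frob_fixed m \<Longrightarrow> r y \<in> frob_fixed m"
      and ar: "\<And>y. y \<in> frob_fixed m \<Longrightarrow> y = (\<Sum>i<m. witt_teich (a y i) * e i) + of_nat ?p * r y"
      by metis
    have rn: "(r ^^ n) y \<in> frob_fixed m" if "y \<in> frob_fixed m" for n y
      using that r by (induction n) auto
    define c where "c y i = Witt (\<lambda>n. a ((r ^^ n) y) i)" for y i
    have cf: "c y i \<in> frob_fixed 1" if "y \<in> frob_fixed m" "i < m" for y i
      using a[OF rn] that by (auto simp: frob_fixed_iff c_def)
    have cr: "c y i = witt_teich (a y i) + of_nat ?p * c (r y) i" if "y \<in> frob_fixed m" "i < m" for y i
      using frob_fixed_1_decompose(1)[OF cf[OF that]] by (simp add: c_def funpow_swap1)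
    define \<delta> where "\<delta> y = y - (\<Sum>i<m. c y i * e i)" for y
    have \<delta>r: "\<delta> y = of_nat ?p * \<delta> (r y)" if "y \<in> frob_fixed m" for y
    proof -
      have "(\<Sum>i<m. c y i * e i) = (\<Sum>i<m. (witt_teich (a y i) + of_nat ?p * c (r y) i) * e i)"
        using cr[OF that] by simp
      also have "\<dots> = (\<Sum>i<m. witt_teich (a y i) * e i) + of_nat ?p * (\<Sum>i<m. c (r y) i * e i)"
        by (simp add: distrib_right sum.distrib sum_distrib_left mult.assoc)
      finally have s: "(\<Sum>i<m. c y i * e i) = (\<Sum>i<m. witt_teich (a y i) * e i) + of_nat ?p * (\<Sum>i<m. c (r y) i * e i)" .
      have "\<delta> y = ((\<Sum>i<m. witt_teich (a y i) * e i) + of_nat ?p * r y) - (\<Sum>i<m. c y i * e i)"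
        unfolding \<delta>_def using ar[OF that] by simp
      also have "\<dots> = of_nat ?p * \<delta> (r y)" unfolding s \<delta>_def by (simp add: algebra_simps)
      finally show ?thesis .
    qed
    \<comment> \<open>The error of the expansion is divisible by every power of p.\<close>
    have "\<delta> y = of_nat ?p ^ n * \<delta> ((r ^^ n) y)" for n
    proof (induction n)
      case (Suc n)
      then show ?case using \<delta>r[OF rn[OF y, of n]] by (simp add: mult_ac)
    qed simp
    then have "\<delta> y = 0" by (intro witt_eq_0_if_prime_divisible) blast
    then show "\<exists>c. (\<forall>i<m. c i \<in> frob_fixed 1) \<and> y = (\<Sum>i<m. c i * e i)"
      using cf[OF y] by (intro exI[of _ "c y"]) (simp add: \<delta>_def)
  next
    have *: "\<forall>i<m. witt_nth (c i) n = 0"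
      if "\<And>i. i < m \<Longrightarrow> c i \<in> frob_fixed 1" "(\<Sum>i<m. c i * e i) = 0" for c n
      using that
    proof (induction n arbitrary: c)
      case (0 c)
      have "(\<Sum>i<m. witt_nth (c i) 0 * \<epsilon> i) = 0" using comb0[of c] 0(2) by (simp add: witt_nth_0_hom)
      then show ?case using 0(1) by (intro ind) (auto simp: frob_fixed_iff)
    next
      case (Suc n c)
      have "(\<Sum>i<m. witt_nth (c i) 0 * \<epsilon> i) = 0" using comb0[of c] Suc(3) by (simp add: witt_nth_0_hom)
      then have c0: "\<forall>i<m. witt_nth (c i) 0 = 0" using Suc(2) by (intro ind) (auto simp: frob_fixed_iff)
      define c' where "c' i = Witt (\<lambda>l. witt_nth (c i) (Suc l))" for i
      have c': "c' i \<in> frob_fixed 1" if "i < m" for i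
        using frob_fixed_1_decompose(2)[OF Suc(2)[OF that]] by (simp add: c'_def)
      have "witt_teich 0 = (0 :: 'k witt)" by (simp add: witt_teich_def zero_witt_def)
      then have cc: "c i = of_nat ?p * c' i" if "i < m" for i
        using frob_fixed_1_decompose(1)[OF Suc(2)[OF that]] c0 that by (simp add: c'_def)
      have "of_nat ?p * (\<Sum>i<m. c' i * e i) = 0"
        using Suc(3) cc by (simp add: sum_distrib_left mult.assoc)
      then have "(\<Sum>i<m. c' i * e i) = 0" using pnz by (simp only: mult_eq_0_iff) simp
      then have "\<forall>i<m. witt_nth (c' i) n = 0" using Suc.IH[of c'] c' by blast
      then show ?case by (simp add: c'_def)
    qed
    show "\<forall>i<m. c i = 0" if "\<And>i. i < m \<Longrightarrow> c i \<in> frob_fixed 1" "(\<Sum>i<m. c i * e i) = 0" for c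
    proof (intro allI impI witt_eqI)
      fix i n assume "i < m"
      then show "witt_nth (c i) n = witt_nth 0 n" using *[of c n] that by (simp add: witt_nth_0_hom)
    qed
  qed
qed

lemma inverse_of_trivial_left_kernel:
  fixes V :: "nat \<Rightarrow> nat \<Rightarrow> 'f::field"
  assumes "\<And>c. (\<And>j. j < m \<Longrightarrow> (\<Sum>l<m. c l * V l j) = 0) \<Longrightarrow> \<forall>l<m. c l = 0"
  obtains W where "\<And>i j. i < m \<Longrightarrow> j < m \<Longrightarrow> (\<Sum>l<m. V i l * W l j) = (if i = j then 1 else 0)"
    and "\<And>i j. i < m \<Longrightarrow> j < m \<Longrightarrow> (\<Sum>l<m. W i l * V l j) = (if i = j then 1 else 0)"
proof -
  define A where "A = Matrix.mat m m (\<lambda>(j, l). V l j)"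
  have A: "A \<in> carrier_mat m m" by (simp add: A_def)
  have "Determinant.det A \<noteq> 0"
  proof
    assume "Determinant.det A = 0"
    then obtain v where v: "v \<in> carrier_vec m" "v \<noteq> 0\<^sub>v m" "A *\<^sub>v v = 0\<^sub>v m"
      using det_0_iff_vec_prod_zero_field[OF A] by blast
    have "(\<Sum>l<m. vec_index v l * V l j) = 0" if "j < m" for j
    proof -
      have "vec_index (A *\<^sub>v v) j = 0" using v(3) that by simp
      then show ?thesis using that v(1) by (simp add: A_def scalar_prod_def atLeast0LessThan mult.commute)
    qed
    then have "\<forall>l<m. vec_index v l = 0" by (rule assms)
    then have "v = 0\<^sub>v m" using v(1) by (intro eq_vecI) auto
    then show False using v(2) by simp
  qed
  then obtain B where B: "B \<in> carrier_mat m m" "A * B = 1\<^sub>m m" "B * A = 1\<^sub>m m"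
    using det_non_zero_imp_unit[OF A, of "()"] by (auto simp: Units_def ring_mat_def)
  show ?thesis
  proof (rule that[of "\<lambda>i j. B $$ (j, i)"])
    fix i j assume ij: "i < m" "j < m"
    have "(B * A) $$ (j, i) = (if i = j then 1 else 0)" using B(3) ij by auto
    then show "(\<Sum>l<m. V i l * B $$ (j, l)) = (if i = j then 1 else 0)"
      using ij B(1) by (simp add: A_def scalar_prod_def atLeast0LessThan mult.commute)
    have "(A * B) $$ (j, i) = (if i = j then 1 else 0)" using B(2) ij by auto
    then show "(\<Sum>l<m. B $$ (l, i) * V l j) = (if i = j then 1 else 0)"
      using ij B(1) by (simp add: A_def scalar_prod_def atLeast0LessThan mult.commute)
  qed
qed

text \<open>Let \<open>M\<close> be the matrix of multiplication by \<open>w\<close> in a basis \<open>e\<close>, let $V = (F^l(e_j))$ and let \<open>D\<close> be the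
  diagonal matrix of the conjugates $F^l(w)$. Applying $F^l$ to the defining equations of \<open>M\<close> gives
  $D V = V M$, so the claim follows if \<open>V\<close> is invertible. A relation \<open>c\<close> between its rows would give a
  polynomial $\sum_l c_l X^{p^l}$ of degree at most $p^{m-1}$ that vanishes at the $p^m$ Teichmueller
  elements.\<close>

theorem ring_trace_frob_sum:
  fixes w :: "'k::{alg_closed_field, field_prime_char} witt"
  assumes "m > 0" "w \<in> frob_fixed m"
  shows "ring_trace (Zq CHAR('k)) (Zq (CHAR('k) ^ m)) (to_fract w) = (\<Sum>l<m. to_fract ((witt_frob ^^ l) w))"
proof -
  let ?p = "CHAR('k)"
  obtain e :: "nat \<Rightarrow> 'k witt" where e: "\<And>i. i < m \<Longrightarrow> e i \<in> frob_fixed m"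
    and span: "\<And>y. y \<in> frob_fixed m \<Longrightarrow> \<exists>c. (\<forall>i<m. c i \<in> frob_fixed 1) \<and> y = (\<Sum>i<m. c i * e i)"
    and ind: "\<And>c. (\<And>i. i < m \<Longrightarrow> c i \<in> frob_fixed 1) \<Longrightarrow> (\<Sum>i<m. c i * e i) = 0 \<Longrightarrow> \<forall>i<m. c i = 0"
    using witt_basis[OF assms(1), where 'k = 'k] by blast
  have A: "Zq ?p = to_fract ` (frob_fixed 1 :: 'k witt set)" using Zq_eq[of 1] by simp
  have B: "Zq (?p ^ m) = to_fract ` (frob_fixed m :: 'k witt set)" by (rule Zq_eq)
  have basis: "is_basis (Zq ?p) (Zq (?p ^ m)) m (\<lambda>i. to_fract (e i))"
    unfolding is_basis_def
  proof (intro conjI allI impI ballI)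
    show "to_fract (e i) \<in> Zq (?p ^ m)" if "i < m" for i using e[OF that] B by blast
  next
    fix y :: "'k witt fract" assume "y \<in> Zq (?p ^ m)"
    then obtain y' where y': "y' \<in> frob_fixed m" "y = to_fract y'" using B by blast
    obtain c where c: "\<forall>i<m. c i \<in> frob_fixed 1" "y' = (\<Sum>i<m. c i * e i)" using span[OF y'(1)] by blast
    show "\<exists>!c. c \<in> {..<m} \<rightarrow>\<^sub>E Zq ?p \<and> y = (\<Sum>i<m. c i * to_fract (e i))"
    proof (rule ex1I[of _ "restrict (\<lambda>i. to_fract (c i)) {..<m}"])
      show "restrict (\<lambda>i. to_fract (c i)) {..<m} \<in> {..<m} \<rightarrow>\<^sub>E Zq ?p \<and>
        y = (\<Sum>i<m. restrict (\<lambda>i. to_fract (c i)) {..<m} i * to_fract (e i))"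
        using c by (auto simp: A y'(2))
    next
      fix g assume g: "g \<in> {..<m} \<rightarrow>\<^sub>E Zq ?p \<and> y = (\<Sum>i<m. g i * to_fract (e i))"
      then have "\<exists>h\<in>frob_fixed 1. g i = to_fract h" if "i < m" for i
        using that unfolding A by blast
      then obtain h where h: "\<And>i. i < m \<Longrightarrow> h i \<in> frob_fixed 1" "\<And>i. i < m \<Longrightarrow> g i = to_fract (h i)"
        by metis
      have "to_fract (\<Sum>i<m. h i * e i) = to_fract (\<Sum>i<m. c i * e i)"
        using g h(2) y'(2) c(2) by simp
      then have "(\<Sum>i<m. h i * e i) = (\<Sum>i<m. c i * e i)" by (simp only: to_fract_eq_iff)
      then have "(\<Sum>i<m. (h i - c i) * e i) = 0" by (simp add: left_diff_distrib sum_subtractf)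
      then have eq: "\<forall>i<m. h i - c i = 0" using h(1) c(1) by (intro ind frob_fixed_closed(6)) auto
      show "g = restrict (\<lambda>i. to_fract (c i)) {..<m}"
      proof (intro PiE_ext[of g "{..<m}" "\<lambda>_. Zq ?p"])
        show "restrict (\<lambda>i. to_fract (c i)) {..<m} \<in> {..<m} \<rightarrow>\<^sub>E Zq ?p"
          using c(1) unfolding A by auto
      qed (use g h(2) eq in auto)
    qed
  qed
  have "\<exists>c. (\<forall>i<m. c i \<in> frob_fixed 1) \<and> w * e j = (\<Sum>i<m. c i * e i)" if "j < m" for j
    using span[OF frob_fixed_closed(4)[OF assms(2) e[OF that]]] .
  then obtain M where M: "\<And>i j. i < m \<Longrightarrow> j < m \<Longrightarrow> M j i \<in> frob_fixed 1"
      "\<And>j. j < m \<Longrightarrow> w * e j = (\<Sum>i<m. M j i * e i)"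
    by metis
  have tr: "ring_trace (Zq ?p) (Zq (?p ^ m)) (to_fract w) = (\<Sum>i<m. to_fract (M i i))"
  proof (rule ring_trace_eq[OF basis, where M = "\<lambda>i j. to_fract (M j i)"])
    show "to_fract w * to_fract (e j) = (\<Sum>i<m. to_fract (M j i) * to_fract (e i))" if "j < m" for j
      using M(2)[OF that] by (simp flip: to_fract_mult)
  qed (use M(1) assms(2) in \<open>auto simp: A B frob_fixed_closed simp flip: to_fract_mult to_fract_add
        intro!: image_eqI[of 0 _ 0] image_eqI[of 1 _ 1] frob_fixed_closed\<close>)
  define V where "V l j = to_fract ((witt_frob ^^ l) (e j))" for l j
  have DV: "to_fract ((witt_frob ^^ l) w) * V l j = (\<Sum>i<m. to_fract (M j i) * V l i)" if "j < m" for l j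
  proof -
    have "(witt_frob ^^ l) w * (witt_frob ^^ l) (e j) = (\<Sum>i<m. M j i * (witt_frob ^^ l) (e i))"
      unfolding witt_frob_pow_hom(2)[symmetric] M(2)[OF that] witt_frob_pow_hom(5)
      using M(1) that by (intro sum.cong refl) (simp add: witt_frob_pow_hom(2) frob_fixed_1)
    then show ?thesis by (simp add: V_def flip: to_fract_mult to_fract_sum)
  qed
  have ker: "\<forall>l<m. c l = 0" if "\<And>j. j < m \<Longrightarrow> (\<Sum>l<m. c l * V l j) = 0" for c
  proof -
    have p2: "?p \<ge> 2" using prime_ge_2_nat[of ?p] by simp
    have zero: "(\<Sum>l<m. c l * teichmuller x ^ (?p ^ l)) = 0" if x: "x \<in> GF (?p ^ m)" for x :: 'k
    proof -
      obtain a where a: "\<forall>i<m. a i \<in> frob_fixed 1" "witt_teich x = (\<Sum>i<m. a i * e i)"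
        using span[OF frob_fixed_teich[OF x]] by blast
      have "teichmuller x ^ (?p ^ l) = (\<Sum>i<m. to_fract (a i) * V l i)" for l
      proof -
        have "teichmuller x ^ (?p ^ l) = to_fract ((witt_frob ^^ l) (witt_teich x))"
          by (simp add: witt_frob_pow_teich flip: teichmuller_eq teichmuller_power)
        also have "(witt_frob ^^ l) (witt_teich x) = (\<Sum>i<m. a i * (witt_frob ^^ l) (e i))"
          unfolding a(2) witt_frob_pow_hom(5)
          using a(1) by (intro sum.cong refl) (simp add: witt_frob_pow_hom(2) frob_fixed_1)
        finally show ?thesis by (simp add: V_def)
      qed
      then have "(\<Sum>l<m. c l * teichmuller x ^ (?p ^ l)) = (\<Sum>l<m. \<Sum>i<m. to_fract (a i) * (c l * V l i))"
        by (simp add: sum_distrib_left mult.left_commute)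
      also have "\<dots> = (\<Sum>i<m. to_fract (a i) * (\<Sum>l<m. c l * V l i))"
        by (subst sum.swap) (simp add: sum_distrib_left)
      also have "\<dots> = 0" using \<open>\<And>j. j < m \<Longrightarrow> (\<Sum>l<m. c l * V l j) = 0\<close> by simp
      finally show ?thesis .
    qed
    define P where "P = (\<Sum>l<m. Polynomial.monom (c l) (?p ^ l))"
    have "P = 0"
    proof (rule ccontr)
      assume "P \<noteq> 0"
      have "degree P \<le> ?p ^ (m - 1)"
        unfolding P_def
      proof (rule degree_sum_le)
        fix l assume "l \<in> {..<m}"
        then have "?p ^ l \<le> ?p ^ (m - 1)" using p2 by (intro power_increasing) auto
        then show "degree (Polynomial.monom (c l) (?p ^ l)) \<le> ?p ^ (m - 1)"
          using degree_monom_le le_trans by blast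
      qed simp
      moreover have "?p ^ (m - 1) < ?p ^ m" using p2 assms(1) by (intro power_strict_increasing) auto
      moreover have "card {z. poly P z = 0} \<le> degree P" by (rule card_poly_roots_bound[OF \<open>P \<noteq> 0\<close>])
      moreover have "?p ^ m \<le> card {z. poly P z = 0}"
      proof -
        have "?p ^ m = card (teichmuller ` (GF (?p ^ m) :: 'k set))"
          using card_GF(1)[OF assms(1), where 'k = 'k] by (subst card_image) (auto simp: inj_on_def teichmuller_inj)
        also have "\<dots> \<le> card {z. poly P z = 0}"
          using zero by (intro card_mono poly_roots_finite[OF \<open>P \<noteq> 0\<close>]) (auto simp: P_def poly_sum poly_monom)
        finally show ?thesis .
      qed
      ultimately show False by linarith
    qed
    show ?thesis
    proof (intro allI impI)
      fix l assume l: "l < m"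
      have "Polynomial.coeff P (?p ^ l) = (\<Sum>l'<m. if l' = l then c l' else 0)"
        unfolding P_def coeff_sum using p2 by (intro sum.cong refl) (auto simp: power_inject_exp)
      then show "c l = 0" using \<open>P = 0\<close> l by simp
    qed
  qed
  obtain W where W: "\<And>i j. i < m \<Longrightarrow> j < m \<Longrightarrow> (\<Sum>l<m. V i l * W l j) = (if i = j then 1 else 0)"
    and W': "\<And>i j. i < m \<Longrightarrow> j < m \<Longrightarrow> (\<Sum>l<m. W i l * V l j) = (if i = j then 1 else 0)"
    using inverse_of_trivial_left_kernel[OF ker] by blast
  have "(\<Sum>l<m. to_fract ((witt_frob ^^ l) w)) = (\<Sum>l<m. to_fract ((witt_frob ^^ l) w) * (\<Sum>j<m. V l j * W j l))"
    using W by simp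
  also have "\<dots> = (\<Sum>l<m. \<Sum>j<m. (\<Sum>i<m. to_fract (M j i) * V l i) * W j l)"
    by (simp add: sum_distrib_left DV flip: mult.assoc)
  also have "\<dots> = (\<Sum>l<m. \<Sum>j<m. \<Sum>i<m. to_fract (M j i) * (W j l * V l i))"
    by (simp add: sum_distrib_left sum_distrib_right mult_ac)
  also have "\<dots> = (\<Sum>j<m. \<Sum>l<m. \<Sum>i<m. to_fract (M j i) * (W j l * V l i))"
    by (rule sum.swap)
  also have "\<dots> = (\<Sum>j<m. \<Sum>i<m. to_fract (M j i) * (\<Sum>l<m. W j l * V l i))"
    unfolding sum_distrib_left by (intro sum.cong refl sum.swap)
  also have "\<dots> = (\<Sum>j<m. \<Sum>i<m. to_fract (M j i) * (if j = i then 1 else 0))"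
    using W' by (intro sum.cong refl) auto
  also have "\<dots> = (\<Sum>j<m. to_fract (M j j))" by (simp add: if_distrib cong: if_cong)
  finally show ?thesis using tr by simp
qed


no_notation vec_index (infixl "$" 100)
no_notation fps_nth (infixl "$" 75)

section \<open>Power series modulo powers of $T$\<close>

text \<open>The bound is real since it will be compared with values of the degree function, and the zero series
  satisfies every bound.\<close>

definition ord_ge :: "'r::zero fps \<Rightarrow> real \<Rightarrow> bool" where
  "ord_ge F c \<longleftrightarrow> (\<forall>i. real i < c \<longrightarrow> fps_nth F i = 0)"

lemma ord_ge_0 [simp]: "ord_ge 0 c"
  by (simp add: ord_ge_def)

lemma ord_ge_nonpos: "c \<le> 0 \<Longrightarrow> ord_ge F c"
  by (auto simp: ord_ge_def)

lemma ord_ge_mono: "ord_ge F c \<Longrightarrow> c' \<le> c \<Longrightarrow> ord_ge F c'"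
  by (auto simp: ord_ge_def)

lemma ord_ge_add: "ord_ge F c \<Longrightarrow> ord_ge G c \<Longrightarrow> ord_ge (F + G) c" for F :: "'r::comm_ring_1 fps"
  by (auto simp: ord_ge_def)

lemma ord_ge_uminus: "ord_ge F c \<Longrightarrow> ord_ge (- F) c" for F :: "'r::comm_ring_1 fps"
  by (auto simp: ord_ge_def)

lemma ord_ge_sum: "(\<And>x. x \<in> A \<Longrightarrow> ord_ge (F x) c) \<Longrightarrow> ord_ge (\<Sum>x\<in>A. F x) c" for F :: "'i \<Rightarrow> 'r::comm_ring_1 fps"
  by (induction A rule: infinite_finite_induct) (auto intro: ord_ge_add)

lemma ord_ge_mult:
  fixes F G :: "'r::comm_ring_1 fps"
  assumes "ord_ge F c" "ord_ge G d"
  shows "ord_ge (F * G) (c + d)"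
  unfolding ord_ge_def
proof (intro allI impI)
  fix i assume i: "real i < c + d"
  have "fps_nth F j * fps_nth G (i - j) = 0" if "j \<le> i" for j
  proof (cases "real j < c")
    case False
    then have "real (i - j) < d" using i that by (simp add: of_nat_diff)
    then show ?thesis using assms(2) by (simp add: ord_ge_def)
  qed (use assms(1) in \<open>simp add: ord_ge_def\<close>)
  then show "fps_nth (F * G) i = 0" by (simp add: fps_mult_nth)
qed

lemma ord_ge_mult_left: "ord_ge G d \<Longrightarrow> ord_ge (F * G) d" for F :: "'r::comm_ring_1 fps"
  using ord_ge_mult[OF ord_ge_nonpos[of 0 F], of G d] by simp

lemma ord_ge_mult_right: "ord_ge G d \<Longrightarrow> ord_ge (G * F) d" for F :: "'r::comm_ring_1 fps"
  using ord_ge_mult_left[of G d F] by (simp add: mult.commute)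

lemma ord_ge_power: "ord_ge F c \<Longrightarrow> ord_ge (F ^ n) (real n * c)" for F :: "'r::comm_ring_1 fps"
proof (induction n)
  case (Suc n)
  then show ?case using ord_ge_mult[of F c "F ^ n" "real n * c"] by (simp add: algebra_simps)
qed (simp add: ord_ge_nonpos)

lemma ord_ge_prod:
  fixes F :: "'i \<Rightarrow> 'r::comm_ring_1 fps"
  shows "(\<And>x. x \<in> A \<Longrightarrow> ord_ge (F x) (c x)) \<Longrightarrow> ord_ge (\<Prod>x\<in>A. F x) (\<Sum>x\<in>A. c x)"
  by (induction A rule: infinite_finite_induct) (auto intro: ord_ge_mult ord_ge_nonpos)

lemma ord_ge_mult_cong:
  fixes F G :: "'r::comm_ring_1 fps"
  assumes "ord_ge (F - F') c" "ord_ge (G - G') c"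
  shows "ord_ge (F * G - F' * G') c"
proof -
  have "F * G - F' * G' = F * (G - G') + (F - F') * G'" by (simp add: algebra_simps)
  then show ?thesis using assms by (simp add: ord_ge_add ord_ge_mult_left ord_ge_mult_right)
qed

lemma ord_ge_prod_cong:
  fixes F :: "'i \<Rightarrow> 'r::comm_ring_1 fps"
  shows "(\<And>x. x \<in> A \<Longrightarrow> ord_ge (F x - G x) c) \<Longrightarrow> ord_ge ((\<Prod>x\<in>A. F x) - (\<Prod>x\<in>A. G x)) c"
  by (induction A rule: infinite_finite_induct) (auto intro!: ord_ge_mult_cong)

section \<open>The truncated exponential series\<close>

definition exp_trunc :: "nat \<Rightarrow> 'r::field_char_0 \<Rightarrow> 'r fps" where
  "exp_trunc N z = (\<Sum>j<N. fps_const (z ^ j / fact j) * fps_ln 1 ^ j)"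

lemma ord_ge_fps_ln: "ord_ge (fps_ln 1 :: 'r::field_char_0 fps) 1"
  by (auto simp: ord_ge_def fps_ln_nth)

text \<open>Both sides solve $(1+T) y' = z y$.\<close>

lemma fps_binomial_eq_exp_ln:
  fixes z :: "'r::field_char_0"
  shows "fps_binomial z = fps_exp z oo fps_ln 1"
proof -
  have u: "fps_nth (1 + fps_X :: 'r fps) 0 \<noteq> 0" by simp
  have "fps_deriv (fps_exp z oo fps_ln 1) = fps_const z * (fps_exp z oo fps_ln 1) * inverse (1 + fps_X)"
    by (simp add: fps_compose_deriv fps_ln_deriv fps_compose_mult_distrib)
  then have "fps_deriv (fps_exp z oo fps_ln 1) = (fps_const z * (fps_exp z oo fps_ln 1)) / (1 + fps_X)"
    by (simp add: fps_divide_unit)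
  then have "fps_exp z oo fps_ln 1 = fps_const (fps_nth (fps_exp z oo fps_ln 1) 0) * fps_binomial z"
    by (rule fps_binomial_ODE_unique[THEN iffD1])
  then show ?thesis by simp
qed

lemma fps_binomial_cong_exp_trunc:
  fixes z :: "'r::field_char_0"
  shows "ord_ge (fps_binomial z - exp_trunc N z) (real N)"
  unfolding ord_ge_def
proof (intro allI impI)
  fix i assume "real i < real N"
  then have i: "i < N" by simp
  have z: "fps_nth (fps_ln 1 ^ j :: 'r fps) i = 0" if "i < j" for j
    using ord_ge_power[OF ord_ge_fps_ln[where 'r = 'r], of j] that by (simp add: ord_ge_def)
  have "fps_nth (fps_binomial z) i = (\<Sum>j=0..i. z ^ j / fact j * fps_nth (fps_ln 1 ^ j) i)"
    unfolding fps_binomial_eq_exp_ln fps_compose_nth by simp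
  also have "\<dots> = (\<Sum>j<N. z ^ j / fact j * fps_nth (fps_ln 1 ^ j) i)"
    by (rule sum.mono_neutral_left) (use i z in auto)
  finally show "fps_nth (fps_binomial z - exp_trunc N z) i = 0"
    by (simp add: exp_trunc_def fps_sum_nth)
qed

lemma fps_binomial_sum: "fps_binomial (\<Sum>x\<in>A. c x) = (\<Prod>x\<in>A. fps_binomial (c x))" for c :: "'i \<Rightarrow> 'r::field_char_0"
  by (induction A rule: infinite_finite_induct) (auto simp: fps_binomial_add_mult)

section \<open>Laurent polynomials over a power series ring\<close>

text \<open>The linear functional with prescribed values on monomials. Evaluation at a point and the extraction
  of a single coefficient or of a sum of coefficients are all of this form.\<close>

definition lfun :: "(int ^ 'n \<Rightarrow> 'r) \<Rightarrow> (int ^ 'n \<Rightarrow>\<^sub>0 'r) \<Rightarrow> 'r::comm_ring_1" where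
  "lfun h P = (\<Sum>v\<in>Poly_Mapping.keys P. Poly_Mapping.lookup P v * h v)"

lemma lfun_superset:
  assumes "finite A" "Poly_Mapping.keys P \<subseteq> A"
  shows "lfun h P = (\<Sum>v\<in>A. Poly_Mapping.lookup P v * h v)"
  unfolding lfun_def by (rule sum.mono_neutral_left) (use assms in \<open>auto simp: in_keys_iff\<close>)

lemma lfun_0 [simp]: "lfun h 0 = 0" by (simp add: lfun_def)

lemma lfun_add: "lfun h (P + Q) = lfun h P + lfun h Q"
proof -
  let ?A = "Poly_Mapping.keys P \<union> Poly_Mapping.keys Q"
  have "Poly_Mapping.keys (P + Q) \<subseteq> ?A" by (rule Poly_Mapping.keys_add)
  then show ?thesis by (simp add: lfun_superset[of ?A] lookup_add distrib_right sum.distrib)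
qed

lemma lfun_sum: "lfun h (\<Sum>i\<in>I. P i) = (\<Sum>i\<in>I. lfun h (P i))"
  by (induction I rule: infinite_finite_induct) (auto simp: lfun_add)

lemma lfun_single: "lfun h (Poly_Mapping.single v c) = c * h v"
  by (simp add: lfun_superset[of "{v}"])

lemma lfun_one: "lfun h 1 = h 0"
  by (simp add: lfun_single flip: single_one)

lemma lfun_cong: "(\<And>v. v \<in> Poly_Mapping.keys P \<Longrightarrow> h v = h' v) \<Longrightarrow> lfun h P = lfun h' P"
  by (auto simp: lfun_def)

lemma lfun_sum_left: "lfun (\<lambda>v. \<Sum>i\<in>I. h i v) P = (\<Sum>i\<in>I. lfun (h i) P)"
  unfolding lfun_def sum_distrib_left by (rule sum.swap)

lemma lfun_cmult_left: "lfun (\<lambda>v. c * h v) P = c * lfun h P"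
  by (simp add: lfun_def sum_distrib_left mult.left_commute)

lemma lfun_mult_single: "lfun h (Poly_Mapping.single w c * P) = c * lfun (\<lambda>v. h (w + v)) P"
proof (induction P rule: poly_mapping_add_induct)
  case (single v c')
  then show ?case by (simp add: mult_single lfun_single mult.assoc)
qed (simp_all add: lfun_add distrib_left)

lemma poly_mapping_keys_sum: "P = (\<Sum>v\<in>Poly_Mapping.keys P. Poly_Mapping.single v (Poly_Mapping.lookup P v))"
  by (rule poly_mapping_eqI) (simp add: lookup_sum lookup_single when_def in_keys_iff)

lemma lfun_mult:
  assumes h: "\<And>v w. h (v + w) = h v * h w"
  shows "lfun h (P * Q) = lfun h P * lfun h Q"
proof (induction P rule: poly_mapping_add_induct)
  case (single v c)
  show ?case by (simp add: lfun_mult_single h lfun_cmult_left lfun_single mult.assoc)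
qed (simp_all add: lfun_add distrib_right)

lemma lfun_prod:
  assumes "\<And>v w. h (v + w) = h v * h w" "h 0 = 1"
  shows "lfun h (\<Prod>i\<in>I. P i) = (\<Prod>i\<in>I. lfun h (P i))"
  by (induction I rule: infinite_finite_induct) (auto simp: lfun_mult[of h, OF assms(1)] lfun_one assms(2))

lemma lookup_eq_lfun: "Poly_Mapping.lookup P v = lfun (\<lambda>w. if w = v then 1 else 0) P"
  by (simp add: lfun_def in_keys_iff if_distrib[of "\<lambda>x. _ * x"] cong: if_cong)

definition lmonom :: "'r::field ^ 'n \<Rightarrow> int ^ 'n \<Rightarrow> 'r" where
  "lmonom x v = (\<Prod>i\<in>UNIV. (x $ i) powi (v $ i))"

lemma lmonom_0 [simp]: "lmonom x 0 = 1" by (simp add: lmonom_def)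

lemma lmonom_add: "(\<And>i. x $ i \<noteq> 0) \<Longrightarrow> lmonom x (v + w) = lmonom x v * lmonom x w"
  by (simp add: lmonom_def power_int_add prod.distrib)

lemma lmonom_scale: "lmonom x (int c *s v) = lmonom x v ^ c"
  unfolding lmonom_def prod_power_distrib
  by (intro prod.cong refl)
    (simp only: vector_smult_component mult.commute[of "int c"] power_int_mult power_int_of_nat)

lemma lmonom_power: "lmonom (\<chi> i. x $ i ^ c) v = lmonom x v ^ c"
  unfolding lmonom_def prod_power_distrib
proof (intro prod.cong refl)
  fix i
  have "(x $ i powi int c) powi (v $ i) = (x $ i powi (v $ i)) powi int c"
    unfolding power_int_mult[symmetric] by (simp only: mult.commute)
  then show "(\<chi> i. x $ i ^ c) $ i powi v $ i = (x $ i powi v $ i) ^ c" by simp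
qed

abbreviation lev :: "'r::field ^ 'n \<Rightarrow> (int ^ 'n \<Rightarrow>\<^sub>0 'r fps) \<Rightarrow> 'r fps" where
  "lev x \<equiv> lfun (\<lambda>v. fps_const (lmonom x v))"


section \<open>The Dwork trace formula\<close>

lemma lookup_mult_eq:
  fixes P Q :: "int ^ 'n \<Rightarrow>\<^sub>0 'r::comm_ring_1"
  shows "Poly_Mapping.lookup (P * Q) v = (\<Sum>u\<in>Poly_Mapping.keys P. \<Sum>w\<in>Poly_Mapping.keys Q.
    Poly_Mapping.lookup P u * (Poly_Mapping.lookup Q w * (if u + w = v then 1 else 0)))"
proof -
  have "lfun (\<lambda>w. if w = v then 1 else 0) (P * Q) =
    lfun (\<lambda>w. if w = v then 1 else 0) ((\<Sum>u\<in>Poly_Mapping.keys P. Poly_Mapping.single u (Poly_Mapping.lookup P u)) * Q)"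
    using poly_mapping_keys_sum[of P] by simp
  then show ?thesis
    by (simp add: lookup_eq_lfun[of "P * Q"] sum_distrib_right lfun_sum lfun_mult_single sum_distrib_left)
      (simp add: lfun_def sum_distrib_left)
qed

text \<open>The properties of the degree function on the lattice points of a cone that the trace formula and the
  order estimates use.\<close>

locale lattice_degree =
  fixes M :: "(int ^ 'n) set" and g :: "int ^ 'n \<Rightarrow> real"
  assumes M_0: "0 \<in> M"
    and M_add: "u \<in> M \<Longrightarrow> v \<in> M \<Longrightarrow> u + v \<in> M"
    and M_scale: "c > 0 \<Longrightarrow> int c *s u \<in> M \<longleftrightarrow> u \<in> M"
    and g_scale: "u \<in> M \<Longrightarrow> g (int c *s u) = real c * g u"
    and g_add: "u \<in> M \<Longrightarrow> v \<in> M \<Longrightarrow> g (u + v) \<le> g u + g v"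
    and g_nonneg: "u \<in> M \<Longrightarrow> 0 \<le> g u"
    and finite_le: "finite {u \<in> M. g u \<le> K}"
begin

lemma g_0: "g 0 = 0"
  using g_scale[OF M_0, of 0] by simp

lemma M_scaleI: "u \<in> M \<Longrightarrow> int c *s u \<in> M"
  using M_scale[of c u] M_0 by (cases "c = 0") auto

text \<open>The parameter \<open>K\<close> bounds the support, which keeps the index set of the matrix below finite.\<close>

definition graded :: "(int ^ 'n \<Rightarrow>\<^sub>0 'r::comm_ring_1 fps) \<Rightarrow> real \<Rightarrow> bool" where
  "graded P K \<longleftrightarrow> (\<forall>v\<in>Poly_Mapping.keys P. v \<in> M \<and> g v \<le> K \<and> ord_ge (Poly_Mapping.lookup P v) (g v))"

lemma graded_ord: "graded P K \<Longrightarrow> ord_ge (Poly_Mapping.lookup P v) (g v)"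
  by (cases "v \<in> Poly_Mapping.keys P") (auto simp: graded_def in_keys_iff)

lemma graded_0: "graded 0 K" by (simp add: graded_def)

lemma graded_single: "v \<in> M \<Longrightarrow> g v \<le> K \<Longrightarrow> ord_ge c (g v) \<Longrightarrow> graded (Poly_Mapping.single v c) K"
  by (simp add: graded_def)

lemma graded_add: "graded P K \<Longrightarrow> graded Q K \<Longrightarrow> graded (P + Q) K"
  unfolding graded_def[of "P + Q"]
  using Poly_Mapping.keys_add[of P Q]
  by (auto simp: lookup_add graded_ord intro!: ord_ge_add) (auto simp: graded_def)

lemma graded_sum: "(\<And>i. i \<in> I \<Longrightarrow> graded (P i) K) \<Longrightarrow> graded (\<Sum>i\<in>I. P i) K"
  by (induction I rule: infinite_finite_induct) (auto intro: graded_0 graded_add)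

lemma graded_mult:
  assumes "graded P K" "graded Q L"
  shows "graded (P * Q) (K + L)"
  unfolding graded_def
proof (intro ballI conjI)
  fix v assume "v \<in> Poly_Mapping.keys (P * Q)"
  then obtain u w where uw: "u \<in> Poly_Mapping.keys P" "w \<in> Poly_Mapping.keys Q" "v = u + w"
    using Poly_Mapping.keys_mult[of P Q] by blast
  then have "u \<in> M" "w \<in> M" "g u \<le> K" "g w \<le> L" using assms by (auto simp: graded_def)
  then show "v \<in> M" "g v \<le> K + L" using M_add[of u w] g_add[of u w] uw by auto
  show "ord_ge (Poly_Mapping.lookup (P * Q) v) (g v)"
    unfolding lookup_mult_eq
  proof (intro ord_ge_sum)
    fix u w assume u: "u \<in> Poly_Mapping.keys P" and w: "w \<in> Poly_Mapping.keys Q"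
    have "ord_ge (Poly_Mapping.lookup P u * Poly_Mapping.lookup Q w) (g u + g w)"
      using assms graded_ord by (blast intro: ord_ge_mult)
    moreover have "g (u + w) \<le> g u + g w" using assms u w by (intro g_add) (auto simp: graded_def)
    ultimately show "ord_ge (Poly_Mapping.lookup P u * (Poly_Mapping.lookup Q w * (if u + w = v then 1 else 0))) (g v)"
      using ord_ge_mono by auto
  qed
qed

lemma graded_one: "graded 1 0"
  using graded_single[of 0 0 1] M_0 by (simp add: g_0 ord_ge_nonpos)

lemma graded_prod:
  "(\<And>i. i \<in> I \<Longrightarrow> graded (P i) K) \<Longrightarrow> graded (\<Prod>i\<in>I. P i) (real (card I) * K)"
proof (induction I rule: infinite_finite_induct)
  case (insert i I)
  then show ?case using graded_mult[of "P i" K "prod P I" "real (card I) * K"] by (simp add: algebra_simps)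
qed (auto simp: graded_one)

end

text \<open>The Laurent polynomial \<open>F t\<close> plays the role of the splitting function with coefficients twisted by
  the \<open>t\<close>-th power of Frobenius, whence the period \<open>a\<close>.\<close>

locale trace_setup = lattice_degree M g
  for M :: "(int ^ 'n) set" and g :: "int ^ 'n \<Rightarrow> real" +
  fixes F :: "nat \<Rightarrow> (int ^ 'n \<Rightarrow>\<^sub>0 'r::{idom, ring_char_0} fps)" and K :: real and p a :: nat and d :: "int ^ 'n"
  assumes p2: "p \<ge> 2" and a0: "a > 0" and K0: "K \<ge> 0"
    and gradedF: "\<And>t. graded (F t) K" and period: "\<And>t. F (t + a) = F t"
begin

definition "r = p ^ a - 1"

lemma r_pos: "r > 0"
proof -
  have "1 < p ^ a" by (rule one_less_power) (use p2 a0 in auto)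
  then show ?thesis by (simp add: r_def)
qed

lemma F_mod: "F (t mod a) = F t"
proof (induction t rule: less_induct)
  case (less t)
  show ?case
  proof (cases "t < a")
    case False
    then have "F ((t - a) mod a) = F (t - a)" using a0 by (intro less) auto
    moreover have "(t - a) mod a = t mod a" using False by (simp add: le_mod_geq)
    moreover have "F t = F (t - a)" using period[of "t - a"] False by simp
    ultimately show ?thesis by simp
  qed simp
qed

text \<open>The product of \<open>F 0\<close>, \<open>F 1\<close>, ... evaluated at $x$, $x^p$, ..., $x^{p^{t-1}}$.\<close>

primrec Q :: "nat \<Rightarrow> (int ^ 'n \<Rightarrow>\<^sub>0 'r fps)" where
  "Q 0 = 1"
| "Q (Suc t) = (\<Sum>w\<in>Poly_Mapping.keys (F t). Poly_Mapping.single (int (p ^ t) *s w) (Poly_Mapping.lookup (F t) w)) * Q t"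

lemma lfun_Q_Suc: "lfun h (Q (Suc t)) =
    (\<Sum>w\<in>Poly_Mapping.keys (F t). Poly_Mapping.lookup (F t) w * lfun (\<lambda>v. h (int (p ^ t) *s w + v)) (Q t))"
  by (simp add: sum_distrib_right lfun_sum lfun_mult_single)

lemma keys_Q: "v \<in> Poly_Mapping.keys (Q t) \<Longrightarrow> v \<in> M \<and> (real p - 1) * g v \<le> (real p ^ t - 1) * K"
proof (induction t arbitrary: v)
  case 0
  then show ?case by (simp add: M_0 g_0)
next
  case (Suc t)
  let ?P = "\<Sum>w\<in>Poly_Mapping.keys (F t). Poly_Mapping.single (int (p ^ t) *s w) (Poly_Mapping.lookup (F t) w)"
  obtain w' v' where wv: "w' \<in> Poly_Mapping.keys ?P" "v' \<in> Poly_Mapping.keys (Q t)" "v = w' + v'"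
    using Suc.prems Poly_Mapping.keys_mult[of ?P "Q t"] by auto
  have "w' \<in> (\<Union>w\<in>Poly_Mapping.keys (F t). Poly_Mapping.keys (Poly_Mapping.single (int (p ^ t) *s w) (Poly_Mapping.lookup (F t) w)))"
    by (rule subsetD[OF Poly_Mapping.keys_sum wv(1)])
  then obtain w where w: "w \<in> Poly_Mapping.keys (F t)" "w' = int (p ^ t) *s w"
    by (auto split: if_splits)
  have wM: "w \<in> M" "g w \<le> K" using gradedF[of t] w(1) by (auto simp: graded_def)
  have w'M: "w' \<in> M" "g w' = real p ^ t * g w" unfolding w(2)
    using M_scaleI[OF wM(1), of "p ^ t"] g_scale[OF wM(1), of "p ^ t"] by simp_all
  have v'M: "v' \<in> M" "(real p - 1) * g v' \<le> (real p ^ t - 1) * K" using Suc.IH[OF wv(2)] by auto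
  have "(real p - 1) * g v \<le> (real p - 1) * (g w' + g v')"
    unfolding wv(3) using g_add[OF w'M(1) v'M(1)] p2 by (intro mult_left_mono) auto
  also have "\<dots> \<le> (real p - 1) * (real p ^ t * K) + (real p ^ t - 1) * K"
    unfolding distrib_left w'M(2) using v'M(2) wM(2) p2
    by (intro add_mono mult_left_mono) auto
  also have "\<dots> = (real p ^ Suc t - 1) * K" by (simp add: algebra_simps)
  finally show ?case using M_add[OF w'M(1) v'M(1)] wv(3) by simp
qed

text \<open>The index $(i, u)$ stands for the exponent $u / (q-1)$ at the $i$-th step of a cycle. The factor
  $p^{a-i}$ compensates for the multiplication by \<open>p\<close> in each step. The bound on \<open>g\<close> is large enough for
  a step to stay below it: $p u' = u + r w$ with $g(u) \le r K$ and $g(w) \le K$ forces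
  $g(u') \le 2 r K / p \le r K$.\<close>

definition X :: "(nat \<times> (int ^ 'n)) set" where
  "X = {(i, u). i < a \<and> u \<in> M \<and> g u \<le> real r * K \<and> (\<forall>j. [u $ j = int p ^ (a - i) * d $ j] (mod int r))}"

definition B :: "nat \<times> (int ^ 'n) \<Rightarrow> nat \<times> (int ^ 'n) \<Rightarrow> 'r fps" where
  "B = (\<lambda>(i, u) (i', u'). if i' = Suc i mod a
     then lfun (\<lambda>w. if int p *s u' = u + int r *s w then 1 else 0) (F i) else 0)"

lemma finite_X: "finite X"
proof -
  have "X \<subseteq> {..<a} \<times> {u \<in> M. g u \<le> real r * K}" by (auto simp: X_def)
  then show ?thesis using finite_le by (meson finite_SigmaI finite_lessThan finite_subset)
qed

text \<open>If $p u' = u + r w$ then $p\,g(u') \le g(u) + r\,g(w)$, and the entry is the coefficient at \<open>w\<close>.\<close>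

lemma ord_ge_B:
  assumes "(i, u) \<in> X" "(i', u') \<in> X"
  shows "ord_ge (B (i, u) (i', u')) (real p / real r * g u' - 1 / real r * g u)"
proof -
  have "ord_ge (Poly_Mapping.lookup (F i) w * (if int p *s u' = u + int r *s w then 1 else 0)) (real p / real r * g u' - 1 / real r * g u)"
    if w: "w \<in> Poly_Mapping.keys (F i)" for w
  proof (cases "int p *s u' = u + int r *s w")
    case True
    have uM: "u \<in> M" "u' \<in> M" using assms by (auto simp: X_def)
    have wM: "w \<in> M" using w gradedF[of i] by (auto simp: graded_def)
    have "real p * g u' = g (u + int r *s w)" using g_scale[OF uM(2), of p] True by simp
    also have "\<dots> \<le> g u + real r * g w" using g_add[OF uM(1) M_scaleI[OF wM]] g_scale[OF wM] by simp
    finally have "real p / real r * g u' - 1 / real r * g u \<le> g w" using r_pos by (simp add: field_simps)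
    moreover have "ord_ge (Poly_Mapping.lookup (F i) w) (g w)" using graded_ord[OF gradedF] .
    ultimately show ?thesis using True ord_ge_mono by auto
  qed simp
  then show ?thesis unfolding B_def lfun_def by (auto intro!: ord_ge_sum)
qed

text \<open>Intermediate indices of a path that starts in \<open>X\<close> lie in \<open>X\<close>, so restricting the infinite matrix to
  \<open>X\<close> loses no path.\<close>

lemma X_predecessor:
  assumes X0: "(0, u) \<in> X" and X2: "(Suc t mod a, u'') \<in> X"
    and w: "w \<in> Poly_Mapping.keys (F t)" and v: "v \<in> Poly_Mapping.keys (Q t)"
    and u': "int p *s u'' = u' + int r *s w" and uv: "int (p ^ t) *s u' = u + int r *s v"
  shows "(t mod a, u') \<in> X"
proof -
  have p0: "p > 0" using p2 by simp
  have vM: "v \<in> M" "(real p - 1) * g v \<le> (real p ^ t - 1) * K" using keys_Q[OF v] by auto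
  have uM: "u \<in> M" "g u \<le> real r * K" using X0 by (auto simp: X_def)
  have "int (p ^ t) *s u' \<in> M" unfolding uv by (intro M_add uM M_scaleI vM)
  then have u'M: "u' \<in> M" using M_scale[of "p ^ t" u'] p0 by simp
  have "real p ^ t * g u' = g (int (p ^ t) *s u')" using g_scale[OF u'M, of "p ^ t"] by simp
  also have "\<dots> \<le> g u + real r * g v"
    unfolding uv using g_add[OF uM(1) M_scaleI[OF vM(1)]] g_scale[OF vM(1)] by simp
  also have "\<dots> \<le> real r * K + real r * ((real p ^ t - 1) * K)"
  proof -
    have "1 * g v \<le> (real p - 1) * g v" using p2 g_nonneg[OF vM(1)] by (intro mult_right_mono) auto
    then have "g v \<le> (real p ^ t - 1) * K" using vM(2) by linarith
    then show ?thesis using uM(2) by (intro add_mono mult_left_mono) auto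
  qed
  also have "\<dots> = real p ^ t * (real r * K)" by (simp add: algebra_simps)
  finally have "g u' \<le> real r * K" using p0 by simp
  moreover have "[u' $ j = int p ^ (a - t mod a) * d $ j] (mod int r)" for j
  proof -
    have "u' $ j = int p * u'' $ j - int r * w $ j"
      using arg_cong[OF u', of "\<lambda>x. x $ j"] by simp
    then have "[u' $ j = int p * u'' $ j] (mod int r)" by (simp add: cong_iff_dvd_diff)
    also have "[int p * u'' $ j = int p * (int p ^ (a - Suc t mod a) * d $ j)] (mod int r)"
      using X2 by (intro cong_scalar_left) (auto simp: X_def)
    also have "[int p * (int p ^ (a - Suc t mod a) * d $ j) = int p ^ (a - t mod a) * d $ j] (mod int r)"
    proof (cases "Suc (t mod a) = a")
      case True
      then have "Suc t mod a = 0" by (metis mod_Suc)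
      moreover have "a - t mod a = 1" using True by simp
      moreover have "[int p ^ a = 1] (mod int r)"
        using p0 by (simp add: cong_iff_dvd_diff r_def of_nat_diff)
      ultimately show ?thesis using cong_scalar_right[of "int p ^ a" 1 "int r" "int p * d $ j"]
        by (simp add: mult_ac)
    next
      case False
      then have *: "Suc t mod a = Suc (t mod a)" by (metis mod_Suc)
      have "Suc (t mod a) < a" using False a0 by (metis Suc_lessI mod_less_divisor)
      then have "a - t mod a = Suc (a - Suc t mod a)" unfolding * by simp
      then show ?thesis by (simp add: mult.assoc)
    qed
    finally show ?thesis .
  qed
  ultimately show ?thesis using u'M a0 by (simp add: X_def)
qed

text \<open>The steps $p u_{j+1} = u_j + r w_j$ of a path from \<open>u\<close> to \<open>u'\<close> telescope to
  $p^t u' = u + r \sum_{j<t} p^j w_j$, and the path is determined by its end and the $w_j$. So the sum over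
  paths is a coefficient of the product \<open>Q t\<close>.\<close>

lemma mpow_B:
  assumes "(0, u) \<in> X" "(i, u') \<in> X"
  shows "mpow X B t (0, u) (i, u') =
    (if i = t mod a then lfun (\<lambda>v. if int (p ^ t) *s u' = u + int r *s v then 1 else 0) (Q t) else 0)"
  using assms(2)
proof (induction t arbitrary: i u')
  case 0
  show ?case by (cases "i = 0"; cases "u' = u") (simp_all add: lfun_one)
next
  case (Suc t i u'')
  define ind where "ind = (\<lambda>t u' v. if int (p ^ t) *s u' = u + int r *s v then 1 else 0 :: 'r fps)"
  have IH: "mpow X B t (0, u) (i', u') = (if i' = t mod a then lfun (ind t u') (Q t) else 0)" if "(i', u') \<in> X" for i' u'
    unfolding ind_def by (rule Suc.IH[OF that])
  define Xt where "Xt = {u'. (t mod a, u') \<in> X}"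
  have finXt: "finite Xt"
  proof -
    have "Xt \<subseteq> snd ` X" by (force simp: Xt_def)
    then show ?thesis using finite_X finite_subset by blast
  qed
  have "mpow X B (Suc t) (0, u) (i, u'') = (\<Sum>(i', u')\<in>X. (if i' = t mod a then lfun (ind t u') (Q t) else 0) * B (i', u') (i, u''))"
    by (auto simp: IH intro!: sum.cong)
  also have "\<dots> = (\<Sum>(i', u')\<in>Pair (t mod a) ` Xt. lfun (ind t u') (Q t) * B (i', u') (i, u''))"
    by (rule sum.mono_neutral_cong_right) (auto simp: finite_X Xt_def)
  also have "\<dots> = (\<Sum>u'\<in>Xt. lfun (ind t u') (Q t) * B (t mod a, u') (i, u''))"
    by (subst sum.reindex) (auto simp: inj_on_def)
  also have "\<dots> = (if i = Suc t mod a then lfun (ind (Suc t) u'') (Q (Suc t)) else 0)"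
  proof (cases "i = Suc t mod a")
    case False
    then show ?thesis by (simp add: B_def mod_Suc_eq)
  next
    case True
    have "(\<Sum>u'\<in>Xt. lfun (ind t u') (Q t) * B (t mod a, u') (i, u'')) =
      (\<Sum>u'\<in>Xt. lfun (ind t u') (Q t) * (\<Sum>w\<in>Poly_Mapping.keys (F t). Poly_Mapping.lookup (F t) w * (if int p *s u'' = u' + int r *s w then 1 else 0)))"
      using True by (simp add: B_def mod_Suc_eq F_mod) (simp add: lfun_def)
    also have "\<dots> = (\<Sum>w\<in>Poly_Mapping.keys (F t). Poly_Mapping.lookup (F t) w *
        (\<Sum>u'\<in>Xt. (if int p *s u'' = u' + int r *s w then 1 else 0) * lfun (ind t u') (Q t)))"
      unfolding sum_distrib_left by (subst sum.swap) (simp add: mult_ac)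
    also have "\<dots> = (\<Sum>w\<in>Poly_Mapping.keys (F t). Poly_Mapping.lookup (F t) w *
        lfun (\<lambda>v. ind (Suc t) u'' (int (p ^ t) *s w + v)) (Q t))"
    proof (intro sum.cong refl arg_cong[where f = "(*) _"])
      fix w assume w: "w \<in> Poly_Mapping.keys (F t)"
      define u' where "u' = int p *s u'' - int r *s w"
      have u': "int p *s u'' = y + int r *s w \<longleftrightarrow> y = u'" for y by (auto simp: u'_def algebra_simps)
      have ind: "ind (Suc t) u'' (int (p ^ t) *s w + v) = ind t u' v" for v
      proof -
        have "int (p ^ Suc t) *s u'' = u + int r *s (int (p ^ t) *s w + v) \<longleftrightarrow> int (p ^ t) *s u' = u + int r *s v"
          by (auto simp: u'_def Finite_Cartesian_Product.vec_eq_iff algebra_simps)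
        then show ?thesis by (simp add: ind_def)
      qed
      have "(\<Sum>y\<in>Xt. (if int p *s u'' = y + int r *s w then 1 else 0) * lfun (ind t y) (Q t)) =
        (\<Sum>y\<in>Xt. if y = u' then lfun (ind t y) (Q t) else 0)"
        unfolding u' by (intro sum.cong) auto
      also have "\<dots> = (if u' \<in> Xt then lfun (ind t u') (Q t) else 0)"
        using finXt by simp
      also have "\<dots> = lfun (ind t u') (Q t)"
      proof (cases "u' \<in> Xt")
        case False
        have "ind t u' v = 0" if "v \<in> Poly_Mapping.keys (Q t)" for v
          using X_predecessor[OF assms(1) _ w that, of u'' u'] Suc.prems True False u' by (auto simp: ind_def Xt_def)
        then have "lfun (ind t u') (Q t) = 0" by (simp add: lfun_def)
        then show ?thesis by simp
      qed simp
      finally show "(\<Sum>y\<in>Xt. (if int p *s u'' = y + int r *s w then 1 else 0) * lfun (ind t y) (Q t)) =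
          lfun (\<lambda>v. ind (Suc t) u'' (int (p ^ t) *s w + v)) (Q t)"
        unfolding ind .
    qed
    also have "\<dots> = lfun (ind (Suc t) u'') (Q (Suc t))" unfolding lfun_Q_Suc ..
    finally show ?thesis using True by simp
  qed
  finally show ?case unfolding ind_def .
qed

lemma mpow_B_level:
  assumes "mpow X B t (i, u) (i', u') \<noteq> 0" "i < a"
  shows "i' = (i + t) mod a"
  using assms(1)
proof (induction t arbitrary: i' u')
  case 0
  then show ?case using assms(2) by (simp split: if_splits)
next
  case (Suc t)
  then obtain z where z: "z \<in> X" "mpow X B t (i, u) z * B z (i', u') \<noteq> 0"
    by (auto elim!: sum.not_neutral_contains_not_neutral)
  obtain j v where zj: "z = (j, v)" by force
  have "mpow X B t (i, u) (j, v) \<noteq> 0" "B (j, v) (i', u') \<noteq> 0" using z(2) zj by auto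
  then have "j = (i + t) mod a" "i' = Suc j mod a" using Suc.IH by (auto simp: B_def split: if_splits)
  then show ?case by (simp add: mod_Suc_eq)
qed

lemma trace_B_eq_0:
  assumes "\<not> a dvd k"
  shows "(\<Sum>x\<in>X. mpow X B k x x) = 0"
proof (rule sum.neutral, rule ballI)
  fix x assume "x \<in> X"
  obtain i u where x: "x = (i, u)" by force
  have i: "i < a" using \<open>x \<in> X\<close> x by (auto simp: X_def)
  show "mpow X B k x x = 0"
  proof (rule ccontr)
    assume "mpow X B k x x \<noteq> 0"
    then have "i = (i + k) mod a" using mpow_B_level i unfolding x by blast
    then have "(i + k) mod a = i mod a" using i by simp
    then have "a dvd k" by (metis add_diff_cancel_left' le_add1 mod_eq_dvd_iff_nat)
    then show False using assms by simp
  qed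
qed

lemma mpow_Suc_left:
  assumes "finite Y" "x \<in> Y" "y \<in> Y"
  shows "mpow Y b (Suc k) x y = (\<Sum>z\<in>Y. b x z * mpow Y b k z y)"
  using assms(3)
proof (induction k arbitrary: y)
  case 0
  have "(\<Sum>z\<in>Y. (if x = z then 1 else 0) * b z y) = (\<Sum>z\<in>Y. if z = x then b z y else 0)"
    "(\<Sum>z\<in>Y. b x z * (if z = y then 1 else 0)) = (\<Sum>z\<in>Y. if z = y then b x z else 0)"
    by (auto intro!: sum.cong)
  then show ?case using 0 assms by simp
next
  case (Suc k)
  have "mpow Y b (Suc (Suc k)) x y = (\<Sum>z\<in>Y. (\<Sum>z'\<in>Y. b x z' * mpow Y b k z' z) * b z y)"
    using Suc.IH by (subst mpow.simps(2)) (auto intro!: sum.cong)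
  also have "\<dots> = (\<Sum>z'\<in>Y. \<Sum>z\<in>Y. b x z' * (mpow Y b k z' z * b z y))"
    unfolding sum_distrib_right by (subst sum.swap) (simp add: mult.assoc)
  finally show ?case by (simp add: sum_distrib_left)
qed

text \<open>Cyclicity of the trace: moving one factor \<open>B\<close> from the front to the back moves the base point of a
  closed path to the next level.\<close>

lemma trace_B_levels:
  assumes "a dvd k" "k > 0" "i < a"
  shows "(\<Sum>x\<in>{x \<in> X. fst x = i}. mpow X B k x x) = (\<Sum>x\<in>{x \<in> X. fst x = 0}. mpow X B k x x)"
  using assms(3)
proof (induction i)
  case (Suc i)
  obtain k' where k: "k = Suc k'" using assms(2) by (cases k) auto
  have lev: "B x y = 0" if "x \<in> X" "y \<in> X" "fst x = i \<longleftrightarrow> fst y \<noteq> Suc i" for x y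
  proof -
    obtain j u j' u' where xy: "x = (j, u)" "y = (j', u')" by force
    have "j' \<noteq> Suc j mod a"
    proof
      assume *: "j' = Suc j mod a"
      have "j < a" using that(1) xy by (auto simp: X_def)
      show False
      proof (cases "Suc j = a")
        case True
        then show False using * that(3) xy Suc.prems by auto
      next
        case False
        then have "j' = Suc j" using * \<open>j < a\<close> by simp
        then show False using that(3) xy by auto
      qed
    qed
    then show ?thesis by (simp add: xy B_def)
  qed
  let ?L = "\<lambda>i. {x \<in> X. fst x = i}"
  have fin: "finite (?L i)" for i using finite_X by simp
  have "(\<Sum>x\<in>?L i. mpow X B k x x) = (\<Sum>x\<in>?L i. \<Sum>y\<in>X. B x y * mpow X B k' y x)"
    unfolding k by (intro sum.cong refl mpow_Suc_left finite_X) auto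
  also have "\<dots> = (\<Sum>x\<in>?L i. \<Sum>y\<in>?L (Suc i). B x y * mpow X B k' y x)"
    using lev by (intro sum.cong refl sum.mono_neutral_right finite_X) auto
  also have "\<dots> = (\<Sum>y\<in>?L (Suc i). \<Sum>x\<in>?L i. mpow X B k' y x * B x y)"
    by (subst sum.swap) (simp add: mult.commute)
  also have "\<dots> = (\<Sum>y\<in>?L (Suc i). \<Sum>x\<in>X. mpow X B k' y x * B x y)"
    using lev by (intro sum.cong refl sum.mono_neutral_left finite_X) auto
  finally show ?case using Suc unfolding k by simp
qed simp

lemma trace_B_eq:
  assumes "a dvd k" "k > 0"
  shows "(\<Sum>x\<in>X. mpow X B k x x) = of_nat a * (\<Sum>x\<in>{x \<in> X. fst x = 0}. mpow X B k x x)"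
proof -
  have "(\<Sum>x\<in>X. mpow X B k x x) = (\<Sum>i<a. \<Sum>x\<in>{x \<in> X. fst x = i}. mpow X B k x x)"
  proof (rule sum.group[OF finite_X, symmetric])
    show "fst ` X \<subseteq> {..<a}" by (auto simp: X_def)
  qed simp
  also have "\<dots> = (\<Sum>i<a. \<Sum>x\<in>{x \<in> X. fst x = 0}. mpow X B k x x)"
    by (intro sum.cong refl trace_B_levels[OF assms]) simp
  finally show ?thesis by simp
qed

text \<open>The closed paths of length $ak$ through level 0 correspond to the solutions of $(q^k-1) u = (q-1) v$
  with $u \equiv d$ modulo $q-1$. Writing $u = d + (q-1) y$ turns this into
  $v = d (q^k-1)/(q-1) + (q^k-1) y$.\<close>

lemma trace_level_0:
  assumes "k > 0"
  shows "(\<Sum>x\<in>{x \<in> X. fst x = 0}. mpow X B (a * k) x x) =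
    lfun (\<lambda>v. if \<forall>j. int (p ^ (a * k) - 1) dvd v $ j - (\<Sum>i<k. int (p ^ a) ^ i) * d $ j then 1 else 0) (Q (a * k))"
proof -
  define t where "t = a * k"
  define U where "U = {u. (0, u) \<in> X}"
  define s where "s = p ^ t - 1"
  have p0: "p > 0" using p2 by simp
  have s: "int (p ^ t) = int s + 1" using p0 by (simp add: s_def of_nat_diff)
  have r: "int (p ^ a) = int r + 1" using p0 by (simp add: r_def of_nat_diff)
  have "1 < p ^ t" by (rule one_less_power) (use p2 a0 assms in \<open>auto simp: t_def\<close>)
  then have s0: "s > 0" by (simp add: s_def)
  define E where "E = (\<Sum>i<k. int (p ^ a) ^ i)"
  have E: "int s = E * int r"
  proof -
    have "int (p ^ a) ^ k - 1 = (int (p ^ a) - 1) * E"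
      unfolding E_def by (simp only: power_diff_1_eq)
    then show ?thesis using s r by (simp add: t_def power_mult algebra_simps)
  qed
  have finU: "finite U"
  proof -
    have "U \<subseteq> snd ` X" by (force simp: U_def)
    then show ?thesis using finite_X finite_subset by blast
  qed
  have inj: "inj_on (Pair (0::nat)) U" by (auto simp: inj_on_def)
  have "{x \<in> X. fst x = 0} = Pair 0 ` U" by (auto simp: U_def)
  then have "(\<Sum>x\<in>{x \<in> X. fst x = 0}. mpow X B t x x) = (\<Sum>u\<in>U. mpow X B t (0, u) (0, u))"
    by (simp add: sum.reindex[OF inj])
  also have "\<dots> = (\<Sum>u\<in>U. lfun (\<lambda>v. if int (p ^ t) *s u = u + int r *s v then 1 else 0) (Q t))"
    by (intro sum.cong refl, subst mpow_B) (simp_all add: U_def, simp add: t_def)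
  also have "\<dots> = lfun (\<lambda>v. \<Sum>u\<in>U. if int (p ^ t) *s u = u + int r *s v then 1 else 0) (Q t)"
    by (rule lfun_sum_left[symmetric])
  also have "\<dots> = lfun (\<lambda>v. if \<forall>j. int s dvd v $ j - E * d $ j then 1 else 0) (Q t)"
  proof (rule lfun_cong)
    fix v assume v: "v \<in> Poly_Mapping.keys (Q t)"
    have eq: "int (p ^ t) *s u = u + int r *s v \<longleftrightarrow> int s *s u = int r *s v" for u
      unfolding s by (simp add: Finite_Cartesian_Product.vec_eq_iff algebra_simps)
    show "(\<Sum>u\<in>U. if int (p ^ t) *s u = u + int r *s v then 1 else 0 :: 'r fps) =
        (if \<forall>j. int s dvd v $ j - E * d $ j then 1 else 0)"
    proof (cases "\<forall>j. int s dvd v $ j - E * d $ j")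
      case True
      then obtain y where y: "\<And>j. v $ j - E * d $ j = int s * y j" unfolding dvd_def by metis
      define u where "u = (\<chi> j. d $ j + int r * y j)"
      have u: "int s *s u = int r *s v"
      proof -
        have "int s * (d $ j + int r * y j) = int r * v $ j" for j
        proof -
          have "v $ j = E * d $ j + int s * y j" using y[of j] by simp
          then show ?thesis using E by (simp add: algebra_simps)
        qed
        then show ?thesis by (simp add: Finite_Cartesian_Product.vec_eq_iff u_def)
      qed
      have vM: "v \<in> M" "(real p - 1) * g v \<le> (real p ^ t - 1) * K" using keys_Q[OF v] by auto
      have uM: "u \<in> M" using M_scaleI[OF vM(1), of r] u M_scale[OF s0, of u] by simp
      have "(0, u) \<in> X"
      proof -
        have "real s * g u = real r * g v" using g_scale[OF uM, of s] g_scale[OF vM(1), of r] u by simp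
        moreover have "1 * g v \<le> (real p - 1) * g v" using p2 g_nonneg[OF vM(1)] by (intro mult_right_mono) auto
        moreover have "real p ^ t - 1 = real s" using p0 by (simp add: s_def of_nat_diff)
        ultimately have "real s * g u \<le> real r * (real s * K)" using vM(2) by (simp add: mult_left_mono)
        then have "real s * g u \<le> real s * (real r * K)" by (simp add: mult_ac)
        then have "g u \<le> real r * K" using s0 by simp
        moreover have "[u $ j = int p ^ a * d $ j] (mod int r)" for j
        proof -
          have "u $ j - int p ^ a * d $ j = int r * (y j - d $ j)"
            using r by (simp add: u_def algebra_simps)
          then show ?thesis by (simp add: cong_iff_dvd_diff)
        qed
        ultimately show ?thesis using uM a0 by (simp add: X_def)
      qed
      then have uU: "u \<in> U" by (simp add: U_def)
      have "int s *s u' = int r *s v \<longleftrightarrow> u' = u" for u'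
        unfolding u[symmetric] using s0 by (auto simp: Finite_Cartesian_Product.vec_eq_iff)
      then show ?thesis using True uU finU unfolding eq by simp
    next
      case False
      have "int s *s u \<noteq> int r *s v" if "u \<in> U" for u
      proof
        assume u: "int s *s u = int r *s v"
        have "int s dvd v $ j - E * d $ j" for j
        proof -
          have "[u $ j = int p ^ a * d $ j] (mod int r)" using that by (auto simp: U_def X_def)
          also have "[int p ^ a * d $ j = 1 * d $ j] (mod int r)"
            by (rule cong_scalar_right) (use r in \<open>simp add: cong_iff_dvd_diff\<close>)
          finally obtain y where y: "u $ j - d $ j = int r * y" by (auto simp: cong_iff_dvd_diff)
          then have "u $ j = d $ j + int r * y" by simp
          moreover have "int s * u $ j = int r * v $ j" using arg_cong[OF u, of "\<lambda>x. x $ j"] by simp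
          ultimately have "int r * v $ j = int r * (E * d $ j + int s * y)"
            using E by (simp add: algebra_simps)
          then have "v $ j = E * d $ j + int s * y" using r_pos by (simp only: mult_cancel_left) simp
          then show ?thesis by simp
        qed
        then show False using False by blast
      qed
      then show ?thesis using False unfolding eq by (simp add: sum.neutral)
    qed
  qed
  finally show ?thesis by (simp only: t_def s_def E_def)
qed

end


section \<open>The exponential sums modulo powers of $T$\<close>

text \<open>The product of the exponentials of the terms of $f$ times $\log(1+T)$, each truncated after \<open>N\<close>
  terms, with the coefficients of $f$ replaced by their Frobenius conjugates.\<close>

definition splitting_factor :: "nat \<Rightarrow> (int ^ 'n \<Rightarrow>\<^sub>0 'r::field_char_0) \<Rightarrow> nat \<Rightarrow> nat \<Rightarrow> int ^ 'n \<Rightarrow>\<^sub>0 'r fps" where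
  "splitting_factor N f p t = (\<Prod>u\<in>Poly_Mapping.keys f. \<Sum>j<N.
     Poly_Mapping.single (int j *s u) (fps_const ((Poly_Mapping.lookup f u ^ (p ^ t)) ^ j / fact j) * fps_ln 1 ^ j))"

lemma lev_splitting_factor:
  assumes "\<And>i. y $ i \<noteq> 0"
  shows "lev y (splitting_factor N f p t) =
    (\<Prod>u\<in>Poly_Mapping.keys f. exp_trunc N (Poly_Mapping.lookup f u ^ (p ^ t) * lmonom y u))"
  unfolding splitting_factor_def exp_trunc_def
  by (subst lfun_prod) (auto simp: lmonom_add assms lfun_sum lfun_single lmonom_scale power_mult_distrib mult_ac
      simp flip: fps_const_mult intro!: prod.cong sum.cong)

lemma (in lattice_degree) graded_splitting_factor:
  assumes "\<And>u. u \<in> Poly_Mapping.keys f \<Longrightarrow> u \<in> M \<and> g u \<le> 1"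
  shows "graded (splitting_factor N f p t) (real (card (Poly_Mapping.keys f)) * real N)"
  unfolding splitting_factor_def
proof (intro graded_prod graded_sum graded_single)
  fix u j assume u: "u \<in> Poly_Mapping.keys f" and j: "j \<in> {..<N}"
  have uM: "u \<in> M" "g u \<le> 1" using assms[OF u] by auto
  then show "int j *s u \<in> M" by (intro M_scaleI)
  have le: "g (int j *s u) \<le> real j" using g_scale[OF uM(1), of j] uM(2) by (simp add: mult_left_le)
  then show "g (int j *s u) \<le> real N" using j by simp
  have "ord_ge (fps_ln 1 ^ j :: 'a fps) (g (int j *s u))"
    using ord_ge_power[OF ord_ge_fps_ln[where 'r = 'a], of j] le ord_ge_mono by simp
  then show "ord_ge (fps_const ((Poly_Mapping.lookup f u ^ p ^ t) ^ j / fact j) * fps_ln 1 ^ j) (g (int j *s u))"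
    by (rule ord_ge_mult_left)
qed

lemma mu_power_eq_1:
  assumes "m > 0" "z \<in> (mu (CHAR('k) ^ m) :: 'k::{alg_closed_field, field_prime_char} witt fract set)"
  shows "z ^ (CHAR('k) ^ m - 1) = 1" and "z \<noteq> 0" and "z ^ (CHAR('k) ^ m) = z"
proof -
  show 1: "z ^ (CHAR('k) ^ m - 1) = 1" using mu_eq(2)[OF assms(1), where 'k = 'k] assms(2) by auto
  have p2: "CHAR('k) \<ge> 2" using prime_ge_2_nat[of "CHAR('k)"] by simp
  have N: "CHAR('k) ^ m > 1" by (rule one_less_power) (use p2 assms(1) in auto)
  show "z \<noteq> 0"
  proof
    assume "z = 0"
    then have "(0 :: 'k witt fract) = 1" using 1 N by (simp only: power_0_left) simp
    then show False by simp
  qed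
  have "CHAR('k) ^ m = Suc (CHAR('k) ^ m - 1)" using N by simp
  then have "z ^ (CHAR('k) ^ m) = z * z ^ (CHAR('k) ^ m - 1)" by (metis power_Suc)
  then show "z ^ (CHAR('k) ^ m) = z" using 1 by simp
qed

lemma pow_minus_1_dvd: "x - 1 dvd x ^ k - (1 :: nat)" if "x > 0"
proof -
  have "int x - 1 dvd int x ^ k - 1" by (simp add: power_diff_1_eq)
  moreover have "int x ^ k - 1 = int (x ^ k - 1)" "int x - 1 = int (x - 1)" using that by (simp_all add: of_nat_diff)
  ultimately show ?thesis by (metis int_dvd_int_iff)
qed

text \<open>All terms of $f(x)$ are roots of unity of order dividing $q^k-1$, that is, Teichmueller elements, and
  Frobenius acts on these by raising to the \<open>p\<close>-th power.\<close>

lemma trace_laurent_eval: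
  fixes f :: "int ^ 'n \<Rightarrow>\<^sub>0 'k::{alg_closed_field, field_prime_char} witt fract"
  assumes a0: "a > 0" and k0: "k > 0"
    and f: "\<And>u. u \<in> Poly_Mapping.keys f \<Longrightarrow> Poly_Mapping.lookup f u \<in> mu (CHAR('k) ^ a)"
    and x: "\<And>i. x $ i \<in> mu (CHAR('k) ^ (a * k))"
  shows "ring_trace (Zq CHAR('k)) (Zq (CHAR('k) ^ (a * k))) (laurent_eval f x) =
    (\<Sum>t<a * k. \<Sum>u\<in>Poly_Mapping.keys f. (Poly_Mapping.lookup f u * lmonom x u) ^ (CHAR('k) ^ t))"
proof -
  let ?p = "CHAR('k)"
  let ?N = "?p ^ (a * k)"
  have m0: "a * k > 0" using a0 k0 by simp
  have p0: "?p > 0" by (simp add: prime_gt_0_nat)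
  have "?p ^ a - 1 dvd ?N - 1" using pow_minus_1_dvd[of "?p ^ a" k] p0 by (simp add: power_mult)
  then obtain c where c: "?N - 1 = (?p ^ a - 1) * c" by (elim dvdE)
  have "\<exists>y\<in>GF ?N. Poly_Mapping.lookup f u * lmonom x u = teichmuller y" if u: "u \<in> Poly_Mapping.keys f" for u
  proof -
    have "Poly_Mapping.lookup f u ^ (?N - 1) = 1"
      unfolding c power_mult[of _ "?p ^ a - 1" c] using mu_power_eq_1(1)[OF a0 f[OF u]] by simp
    moreover have "lmonom x u ^ (?N - 1) = 1"
      unfolding lmonom_power[symmetric] using mu_power_eq_1(1)[OF m0 x]
      by (simp add: lmonom_def)
    ultimately have "(Poly_Mapping.lookup f u * lmonom x u) ^ (?N - 1) = 1"
      by (simp only: power_mult_distrib mult_1)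
    then have "Poly_Mapping.lookup f u * lmonom x u \<in> mu ?N"
      using mu_eq(2)[OF m0, where 'k = 'k] by blast
    then show ?thesis using mu_eq(1)[OF m0, where 'k = 'k] by blast
  qed
  then obtain y where y: "\<And>u. u \<in> Poly_Mapping.keys f \<Longrightarrow> y u \<in> GF ?N"
      "\<And>u. u \<in> Poly_Mapping.keys f \<Longrightarrow> Poly_Mapping.lookup f u * lmonom x u = teichmuller (y u)"
    by metis
  define w where "w = (\<Sum>u\<in>Poly_Mapping.keys f. witt_teich (y u))"
  have w: "w \<in> frob_fixed (a * k)"
    unfolding w_def by (intro frob_fixed_sum frob_fixed_teich y)
  have "laurent_eval f x = (\<Sum>u\<in>Poly_Mapping.keys f. Poly_Mapping.lookup f u * lmonom x u)"
    by (simp add: laurent_eval_def lmonom_def)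
  also have "\<dots> = to_fract w" using y(2) by (simp add: w_def teichmuller_eq)
  finally have "ring_trace (Zq ?p) (Zq ?N) (laurent_eval f x) = (\<Sum>l<a * k. to_fract ((witt_frob ^^ l) w))"
    using ring_trace_frob_sum[OF m0 w] by simp
  also have "\<dots> = (\<Sum>t<a * k. \<Sum>u\<in>Poly_Mapping.keys f. (Poly_Mapping.lookup f u * lmonom x u) ^ (?p ^ t))"
  proof (intro sum.cong refl)
    fix l
    have "(witt_frob ^^ l) w = (\<Sum>u\<in>Poly_Mapping.keys f. witt_teich (y u ^ (?p ^ l)))"
      unfolding w_def witt_frob_pow_hom(5) witt_frob_pow_teich ..
    then show "to_fract ((witt_frob ^^ l) w) = (\<Sum>u\<in>Poly_Mapping.keys f. (Poly_Mapping.lookup f u * lmonom x u) ^ (?p ^ l))"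
      using y(2) by (simp flip: teichmuller_eq teichmuller_power)
  qed
  finally show ?thesis .
qed

lemma sum_vec_prod:
  fixes h :: "'n::finite \<Rightarrow> 'a \<Rightarrow> 'b::comm_semiring_1"
  assumes "finite A"
  shows "(\<Sum>x | \<forall>i. x $ i \<in> A. \<Prod>i\<in>UNIV. h i (x $ i)) = (\<Prod>i\<in>UNIV. \<Sum>z\<in>A. h i z)"
proof -
  have "(\<Prod>i\<in>UNIV. \<Sum>z\<in>A. h i z) = (\<Sum>\<phi>\<in>PiE UNIV (\<lambda>_. A). \<Prod>i\<in>UNIV. h i (\<phi> i))"
    by (rule prod_sum_PiE) (use assms in auto)
  also have "\<dots> = (\<Sum>x | \<forall>i. x $ i \<in> A. \<Prod>i\<in>UNIV. h i (x $ i))"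
    by (rule sum.reindex_bij_witness[of _ "\<lambda>x. ($) x" vec_lambda]) (auto simp: PiE_def)
  finally show ?thesis ..
qed

lemma finite_vec: "finite A \<Longrightarrow> finite {x :: 'a ^ 'n. \<forall>i. x $ i \<in> A}"
proof -
  assume "finite A"
  then have "finite (PiE (UNIV :: 'n set) (\<lambda>_. A))" by (intro finite_PiE) auto
  moreover have "{x :: 'a ^ 'n. \<forall>i. x $ i \<in> A} \<subseteq> vec_lambda ` PiE UNIV (\<lambda>_. A)"
  proof
    fix x :: "'a ^ 'n" assume "x \<in> {x. \<forall>i. x $ i \<in> A}"
    then show "x \<in> vec_lambda ` PiE UNIV (\<lambda>_. A)" by (intro image_eqI[of _ _ "($) x"]) auto
  qed
  ultimately show ?thesis using finite_surj by blast
qed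

lemma sum_fps_const: "(\<Sum>i\<in>A. fps_const (h i)) = fps_const (\<Sum>i\<in>A. h i :: 'a::comm_ring_1)"
  by (induction A rule: infinite_finite_induct) auto

lemma character_orthogonality:
  fixes v d :: "int ^ 'n"
  assumes m0: "a * k > 0" and q: "q = CHAR('k) ^ a"
  shows "(\<Sum>x | \<forall>i. x $ i \<in> mu (q ^ k). chi q d k x * lmonom x v :: 'k::{alg_closed_field, field_prime_char} witt fract) =
    (if \<forall>j. int (q ^ k - 1) dvd v $ j - (\<Sum>i<k. int q ^ i) * d $ j then of_nat (q ^ k - 1) ^ CARD('n) else 0)"
proof -
  define E where "E = (\<Sum>i<k. int q ^ i)"
  have qk: "q ^ k = CHAR('k) ^ (a * k)" by (simp add: q power_mult)
  have fin: "finite (mu (q ^ k) :: 'k witt fract set)" unfolding qk by (rule mu_eq(3)[OF m0])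
  have "(\<Sum>x | \<forall>i. x $ i \<in> mu (q ^ k). chi q d k x * lmonom x v :: 'k witt fract) =
    (\<Sum>x | \<forall>i. x $ i \<in> mu (q ^ k). \<Prod>i\<in>UNIV. (x $ i) powi (v $ i - E * d $ i))"
  proof (intro sum.cong refl)
    fix x :: "'k witt fract ^ 'n" assume "x \<in> {x. \<forall>i. x $ i \<in> mu (q ^ k)}"
    then have nz: "x $ i \<noteq> 0" for i using mu_power_eq_1(2)[OF m0] unfolding qk by blast
    show "chi q d k x * lmonom x v = (\<Prod>i\<in>UNIV. (x $ i) powi (v $ i - E * d $ i))"
      unfolding chi_def lmonom_def prod.distrib[symmetric] E_def[symmetric]
      by (intro prod.cong refl) (simp add: nz mult.commute flip: power_int_add)
  qed
  also have "\<dots> = (\<Prod>i\<in>UNIV. \<Sum>z\<in>mu (q ^ k). z powi (v $ i - E * d $ i))"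
    by (rule sum_vec_prod[OF fin])
  also have "\<dots> = (\<Prod>i\<in>UNIV. if int (q ^ k - 1) dvd v $ i - E * d $ i then of_nat (q ^ k - 1) else 0)"
    unfolding qk mu_orthogonality[OF m0] ..
  also have "\<dots> = (if \<forall>j. int (q ^ k - 1) dvd v $ j - E * d $ j then of_nat (q ^ k - 1) ^ CARD('n) else 0)"
    by (auto intro!: prod_zero)
  finally show ?thesis by (simp only: E_def)
qed

lemma (in trace_setup) lfun_Q_prod:
  assumes h: "\<And>v w. h (v + w) = h v * h w" "h 0 = 1"
  shows "lfun h (Q t) = (\<Prod>i<t. lfun (\<lambda>w. h (int (p ^ i) *s w)) (F i))"
proof (induction t)
  case (Suc t)
  have "lfun h (Q (Suc t)) = (\<Sum>w\<in>Poly_Mapping.keys (F t). Poly_Mapping.lookup (F t) w * h (int (p ^ t) *s w)) * lfun h (Q t)"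
    unfolding lfun_Q_Suc by (simp only: h(1) lfun_cmult_left sum_distrib_right mult.assoc)
  then show ?case using Suc by (simp add: lfun_def mult.commute)
qed (simp add: lfun_one h)

text \<open>The binomial series of the trace is congruent to the value of \<open>Q\<close> at \<open>x\<close>; summing the monomials of \<open>Q\<close>
  over all \<open>x\<close> leaves the exponents in one residue class.\<close>

theorem exp_sum_cong:
  fixes f :: "int ^ 'n \<Rightarrow>\<^sub>0 'k::{alg_closed_field, field_prime_char} witt fract" and N p a q :: nat
  assumes tr_setup: "trace_setup M g (splitting_factor N f p) K p a"
    and p: "p = CHAR('k)" and q: "q = p ^ a" and k0: "k > 0"
    and f: "\<And>u. u \<in> Poly_Mapping.keys f \<Longrightarrow> Poly_Mapping.lookup f u \<in> mu q"
  shows "ord_ge (exp_sum q d f k - fps_const (of_nat (q ^ k - 1) ^ CARD('n)) *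
    lfun (\<lambda>v. if \<forall>j. int (q ^ k - 1) dvd v $ j - (\<Sum>i<k. int q ^ i) * d $ j then 1 else 0)
      (trace_setup.Q (splitting_factor N f p) p (a * k))) (real N)"
proof -
  interpret trace_setup M g "splitting_factor N f p" K p a by (rule tr_setup)
  have m0: "a * k > 0" using a0 k0 by simp
  have qk: "q ^ k = CHAR('k) ^ (a * k)" by (simp add: q p power_mult)
  let ?A = "{x :: 'k witt fract ^ 'n. \<forall>i. x $ i \<in> mu (q ^ k)}"
  have main: "ord_ge (fps_binomial (ring_trace (Zq CHAR('k)) (Zq (q ^ k)) (laurent_eval f x)) - lev x (Q (a * k))) (real N)"
    if "x \<in> ?A" for x
  proof -
    have x: "x $ i \<in> mu (CHAR('k) ^ (a * k))" for i using that by (simp add: qk)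
    then have nz: "x $ i \<noteq> 0" for i using mu_power_eq_1(2)[OF m0] by blast
    have f': "\<And>u. u \<in> Poly_Mapping.keys f \<Longrightarrow> Poly_Mapping.lookup f u \<in> mu (CHAR('k) ^ a)"
      using f by (simp add: q p)
    have l: "lev x (Q (a * k)) = (\<Prod>t<a * k. \<Prod>u\<in>Poly_Mapping.keys f. exp_trunc N ((Poly_Mapping.lookup f u * lmonom x u) ^ (p ^ t)))"
    proof -
      have "lev x (Q (a * k)) = (\<Prod>t<a * k. lfun (\<lambda>w. fps_const (lmonom x (int (p ^ t) *s w))) (splitting_factor N f p t))"
        by (rule lfun_Q_prod) (simp_all add: lmonom_add[OF nz])
      also have "\<dots> = (\<Prod>t<a * k. lev (\<chi> i. x $ i ^ (p ^ t)) (splitting_factor N f p t))"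
        by (simp only: lmonom_scale lmonom_power)
      also have "\<dots> = (\<Prod>t<a * k. \<Prod>u\<in>Poly_Mapping.keys f. exp_trunc N ((Poly_Mapping.lookup f u * lmonom x u) ^ (p ^ t)))"
        by (intro prod.cong refl, subst lev_splitting_factor) (simp_all add: nz lmonom_power power_mult_distrib)
      finally show ?thesis .
    qed
    have "fps_binomial (ring_trace (Zq CHAR('k)) (Zq (q ^ k)) (laurent_eval f x)) =
       (\<Prod>t<a * k. \<Prod>u\<in>Poly_Mapping.keys f. fps_binomial ((Poly_Mapping.lookup f u * lmonom x u) ^ (p ^ t)))"
    proof -
      have "ring_trace (Zq CHAR('k)) (Zq (q ^ k)) (laurent_eval f x) =
          (\<Sum>t<a * k. \<Sum>u\<in>Poly_Mapping.keys f. (Poly_Mapping.lookup f u * lmonom x u) ^ (p ^ t))"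
        unfolding qk p by (rule trace_laurent_eval[OF a0 k0]) (use f' x in auto)
      then show ?thesis by (simp only: fps_binomial_sum)
    qed
    then show ?thesis unfolding l by (simp only:) (intro ord_ge_prod_cong fps_binomial_cong_exp_trunc)
  qed
  have "exp_sum q d f k - (\<Sum>x\<in>?A. fps_const (chi q d k x) * lev x (Q (a * k))) =
    (\<Sum>x\<in>?A. fps_const (chi q d k x) * (fps_binomial (ring_trace (Zq CHAR('k)) (Zq (q ^ k)) (laurent_eval f x)) - lev x (Q (a * k))))"
    by (simp add: exp_sum_def right_diff_distrib sum_subtractf)
  moreover have "ord_ge \<dots> (real N)"
    by (intro ord_ge_sum ord_ge_mult_left main)
  moreover have "(\<Sum>x\<in>?A. fps_const (chi q d k x) * lev x (Q (a * k))) =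
      lfun (\<lambda>v. fps_const (\<Sum>x\<in>?A. chi q d k x * lmonom x v)) (Q (a * k))"
  proof -
    have "(\<Sum>x\<in>?A. fps_const (chi q d k x) * lev x (Q (a * k))) =
        lfun (\<lambda>v. \<Sum>x\<in>?A. fps_const (chi q d k x) * fps_const (lmonom x v)) (Q (a * k))"
      by (simp only: lfun_cmult_left lfun_sum_left)
    also have "(\<lambda>v. \<Sum>x\<in>?A. fps_const (chi q d k x) * fps_const (lmonom x v)) =
        (\<lambda>v. fps_const (\<Sum>x\<in>?A. chi q d k x * lmonom x v))"
      by (rule ext) (simp add: sum_fps_const)
    finally show ?thesis .
  qed
  moreover have "\<dots> = fps_const (of_nat (q ^ k - 1) ^ CARD('n)) *
    lfun (\<lambda>v. if \<forall>j. int (q ^ k - 1) dvd v $ j - (\<Sum>i<k. int q ^ i) * d $ j then 1 else 0) (Q (a * k))"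
    unfolding character_orthogonality[OF m0 q[unfolded p]] lfun_cmult_left[symmetric]
    by (intro lfun_cong) auto
  ultimately show ?thesis by simp
qed

section \<open>The generating function as a characteristic power series\<close>

text \<open>Comparison of coefficients in $H' = H G'$.\<close>

lemma fps_exp_compose_recursion:
  fixes G :: "'r::field_char_0 fps fps"
  assumes G0: "fps_nth G 0 = 0"
  defines "H \<equiv> Abs_fps (\<lambda>m. fps_const (1 / fact m)) oo G"
  shows "fps_nth H 0 = 1"
    and "of_nat (Suc m) * fps_nth H (Suc m) = (\<Sum>k\<le>m. of_nat (Suc k) * fps_nth G (Suc k) * fps_nth H (m - k))"
proof -
  show "fps_nth H 0 = 1" by (simp add: H_def)
  have "fps_deriv (Abs_fps (\<lambda>m. fps_const (1 / fact m))) = Abs_fps (\<lambda>m. fps_const (1 / fact m :: 'r))"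
  proof (rule fps_ext)
    fix n
    have "of_nat (Suc n) * fps_const (1 / fact (Suc n)) = fps_const (of_nat (Suc n) * (1 / fact (Suc n)) :: 'r)"
      by (simp only: fps_of_nat[symmetric] fps_const_mult)
    also have "of_nat (Suc n) * (1 / fact (Suc n)) = (1 / fact n :: 'r)"
      using of_nat_neq_0[of n, where 'a = 'r] by (simp add: fact_Suc del: of_nat_Suc)
    finally show "fps_nth (fps_deriv (Abs_fps (\<lambda>m. fps_const (1 / fact m)))) n = fps_nth (Abs_fps (\<lambda>m. fps_const (1 / fact m :: 'r))) n"
      by simp
  qed
  then have "fps_deriv H = H * fps_deriv G"
    unfolding H_def by (subst fps_compose_deriv) (simp_all add: G0)
  then have "fps_nth (fps_deriv H) m = fps_nth (fps_deriv G * H) m" by (simp add: mult.commute)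
  then show "of_nat (Suc m) * fps_nth H (Suc m) = (\<Sum>k\<le>m. of_nat (Suc k) * fps_nth G (Suc k) * fps_nth H (m - k))"
    by (simp add: fps_mult_nth atMost_atLeast0)
qed

lemma C_series_recursion:
  fixes f :: "int ^ 'n \<Rightarrow>\<^sub>0 'k::field_prime_char witt fract"
  shows "fps_nth (C_series q d f) 0 = 1"
    and "of_nat (Suc m) * fps_nth (C_series q d f) (Suc m) =
      - (\<Sum>k\<le>m. fps_const (1 / of_nat (q ^ Suc k - 1) ^ CARD('n)) * exp_sum q d f (Suc k) * fps_nth (C_series q d f) (m - k))"
proof -
  define G where "G = Abs_fps (\<lambda>k. if k = 0 then 0 else
       fps_const (- 1 / of_nat (q ^ k - 1) ^ CARD('n)) * exp_sum q d f k * fps_const (1 / of_nat k))"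
  have C: "C_series q d f = Abs_fps (\<lambda>m. fps_const (1 / fact m)) oo G"
    by (simp add: C_series_def G_def)
  have G0: "fps_nth G 0 = 0" by (simp add: G_def)
  show "fps_nth (C_series q d f) 0 = 1" unfolding C by (rule fps_exp_compose_recursion[OF G0])
  have "of_nat (Suc k) * fps_nth G (Suc k) = - (fps_const (1 / of_nat (q ^ Suc k - 1) ^ CARD('n)) * exp_sum q d f (Suc k))" for k
  proof -
    have 1: "of_nat (Suc k) * fps_const (1 / of_nat (Suc k) :: 'k witt fract) = 1"
      unfolding fps_of_nat[symmetric] fps_const_mult
      using of_nat_neq_0[of k, where 'a = "'k witt fract"] by (simp del: of_nat_Suc)
    have "of_nat (Suc k) * fps_nth G (Suc k) =
        (of_nat (Suc k) * fps_const (1 / of_nat (Suc k))) * (fps_const (- 1 / of_nat (q ^ Suc k - 1) ^ CARD('n)) * exp_sum q d f (Suc k))"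
      by (simp add: G_def del: of_nat_Suc power_Suc fps_const_mult) 
    also have "fps_const (- 1 / of_nat (q ^ Suc k - 1) ^ CARD('n)) = - fps_const (1 / of_nat (q ^ Suc k - 1) ^ CARD('n) :: 'k witt fract)"
      by (simp del: power_Suc)
    finally show ?thesis unfolding 1 by (simp only: mult_1 mult_minus_left)
  qed
  then show "of_nat (Suc m) * fps_nth (C_series q d f) (Suc m) =
      - (\<Sum>k\<le>m. fps_const (1 / of_nat (q ^ Suc k - 1) ^ CARD('n)) * exp_sum q d f (Suc k) * fps_nth (C_series q d f) (m - k))"
    unfolding C fps_exp_compose_recursion(2)[OF G0] by (simp only: mult_minus_left sum_negf)
qed


lemma ord_ge_of_nat_mult:
  fixes F :: "'r::field_char_0 fps"
  assumes "ord_ge (of_nat n * F) c" "n > 0"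
  shows "ord_ge F c"
  using assms by (simp add: ord_ge_def flip: fps_of_nat)

lemma sum_multiples:
  fixes h :: "nat \<Rightarrow> 'b::comm_monoid_add"
  assumes a0: "a > 0" and h: "\<And>k. \<not> a dvd Suc k \<Longrightarrow> h k = 0" and m: "Suc n = a * Suc m"
  shows "(\<Sum>k\<le>n. h k) = (\<Sum>j\<le>m. h (a * Suc j - 1))"
proof -
  have inj: "inj_on (\<lambda>j. a * Suc j - 1) {..m}"
  proof (rule inj_onI)
    fix i j assume "a * Suc i - 1 = a * Suc j - 1"
    moreover have "a * Suc i > 0" "a * Suc j > 0" using a0 by simp_all
    ultimately have "a * Suc i = a * Suc j" by linarith
    then show "i = j" using a0 by simp
  qed
  have "(\<Sum>j\<le>m. h (a * Suc j - 1)) = (\<Sum>k\<in>(\<lambda>j. a * Suc j - 1) ` {..m}. h k)"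
    by (simp only: sum.reindex[OF inj] o_def)
  also have "\<dots> = (\<Sum>k\<le>n. h k)"
  proof (rule sum.mono_neutral_left)
    show "(\<lambda>j. a * Suc j - 1) ` {..m} \<subseteq> {..n}"
    proof (rule image_subsetI)
      fix j assume "j \<in> {..m}"
      then have "a * Suc j \<le> Suc n" unfolding m by (intro mult_le_mono) auto
      then show "a * Suc j - 1 \<in> {..n}" by simp
    qed
    show "\<forall>k\<in>{..n} - (\<lambda>j. a * Suc j - 1) ` {..m}. h k = 0"
    proof (intro ballI h notI)
      fix k assume k: "k \<in> {..n} - (\<lambda>j. a * Suc j - 1) ` {..m}" and "a dvd Suc k"
      then obtain c where c: "Suc k = a * c" by (elim dvdE)
      then obtain j where j: "c = Suc j" by (cases c) auto
      have "a * Suc j \<le> a * Suc m" using k unfolding j[symmetric] c[symmetric] m[symmetric] by auto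
      then have "j \<le> m" using a0 by simp
      moreover have "k = a * Suc j - 1" using c j by simp
      ultimately show False using k by blast
    qed
  qed simp
  finally show ?thesis ..
qed

text \<open>By Newton's identities the coefficients of \<open>C_series\<close> and those of $\det(1 - sB)$ at multiples of \<open>a\<close>
  obey congruent recursions, since only powers of \<open>B\<close> with exponent divisible by \<open>a\<close> have nonzero
  trace. A product of entries along a permutation of \<open>S\<close> has order at least
  $\sum_S (p\,g(\pi x) - g(x))/(q-1) = \frac{p-1}{q-1} \sum_S g$.\<close>

theorem (in lattice_degree) ord_C_series:
  fixes f :: "int ^ 'n \<Rightarrow>\<^sub>0 'k::{alg_closed_field, field_prime_char} witt fract" and d :: "int ^ 'n" and p q a m :: nat
  assumes p: "p = CHAR('k)" and a0: "a > 0" and q: "q = p ^ a"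
    and f: "\<And>u. u \<in> Poly_Mapping.keys f \<Longrightarrow> Poly_Mapping.lookup f u \<in> mu q"
    and fM: "\<And>u. u \<in> Poly_Mapping.keys f \<Longrightarrow> u \<in> M \<and> g u \<le> 1"
    and bound: "\<And>S. finite S \<Longrightarrow> card S = a * m \<Longrightarrow>
      S \<subseteq> {(i, u). i < a \<and> u \<in> M \<and> (\<forall>j. [u $ j = int p ^ (a - i) * d $ j] (mod int (q - 1)))} \<Longrightarrow>
      c \<le> (real p - 1) / real (q - 1) * (\<Sum>(i, u)\<in>S. g u)"
  shows "ord_ge (fps_nth (C_series q d f) m) c"
proof -
  \<comment> \<open>Working modulo this power of T loses nothing about orders up to c.\<close>
  obtain N :: nat where N: "c \<le> real N" using real_arch_simple by blast
  define F where "F = splitting_factor N f p"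
  define K where "K = real (card (Poly_Mapping.keys f)) * real N"
  have p2: "p \<ge> 2" using prime_ge_2_nat[of "CHAR('k)"] p by simp
  have f': "\<And>u. u \<in> Poly_Mapping.keys f \<Longrightarrow> Poly_Mapping.lookup f u \<in> mu (CHAR('k) ^ a)"
    using f q p by simp
  have tr_setup: "trace_setup M g F K p a"
  proof
    show "graded (F t) K" for t unfolding F_def K_def by (rule graded_splitting_factor[OF fM])
    have "Poly_Mapping.lookup f u ^ p ^ (t + a) = Poly_Mapping.lookup f u ^ p ^ t" if "u \<in> Poly_Mapping.keys f" for u t
    proof -
      have "Poly_Mapping.lookup f u ^ p ^ (t + a) = (Poly_Mapping.lookup f u ^ p ^ a) ^ p ^ t"
        by (simp add: power_add power_mult[symmetric] mult.commute)
      then show ?thesis using mu_power_eq_1(3)[OF a0 f'[OF that]] p by simp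
    qed
    then show "F (t + a) = F t" for t
      unfolding F_def splitting_factor_def by (intro prod.cong refl sum.cong) simp
  qed (use p2 a0 in \<open>auto simp: K_def\<close>)
  interpret trace_setup M g F K p a d by (rule tr_setup)
  have rq: "r = q - 1" by (simp add: r_def q)
  obtain D where D0: "D 0 = 1"
    and Drec: "\<forall>m. of_nat (Suc m) * D (Suc m) = - (\<Sum>k\<le>m. (\<Sum>x\<in>X. mpow X B (Suc k) x x) * D (m - k))"
    and DH: "\<forall>m H. H 0 \<longrightarrow> (\<forall>u v. H u \<longrightarrow> H v \<longrightarrow> H (u + v)) \<longrightarrow> (\<forall>u. H u \<longrightarrow> H (- u)) \<longrightarrow>
      (\<forall>S \<pi>. S \<subseteq> X \<longrightarrow> card S = m \<longrightarrow> bij_betw \<pi> S S \<longrightarrow> H (\<Prod>x\<in>S. B x (\<pi> x))) \<longrightarrow> H (D m)"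
    using fredholm_determinant[OF finite_X, of B] by (elim exE conjE)
  define \<tau> where "\<tau> k = lfun (\<lambda>v. if \<forall>j. int (q ^ k - 1) dvd v $ j - (\<Sum>i<k. int q ^ i) * d $ j then 1 else 0) (Q (a * k))" for k
  define \<sigma> where "\<sigma> k = fps_const (1 / of_nat (q ^ k - 1) ^ CARD('n)) * exp_sum q d f k" for k
  have \<sigma>\<tau>: "ord_ge (\<sigma> (Suc k) - \<tau> (Suc k)) (real N)" for k
  proof -
    have "q ^ Suc k > 1"
    proof -
      have "q > 1" unfolding q by (rule one_less_power) (use p2 a0 in auto)
      then show ?thesis by (intro one_less_power) auto
    qed
    then have "q ^ Suc k - 1 \<noteq> 0" by (simp only: diff_is_0_eq not_le)
    then have "of_nat (q ^ Suc k - 1) \<noteq> (0 :: 'k witt fract)" by (simp only: of_nat_eq_0_iff not_False_eq_True)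
    then have nz: "of_nat (q ^ Suc k - 1) ^ CARD('n) \<noteq> (0 :: 'k witt fract)" by (rule power_not_zero)
    have "ord_ge (exp_sum q d f (Suc k) - fps_const (of_nat (q ^ Suc k - 1) ^ CARD('n)) * \<tau> (Suc k)) (real N)"
      unfolding \<tau>_def F_def by (rule exp_sum_cong[OF tr_setup[unfolded F_def] p q _ f]) auto
    then have "ord_ge (fps_const (1 / of_nat (q ^ Suc k - 1) ^ CARD('n)) *
        (exp_sum q d f (Suc k) - fps_const (of_nat (q ^ Suc k - 1) ^ CARD('n)) * \<tau> (Suc k))) (real N)"
      by (rule ord_ge_mult_left)
    also have "fps_const (1 / of_nat (q ^ Suc k - 1) ^ CARD('n)) *
        (exp_sum q d f (Suc k) - fps_const (of_nat (q ^ Suc k - 1) ^ CARD('n)) * \<tau> (Suc k)) = \<sigma> (Suc k) - \<tau> (Suc k)"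
      unfolding right_diff_distrib mult.assoc[symmetric] fps_const_mult \<sigma>_def using nz by simp
    finally show ?thesis .
  qed
  have tr: "(\<Sum>x\<in>X. mpow X B (a * k) x x) = of_nat a * \<tau> k" if "k > 0" for k
  proof -
    have "p ^ (a * k) = q ^ k" by (simp add: q power_mult)
    then show ?thesis
      using trace_B_eq[of "a * k"] trace_level_0[OF that] that a0 unfolding \<tau>_def q by (simp add: power_mult)
  qed
  have Drec': "of_nat (Suc l) * D (a * Suc l) = - (\<Sum>k\<le>l. \<tau> (Suc k) * D (a * (l - k)))" for l
  proof -
    obtain n where n: "Suc n = a * Suc l" using a0 by (metis Suc_pred' mult_pos_pos zero_less_Suc)
    have "of_nat a * (of_nat (Suc l) * D (a * Suc l)) = of_nat (Suc n) * D (Suc n)"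
      unfolding n by (simp only: of_nat_mult mult.assoc)
    also have "\<dots> = - (\<Sum>k\<le>n. (\<Sum>x\<in>X. mpow X B (Suc k) x x) * D (n - k))" by (rule Drec[rule_format])
    also have "(\<Sum>k\<le>n. (\<Sum>x\<in>X. mpow X B (Suc k) x x) * D (n - k)) =
        (\<Sum>j\<le>l. (\<Sum>x\<in>X. mpow X B (Suc (a * Suc j - 1)) x x) * D (n - (a * Suc j - 1)))"
      by (rule sum_multiples[OF a0 _ n]) (subst trace_B_eq_0, assumption, rule mult_zero_left)
    also have "\<dots> = (\<Sum>j\<le>l. of_nat a * (\<tau> (Suc j) * D (a * (l - j))))"
    proof (intro sum.cong refl)
      fix j assume j: "j \<in> {..l}"
      have 1: "Suc (a * Suc j - 1) = a * Suc j" using a0 by simp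
      have "a * Suc l = a * Suc j + a * (l - j)" using j by (simp flip: distrib_left)
      then have 2: "n - (a * Suc j - 1) = a * (l - j)" using n 1 by linarith
      show "(\<Sum>x\<in>X. mpow X B (Suc (a * Suc j - 1)) x x) * D (n - (a * Suc j - 1)) = of_nat a * (\<tau> (Suc j) * D (a * (l - j)))"
        unfolding 1 2 by (subst tr) (simp_all only: zero_less_Suc mult.assoc)
    qed
    also have "- \<dots> = of_nat a * - (\<Sum>k\<le>l. \<tau> (Suc k) * D (a * (l - k)))"
      by (simp only: sum_distrib_left mult_minus_right)
    finally show ?thesis using a0 by (simp only: mult_cancel_left of_nat_eq_0_iff) simp
  qed
  have CD: "ord_ge (fps_nth (C_series q d f) l - D (a * l)) (real N)" for l
  proof (induction l rule: less_induct)
    case (less l)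
    show ?case
    proof (cases l)
      case 0
      then show ?thesis using D0 by (simp add: C_series_recursion(1))
    next
      case (Suc l')
      have "of_nat (Suc l') * (fps_nth (C_series q d f) (Suc l') - D (a * Suc l')) =
          - (\<Sum>k\<le>l'. \<sigma> (Suc k) * fps_nth (C_series q d f) (l' - k) - \<tau> (Suc k) * D (a * (l' - k)))"
        unfolding right_diff_distrib C_series_recursion(2) Drec' \<sigma>_def sum_subtractf by simp
      moreover have "ord_ge \<dots> (real N)"
        using less Suc by (intro ord_ge_uminus ord_ge_sum ord_ge_mult_cong \<sigma>\<tau>) auto
      ultimately show ?thesis unfolding Suc by (metis ord_ge_of_nat_mult zero_less_Suc)
    qed
  qed
  have "ord_ge (D (a * m)) c"
  proof (rule DH[rule_format])
    fix S \<pi> assume S: "S \<subseteq> X" "card S = a * m" and \<pi>: "bij_betw \<pi> S S"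
    have finS: "finite S" using S(1) finite_X finite_subset by blast
    define h where "h = (\<lambda>(i :: nat, u). g u)"
    have "ord_ge (B x (\<pi> x)) (real p / real r * h (\<pi> x) - 1 / real r * h x)" if "x \<in> S" for x
    proof -
      have "x \<in> X" "\<pi> x \<in> X" using that S(1) \<pi> by (auto simp: bij_betw_def)
      then show ?thesis using ord_ge_B[of "fst x" "snd x" "fst (\<pi> x)" "snd (\<pi> x)"]
        by (simp add: h_def case_prod_beta)
    qed
    then have "ord_ge (\<Prod>x\<in>S. B x (\<pi> x)) (\<Sum>x\<in>S. real p / real r * h (\<pi> x) - 1 / real r * h x)"
      by (rule ord_ge_prod)
    also have "(\<Sum>x\<in>S. real p / real r * h (\<pi> x) - 1 / real r * h x) =
        real p / real r * (\<Sum>x\<in>S. h (\<pi> x)) - 1 / real r * (\<Sum>x\<in>S. h x)"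
      by (simp only: sum_subtractf sum_distrib_left)
    also have "(\<Sum>x\<in>S. h (\<pi> x)) = (\<Sum>x\<in>S. h x)" by (rule sum.reindex_bij_betw[OF \<pi>])
    also have "real p / real r * (\<Sum>x\<in>S. h x) - 1 / real r * (\<Sum>x\<in>S. h x) =
        (real p - 1) / real (q - 1) * (\<Sum>(i, u)\<in>S. g u)"
      unfolding h_def rq by (simp add: diff_divide_distrib left_diff_distrib)
    finally show "ord_ge (\<Prod>x\<in>S. B x (\<pi> x)) c"
    proof (rule ord_ge_mono)
      show "c \<le> (real p - 1) / real (q - 1) * (\<Sum>(i, u)\<in>S. g u)"
        using S by (intro bound finS) (auto simp: X_def rq)
    qed
  qed (auto intro: ord_ge_add ord_ge_uminus)
  then have "ord_ge (fps_nth (C_series q d f) m - D (a * m) + D (a * m)) c"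
    using CD[of m] N by (intro ord_ge_add) (auto intro: ord_ge_mono)
  then show ?thesis by simp
qed


section \<open>The degree function is the gauge of the polytope\<close>

definition cone_gauge :: "'a::euclidean_space set \<Rightarrow> 'a \<Rightarrow> real" where
  "cone_gauge P x = Inf {c. 0 \<le> c \<and> (\<exists>y\<in>P. x = c *\<^sub>R y)}"

locale compact_convex_0 =
  fixes P :: "'a::euclidean_space set"
  assumes compact: "compact P" and convex: "convex P" and zero: "0 \<in> P"
begin

lemma cone_iff: "x \<in> convex_cone hull P \<longleftrightarrow> (\<exists>c\<ge>0. \<exists>y\<in>P. x = c *\<^sub>R y)"
  using convex_cone_hull_convex_hull_nonempty[of P] zero convex hull_same[of convex P] by auto

lemma gauge_le: "0 \<le> c \<Longrightarrow> y \<in> P \<Longrightarrow> cone_gauge P (c *\<^sub>R y) \<le> c"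
  unfolding cone_gauge_def by (rule cInf_lower) (auto intro: bdd_belowI[of _ 0])

text \<open>By compactness there is a largest multiple $s x$ of a nonzero \<open>x\<close> in \<open>P\<close>, and the gauge is $1/s$.\<close>

lemma gauge_attained:
  assumes "x \<in> convex_cone hull P"
  shows "\<exists>y\<in>P. cone_gauge P x *\<^sub>R y = x" and "0 \<le> cone_gauge P x"
proof -
  have "(\<exists>y\<in>P. cone_gauge P x *\<^sub>R y = x) \<and> 0 \<le> cone_gauge P x"
  proof (cases "x = 0")
    case True
    have "cone_gauge P 0 = 0"
      unfolding cone_gauge_def by (rule cInf_eq_minimum) (use zero in auto)
    then show ?thesis using True zero by auto
  next
    case False
    define T where "T = {s. 0 \<le> s \<and> s *\<^sub>R x \<in> P}"
    obtain c y where c: "c \<ge> 0" "y \<in> P" "x = c *\<^sub>R y" using assms cone_iff by blast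
    have c0: "c > 0" using c False by (cases "c = 0") auto
    have "1 / c \<in> T" using c c0 by (simp add: T_def)
    obtain R where R: "\<And>z. z \<in> P \<Longrightarrow> norm z \<le> R"
      using compact_imp_bounded[OF compact] unfolding bounded_iff by blast
    have "bounded T"
    proof (rule boundedI)
      fix s assume s: "s \<in> T"
      then have "s * norm x \<le> R" using R[of "s *\<^sub>R x"] by (simp add: T_def)
      then show "norm s \<le> R / norm x" using s False by (simp add: T_def field_simps)
    qed
    moreover have "closed T"
    proof -
      have "T = {0..} \<inter> (\<lambda>s. s *\<^sub>R x) -` P" by (auto simp: T_def)
      moreover have "closed ((\<lambda>s :: real. s *\<^sub>R x) -` P)"
        by (intro closed_vimage compact_imp_closed compact continuous_intros)
      ultimately show ?thesis by (simp add: closed_Int)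
    qed
    ultimately have "compact T" by (simp add: compact_eq_bounded_closed)
    then obtain s where s: "s \<in> T" "\<And>t. t \<in> T \<Longrightarrow> t \<le> s"
      using compact_attains_sup[of T] \<open>1 / c \<in> T\<close> by blast
    have "0 < 1 / c" using c0 by simp
    then have s0: "s > 0" using s(2)[OF \<open>1 / c \<in> T\<close>] by linarith
    have g: "cone_gauge P x = 1 / s"
      unfolding cone_gauge_def
    proof (rule cInf_eq_minimum)
      show "1 / s \<in> {c. 0 \<le> c \<and> (\<exists>y\<in>P. x = c *\<^sub>R y)}"
        using s(1) s0 by (auto simp: T_def intro!: bexI[of _ "s *\<^sub>R x"])
      fix b assume "b \<in> {c. 0 \<le> c \<and> (\<exists>y\<in>P. x = c *\<^sub>R y)}"
      then obtain z where b: "0 \<le> b" "z \<in> P" "x = b *\<^sub>R z" by blast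
      then have "b > 0" using False by (cases "b = 0") auto
      then have "1 / b \<in> T" using b by (simp add: T_def)
      then have "1 / b \<le> s" by (rule s(2))
      then show "1 / s \<le> b" using s0 \<open>b > 0\<close> by (simp add: field_simps)
    qed
    show ?thesis using s(1) s0 unfolding g T_def by (auto intro!: bexI[of _ "s *\<^sub>R x"])
  qed
  then show "\<exists>y\<in>P. cone_gauge P x *\<^sub>R y = x" and "0 \<le> cone_gauge P x" by blast+
qed

lemma gauge_nonneg: "x \<in> convex_cone hull P \<Longrightarrow> 0 \<le> cone_gauge P x"
  by (rule gauge_attained(2))

lemma gauge_0: "cone_gauge P 0 = 0"
  unfolding cone_gauge_def by (rule cInf_eq_minimum) (use zero in auto)

lemma gauge_scale:
  assumes x: "x \<in> convex_cone hull P" and c: "0 \<le> c"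
  shows "cone_gauge P (c *\<^sub>R x) = c * cone_gauge P x"
proof -
  have le: "cone_gauge P (c *\<^sub>R x) \<le> c * cone_gauge P x" if h: "x \<in> convex_cone hull P" "0 \<le> c" for c x
  proof -
    obtain y where y: "y \<in> P" "cone_gauge P x *\<^sub>R y = x" using gauge_attained(1)[OF h(1)] by blast
    have "c *\<^sub>R x = (c * cone_gauge P x) *\<^sub>R y" by (simp add: y(2) flip: scaleR_scaleR)
    then show ?thesis using gauge_le[of "c * cone_gauge P x" y] h gauge_nonneg y(1) by simp
  qed
  show ?thesis
  proof (cases "c = 0")
    case False
    then have "c > 0" using c by simp
    have "cone_gauge P ((1 / c) *\<^sub>R (c *\<^sub>R x)) \<le> (1 / c) * cone_gauge P (c *\<^sub>R x)"
      using \<open>c > 0\<close> x by (intro le convex_cone_hull_mul) auto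
    then have "c * cone_gauge P x \<le> cone_gauge P (c *\<^sub>R x)" using \<open>c > 0\<close> by (simp add: field_simps)
    then show ?thesis using le[OF x c] by simp
  qed (simp add: gauge_0)
qed

lemma gauge_add:
  assumes x: "x \<in> convex_cone hull P" and z: "z \<in> convex_cone hull P"
  shows "cone_gauge P (x + z) \<le> cone_gauge P x + cone_gauge P z"
proof -
  obtain y where y: "y \<in> P" "cone_gauge P x *\<^sub>R y = x" using gauge_attained(1)[OF x] by blast
  obtain w where w: "w \<in> P" "cone_gauge P z *\<^sub>R w = z" using gauge_attained(1)[OF z] by blast
  let ?a = "cone_gauge P x" and ?b = "cone_gauge P z"
  have nn: "?a \<ge> 0" "?b \<ge> 0" using gauge_nonneg x z by auto
  show ?thesis
  proof (cases "?a + ?b = 0")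
    case True
    then have "?a = 0" "?b = 0" using nn by linarith+
    have "x = 0" using y(2) unfolding \<open>?a = 0\<close> by simp
    moreover have "z = 0" using w(2) unfolding \<open>?b = 0\<close> by simp
    ultimately show ?thesis by (simp add: gauge_0)
  next
    case False
    define s where "s = ?a + ?b"
    have s0: "s > 0" using False nn by (simp add: s_def)
    have "(?a / s) *\<^sub>R y + (?b / s) *\<^sub>R w \<in> P"
      using nn s0 y(1) w(1) by (intro convexD[OF convex]) (auto simp: s_def simp flip: add_divide_distrib)
    then have "cone_gauge P (s *\<^sub>R ((?a / s) *\<^sub>R y + (?b / s) *\<^sub>R w)) \<le> s" using s0 by (intro gauge_le) auto
    moreover have "s *\<^sub>R ((?a / s) *\<^sub>R y + (?b / s) *\<^sub>R w) = ?a *\<^sub>R y + ?b *\<^sub>R w"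
      using s0 by (simp add: scaleR_add_right)
    ultimately show ?thesis using y(2) w(2) by (simp add: s_def)
  qed
qed

lemma norm_le_gauge: "\<exists>R>0. \<forall>x\<in>convex_cone hull P. norm x \<le> R * cone_gauge P x"
proof -
  obtain R where R: "R > 0" "\<And>z. z \<in> P \<Longrightarrow> norm z \<le> R"
    using compact_imp_bounded[OF compact] unfolding bounded_pos by blast
  have "norm x \<le> R * cone_gauge P x" if x: "x \<in> convex_cone hull P" for x
  proof -
    obtain y where y: "y \<in> P" "cone_gauge P x *\<^sub>R y = x" using gauge_attained(1)[OF x] by blast
    have "norm x = cone_gauge P x * norm y" using gauge_nonneg[OF x] norm_scaleR[of "cone_gauge P x" y] unfolding y(2) by simp
    also have "\<dots> \<le> cone_gauge P x * R" using R(2)[OF y(1)] gauge_nonneg[OF x] by (intro mult_left_mono)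
    finally show ?thesis by (simp add: mult.commute)
  qed
  then show ?thesis using R(1) by blast
qed

lemma in_cone: "x \<in> P \<Longrightarrow> x \<in> convex_cone hull P"
  by (rule hull_inc)

text \<open>A nonzero point of \<open>P\<close> of gauge less than 1 lies strictly between 0 and another point of \<open>P\<close>, so a face
  containing it contains 0.\<close>

lemma gauge_face:
  assumes F: "F face_of P" "0 \<notin> F" and x: "x \<in> F"
  shows "cone_gauge P x = 1"
proof (rule ccontr)
  assume ne: "cone_gauge P x \<noteq> 1"
  have xP: "x \<in> P" using F x face_of_imp_subset by blast
  have lt: "cone_gauge P x < 1" using gauge_le[of 1 x] xP ne by simp
  obtain y where y: "y \<in> P" "cone_gauge P x *\<^sub>R y = x" using gauge_attained(1)[OF in_cone[OF xP]] by blast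
  have x0: "x \<noteq> 0" using F(2) x by blast
  then have "y \<noteq> 0" "cone_gauge P x \<noteq> 0" using y(2) by (metis scaleR_zero_right, metis scaleR_zero_left)
  then have "cone_gauge P x > 0" using gauge_nonneg[OF in_cone[OF xP]] by simp
  then have "x \<in> open_segment 0 y"
    using lt \<open>y \<noteq> 0\<close> unfolding in_segment by (intro conjI exI[of _ "cone_gauge P x"]) (simp_all add: y(2))
  then have "0 \<in> F" using F(1) zero y(1) x unfolding face_of_def by blast
  then show False using F(2) by simp
qed

text \<open>The smallest face containing a point \<open>y\<close> consists of the points \<open>z\<close> for which the segment
  from \<open>z\<close> to \<open>y\<close> can be prolonged beyond \<open>y\<close> inside the convex set.\<close>

lemma face_avoiding_0:
  assumes y: "y \<in> P" "cone_gauge P y = 1"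
  obtains F where "F face_of P" "0 \<notin> F" "y \<in> F"
proof -
  define F where "F = {z \<in> P. \<exists>e>0. y + e *\<^sub>R (y - z) \<in> P}"
  have shrink: "y + e' *\<^sub>R (y - z) \<in> P" if "y + e *\<^sub>R (y - z) \<in> P" "0 < e'" "e' \<le> e" for e e' z
  proof -
    have "(1 - e' / e) *\<^sub>R y + (e' / e) *\<^sub>R (y + e *\<^sub>R (y - z)) \<in> P"
      using that y(1) by (intro convexD[OF convex]) auto
    moreover have "(1 - e' / e) *\<^sub>R y + (e' / e) *\<^sub>R (y + e *\<^sub>R (y - z)) = y + e' *\<^sub>R (y - z)"
      using that by (simp add: algebra_simps)
    ultimately show ?thesis by simp
  qed
  have "F face_of P"
    unfolding face_of_def
  proof (intro conjI ballI impI)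
    show "F \<subseteq> P" by (auto simp: F_def)
    show "convex F"
    proof (rule convexI)
      fix z w :: 'a and s t :: real assume z: "z \<in> F" and w: "w \<in> F" and st: "0 \<le> s" "0 \<le> t" "s + t = 1"
      obtain e1 where e1: "e1 > 0" "y + e1 *\<^sub>R (y - z) \<in> P" using z by (auto simp: F_def)
      obtain e2 where e2: "e2 > 0" "y + e2 *\<^sub>R (y - w) \<in> P" using w by (auto simp: F_def)
      define e where "e = min e1 e2"
      have e: "e > 0" "y + e *\<^sub>R (y - z) \<in> P" "y + e *\<^sub>R (y - w) \<in> P"
        using shrink[OF e1(2), of e] shrink[OF e2(2), of e] e1(1) e2(1) by (auto simp: e_def)
      have "s *\<^sub>R (y + e *\<^sub>R (y - z)) + t *\<^sub>R (y + e *\<^sub>R (y - w)) \<in> P"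
        using e st by (intro convexD[OF convex]) auto
      moreover have "s *\<^sub>R (y + e *\<^sub>R (y - z)) + t *\<^sub>R (y + e *\<^sub>R (y - w)) = (s + t) *\<^sub>R (y + e *\<^sub>R y) - e *\<^sub>R (s *\<^sub>R z + t *\<^sub>R w)"
        by (simp add: algebra_simps)
      moreover have "\<dots> = y + e *\<^sub>R (y - (s *\<^sub>R z + t *\<^sub>R w))"
        unfolding st(3) by (simp add: algebra_simps)
      moreover have "s *\<^sub>R z + t *\<^sub>R w \<in> P" using z w st by (intro convexD[OF convex]) (auto simp: F_def)
      ultimately show "s *\<^sub>R z + t *\<^sub>R w \<in> F" using e(1) by (auto simp: F_def)
    qed
    have end_in: "u \<in> F" if u: "u \<in> P" and v: "v \<in> P" and z: "(1 - t) *\<^sub>R u + t *\<^sub>R v \<in> F" and t: "0 \<le> t" "t < 1" for u v t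
    proof -
      obtain e where e: "e > 0" "y + e *\<^sub>R (y - ((1 - t) *\<^sub>R u + t *\<^sub>R v)) \<in> P" using z by (auto simp: F_def)
      define k where "k = 1 + e * t"
      have k: "k > 0" using e(1) t by (simp add: k_def add_pos_nonneg)
      have "(1 / k) *\<^sub>R (y + e *\<^sub>R (y - ((1 - t) *\<^sub>R u + t *\<^sub>R v))) + (e * t / k) *\<^sub>R v \<in> P"
        using e t v k by (intro convexD[OF convex]) (auto simp: k_def simp flip: add_divide_distrib)
      moreover have "(1 / k) *\<^sub>R (y + e *\<^sub>R (y - ((1 - t) *\<^sub>R u + t *\<^sub>R v))) + (e * t / k) *\<^sub>R v =
          (1 / k) *\<^sub>R ((1 + e) *\<^sub>R y - (e * (1 - t)) *\<^sub>R u)"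
        by (simp add: algebra_simps)
      moreover have "\<dots> = (1 / k) *\<^sub>R (k *\<^sub>R y + (e * (1 - t)) *\<^sub>R (y - u))"
        by (simp add: k_def algebra_simps)
      moreover have "\<dots> = y + (e * (1 - t) / k) *\<^sub>R (y - u)" using k by (simp add: scaleR_add_right)
      ultimately have "y + (e * (1 - t) / k) *\<^sub>R (y - u) \<in> P" by simp
      moreover have "e * (1 - t) / k > 0" using e(1) t k by simp
      ultimately show "u \<in> F" using u by (auto simp: F_def)
    qed
    fix u v z assume u: "u \<in> P" and v: "v \<in> P" and z: "z \<in> F" and "z \<in> open_segment u v"
    then obtain t where t: "0 < t" "t < 1" "z = (1 - t) *\<^sub>R u + t *\<^sub>R v" by (auto simp: in_segment)
    show "u \<in> F" using end_in[OF u v, of t] z t by simp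
    show "v \<in> F" using end_in[OF v u, of "1 - t"] z t by (simp add: add.commute)
  qed
  moreover have "0 \<notin> F"
  proof
    assume "0 \<in> F"
    then obtain e where e: "e > 0" "y + e *\<^sub>R y \<in> P" by (auto simp: F_def)
    have "y = (1 / (1 + e)) *\<^sub>R (y + e *\<^sub>R y)"
      using e(1) by (simp flip: scaleR_left_distrib[of 1 e y, simplified])
    then have "cone_gauge P y \<le> 1 / (1 + e)" using gauge_le[of "1 / (1 + e)" "y + e *\<^sub>R y"] e by simp
    then show False using y(2) e(1) by (simp add: field_simps)
  qed
  moreover have "y \<in> F" using y(1) by (auto simp: F_def intro!: exI[of _ 1])
  ultimately show ?thesis by (rule that)
qed

end

lemma is_degree_function_gauge:
  assumes "compact_convex_0 D"
  shows "is_degree_function D (cone_gauge D)"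
proof -
  interpret compact_convex_0 D by (rule assms)
  show ?thesis
    unfolding is_degree_function_def
  proof (intro conjI ballI allI impI)
    show "cone_gauge D (c *\<^sub>R x) = c * cone_gauge D x" if "x \<in> convex_cone hull D" "0 \<le> c" for x c
      by (rule gauge_scale[OF that])
    fix \<delta> assume \<delta>: "\<delta> face_of D \<and> 0 \<notin> \<delta>"
    show one: "cone_gauge D x = 1" if "x \<in> \<delta>" for x using gauge_face \<delta> that by blast
    have conv: "convex \<delta>" and sub: "\<delta> \<subseteq> D" using \<delta> face_of_imp_convex face_of_imp_subset by blast+
    have rep: "x = 0 \<or> (\<exists>c>0. \<exists>z\<in>\<delta>. x = c *\<^sub>R z)" if x: "x \<in> convex_cone hull \<delta>" for x
    proof -
      have "x \<in> insert 0 (\<Union>x \<in> \<delta>. \<Union>c\<in>{0..}. {c *\<^sub>R x})"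
        using x unfolding convex_cone_hull_convex_hull hull_same[of convex, OF conv] .
      then obtain c z where "x = 0 \<or> (c \<ge> 0 \<and> z \<in> \<delta> \<and> x = c *\<^sub>R z)" by auto
      then show ?thesis by (cases "c = 0") (auto simp: less_le)
    qed
    fix x y assume x: "x \<in> convex_cone hull \<delta>" and y: "y \<in> convex_cone hull \<delta>"
    have g: "cone_gauge D (c *\<^sub>R z) = c" if "c \<ge> 0" "z \<in> \<delta>" for c z
      using gauge_scale[of z c] one[OF that(2)] that sub in_cone by auto
    show "cone_gauge D (x + y) = cone_gauge D x + cone_gauge D y"
    proof (cases "x = 0 \<or> y = 0")
      case True
      then show ?thesis by (auto simp: gauge_0)
    next
      case False
      then obtain c z c' z' where r: "c > 0" "z \<in> \<delta>" "x = c *\<^sub>R z" "c' > 0" "z' \<in> \<delta>" "y = c' *\<^sub>R z'"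
        using rep[OF x] rep[OF y] by blast
      define w where "w = (c / (c + c')) *\<^sub>R z + (c' / (c + c')) *\<^sub>R z'"
      have "w \<in> \<delta>" unfolding w_def using r by (intro convexD[OF conv]) (auto simp flip: add_divide_distrib)
      moreover have "x + y = (c + c') *\<^sub>R w" using r by (simp add: w_def scaleR_add_right)
      ultimately show ?thesis using g r by simp
    qed
  qed
qed

text \<open>A nonzero point of the cone is its gauge times a point of gauge 1, and the latter lies on a face that
  avoids 0.\<close>

lemma degree_function_unique:
  assumes D: "compact_convex_0 D" and g: "is_degree_function D g" and x: "x \<in> convex_cone hull D"
  shows "g x = cone_gauge D x"
proof -
  interpret compact_convex_0 D by (rule D)
  have hom: "g (c *\<^sub>R x) = c * g x" if "x \<in> convex_cone hull D" "c \<ge> 0" for c x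
    using g that by (simp add: is_degree_function_def)
  obtain y where y: "y \<in> D" "cone_gauge D x *\<^sub>R y = x" using gauge_attained(1)[OF x] by blast
  show ?thesis
  proof (cases "cone_gauge D x = 0")
    case True
    have "x = 0" using y(2) unfolding True by simp
    then show ?thesis using hom[of 0 0] in_cone[OF zero] True by simp
  next
    case False
    have "cone_gauge D x = cone_gauge D x * cone_gauge D y"
      using gauge_scale[OF in_cone[OF y(1)] gauge_nonneg[OF x]] y(2) by simp
    then have "cone_gauge D y = 1" using False by simp
    then obtain F where "F face_of D" "0 \<notin> F" "y \<in> F" using face_avoiding_0[OF y(1)] by blast
    then have "g y = 1" using g by (auto simp: is_degree_function_def)
    then have "g (cone_gauge D x *\<^sub>R y) = cone_gauge D x" using hom[OF in_cone[OF y(1)] gauge_nonneg[OF x]] by simp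
    then show ?thesis using y(2) by simp
  qed
qed

lemma deg_fun_eq_gauge:
  assumes "compact_convex_0 D" "x \<in> convex_cone hull D"
  shows "deg_fun D x = cone_gauge D x"
  unfolding deg_fun_def
  by (rule degree_function_unique[OF assms(1) _ assms(2)])
    (rule someI[of "is_degree_function D", OF is_degree_function_gauge[OF assms(1)]])

section \<open>Lattice points of the cone\<close>

lemma real_vec_add: "real_vec (u + v) = real_vec u + real_vec v"
  by (simp add: real_vec_def Finite_Cartesian_Product.vec_eq_iff)

lemma real_vec_0: "real_vec 0 = 0"
  by (simp add: real_vec_def Finite_Cartesian_Product.vec_eq_iff)

lemma real_vec_scale: "real_vec (int c *s u) = real c *\<^sub>R real_vec u"
  by (simp add: real_vec_def Finite_Cartesian_Product.vec_eq_iff)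

lemma real_vec_inj: "real_vec u = real_vec v \<longleftrightarrow> u = v"
  by (simp add: real_vec_def Finite_Cartesian_Product.vec_eq_iff)

lemma finite_real_vec_bounded: "finite {u :: int ^ 'n. norm (real_vec u) \<le> C}"
proof -
  have "{u :: int ^ 'n. norm (real_vec u) \<le> C} \<subseteq> {u. \<forall>i. u $ i \<in> {- \<lceil>C\<rceil>..\<lceil>C\<rceil>}}"
  proof safe
    fix u :: "int ^ 'n" and i assume u: "norm (real_vec u) \<le> C"
    have "\<bar>real_of_int (u $ i)\<bar> \<le> norm (real_vec u)"
      using component_le_norm_cart[of "real_vec u" i] by (simp add: real_vec_def)
    then have "\<bar>real_of_int (u $ i)\<bar> \<le> C" using u by linarith
    then have "\<bar>u $ i\<bar> \<le> \<lceil>C\<rceil>" by linarith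
    then show "u $ i \<in> {- \<lceil>C\<rceil>..\<lceil>C\<rceil>}" by auto
  qed
  moreover have "finite {u :: int ^ 'n. \<forall>i. u $ i \<in> {- \<lceil>C\<rceil>..\<lceil>C\<rceil>}}" by (rule finite_vec) simp
  ultimately show ?thesis using finite_subset by blast
qed

lemma compact_convex_0_newton_polytope: "compact_convex_0 (newton_polytope f)"
proof
  show "compact (newton_polytope f)" unfolding newton_polytope_def
    by (intro compact_convex_hull finite_imp_compact) simp
  show "convex (newton_polytope f)" by (simp add: newton_polytope_def)
  show "0 \<in> newton_polytope f" unfolding newton_polytope_def by (rule hull_inc) simp
qed

lemma lattice_degree_polytope:
  assumes "compact_convex_0 D"
  shows "lattice_degree (M_set D) (\<lambda>u. cone_gauge D (real_vec u))"
proof -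
  interpret compact_convex_0 D by (rule assms)
  show ?thesis
  proof
    show "0 \<in> M_set D"
      using in_cone[OF zero] by (simp add: M_set_def real_vec_0)
    show "u + v \<in> M_set D" if "u \<in> M_set D" "v \<in> M_set D" for u v
      using that convex_cone_hull_add by (auto simp: M_set_def real_vec_add)
    show "int c *s u \<in> M_set D \<longleftrightarrow> u \<in> M_set D" if "c > 0" for c u
    proof
      assume "int c *s u \<in> M_set D"
      then have "(1 / real c) *\<^sub>R real_vec (int c *s u) \<in> convex_cone hull D"
        by (intro convex_cone_hull_mul) (auto simp: M_set_def)
      then show "u \<in> M_set D" using that by (simp add: M_set_def real_vec_scale)
    next
      assume "u \<in> M_set D"
      then show "int c *s u \<in> M_set D" by (simp add: M_set_def real_vec_scale convex_cone_hull_mul)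
    qed
    show "cone_gauge D (real_vec (int c *s u)) = real c * cone_gauge D (real_vec u)" if "u \<in> M_set D" for c u
      using that by (simp add: real_vec_scale M_set_def gauge_scale)
    show "cone_gauge D (real_vec (u + v)) \<le> cone_gauge D (real_vec u) + cone_gauge D (real_vec v)" if "u \<in> M_set D" "v \<in> M_set D" for u v
      using that by (simp add: real_vec_add M_set_def gauge_add)
    show "0 \<le> cone_gauge D (real_vec u)" if "u \<in> M_set D" for u
      using that by (simp add: M_set_def gauge_nonneg)
    obtain R where R: "R > 0" "\<And>x. x \<in> convex_cone hull D \<Longrightarrow> norm x \<le> R * cone_gauge D x"
      using norm_le_gauge by blast
    show "finite {u \<in> M_set D. cone_gauge D (real_vec u) \<le> C}" for C
    proof (rule finite_subset)
      show "{u \<in> M_set D. cone_gauge D (real_vec u) \<le> C} \<subseteq> {u. norm (real_vec u) \<le> R * C}"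
      proof safe
        fix u assume "u \<in> M_set D" "cone_gauge D (real_vec u) \<le> C"
        then have "norm (real_vec u) \<le> R * cone_gauge D (real_vec u)"
          and "R * cone_gauge D (real_vec u) \<le> R * C"
          using R(2)[of "real_vec u"] R(1) by (auto simp: M_set_def)
        then show "norm (real_vec u) \<le> R * C" by linarith
      qed
    qed (rule finite_real_vec_bounded)
  qed
qed


section \<open>Enumerating points by degree\<close>

text \<open>Repeatedly choosing a remaining point of least degree exhausts the set: a point never chosen would
  bound the degrees of infinitely many chosen ones.\<close>

lemma enumeration_by_degree:
  fixes w :: "'x \<Rightarrow> real"
  assumes inf: "infinite U" and fin: "\<And>c. finite {y \<in> U. w y \<le> c}"
  shows "\<exists>x. bij_betw x (UNIV :: nat set) U \<and> incseq (\<lambda>i. w (x i))"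
proof -
  define pick where "pick A = (SOME y. y \<in> U - A \<and> (\<forall>z\<in>U - A. w y \<le> w z))" for A
  have pick: "pick A \<in> U - A \<and> (\<forall>z\<in>U - A. w (pick A) \<le> w z)" if A: "finite A" for A
  proof -
    have "U - A \<noteq> {}" using inf A by (metis Diff_eq_empty_iff finite_subset)
    then obtain z where z: "z \<in> U - A" by blast
    let ?B = "{y \<in> U - A. w y \<le> w z}"
    have B: "finite ?B" "?B \<noteq> {}" using fin[of "w z"] z by (auto intro: rev_finite_subset)
    obtain y where y: "y \<in> ?B" "\<And>z'. z' \<in> ?B \<Longrightarrow> w y \<le> w z'"
      using ex_min_if_finite[of "w ` ?B"] B by (metis (no_types, lifting) arg_min_if_finite(1) arg_min_least)
    have "w y \<le> w z'" if "z' \<in> U - A" for z'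
      using y that by (cases "w z' \<le> w z") auto
    then have "y \<in> U - A \<and> (\<forall>z\<in>U - A. w y \<le> w z)" using y(1) by blast
    then show ?thesis unfolding pick_def by (rule someI)
  qed
  define S where "S = rec_nat {} (\<lambda>_ A. insert (pick A) A)"
  have S0: "S 0 = {}" and SS: "S (Suc n) = insert (pick (S n)) (S n)" for n by (simp_all add: S_def)
  have finS: "finite (S n)" for n by (induction n) (simp_all add: S0 SS)
  define x where "x n = pick (S n)" for n
  have x: "x n \<in> U" "x n \<notin> S n" "\<And>z. z \<in> U \<Longrightarrow> z \<notin> S n \<Longrightarrow> w (x n) \<le> w z" for n
    using pick[OF finS, of n] by (auto simp: x_def)
  have S: "S n = x ` {..<n}" for n by (induction n) (simp_all add: S0 SS x_def lessThan_Suc)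
  have inj: "inj x"
  proof (rule linorder_injI)
    fix m n :: nat assume "m < n"
    then have "x m \<in> S n" unfolding S by blast
    then show "x m \<noteq> x n" using x(2)[of n] by metis
  qed
  have "range x = U"
  proof
    show "range x \<subseteq> U" using x(1) by blast
    show "U \<subseteq> range x"
    proof
      fix y assume y: "y \<in> U"
      show "y \<in> range x"
      proof (rule ccontr)
        assume "y \<notin> range x"
        then have "w (x n) \<le> w y" for n using x(3)[OF y, of n] unfolding S by blast
        then have "range x \<subseteq> {z \<in> U. w z \<le> w y}" using x(1) by blast
        then have "finite (range x)" using fin by (rule finite_subset)
        then show False using finite_imageD[OF _ inj] infinite_UNIV_nat by blast
      qed
    qed
  qed
  moreover have "incseq (\<lambda>i. w (x i))"
  proof (rule incseq_SucI)
    fix n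
    show "w (x n) \<le> w (x (Suc n))" using x(2)[of "Suc n"] by (intro x(3) x(1)) (simp add: SS)
  qed
  ultimately show ?thesis using inj by (auto simp: bij_betw_def)
qed

section \<open>The twisted Hodge polygon as a bound for multisets of points\<close>

lemma sum_lessThan_add: "(\<Sum>j<k + n. h j) = (\<Sum>j<k. h j) + (\<Sum>j<n. h (k + j) :: real)"
  for k n :: nat
  by (induction n) simp_all

lemma periodic_sum:
  fixes h :: "nat \<Rightarrow> real"
  assumes "\<And>k. h (k + b) = h k"
  shows "(\<Sum>k<n * b. h k) = real n * (\<Sum>k<b. h k)"
proof (induction n)
  case (Suc n)
  have "h (k + n * b) = h k" for k
  proof (induction n)
    case (Suc n)
    then show ?case using assms[of "k + n * b"] by (simp add: algebra_simps)
  qed simp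
  then have "(\<Sum>k<b. h (n * b + k)) = (\<Sum>k<b. h k)" by (simp add: add.commute)
  then show ?case using Suc sum_lessThan_add[of h "n * b" b] by (simp add: add.commute distrib_right)
qed simp

locale twisted_setup =
  fixes p a q :: nat and D :: "(real ^ 'n) set" and d :: "int ^ 'n"
  assumes p2: "p \<ge> 2" and a0: "a > 0" and q: "q = p ^ a" and D: "compact_convex_0 D"
begin

abbreviation "b \<equiv> twist_order p q d"

text \<open>The lattice points that \<open>\<rho>\<close> below scales to the points of $M_{p^i d}$.\<close>

definition cls :: "nat \<Rightarrow> (int ^ 'n) set" where
  "cls i = {u \<in> M_set D. \<forall>j. [u $ j = int p ^ i * d $ j] (mod int (q - 1))}"

definition w :: "int ^ 'n \<Rightarrow> real" where
  "w u = cone_gauge D (real_vec u) / real (q - 1)"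

definition \<rho> :: "int ^ 'n \<Rightarrow> real ^ 'n" where
  "\<rho> u = (1 / (real q - 1)) *\<^sub>R real_vec u"

sublocale lattice_degree "M_set D" "\<lambda>u. cone_gauge D (real_vec u)"
  by (rule lattice_degree_polytope[OF D])

lemma q1: "q > 1" unfolding q by (rule one_less_power) (use p2 a0 in auto)

lemma int_q1: "int (q - 1) = int q - 1" using q1 by (simp add: of_nat_diff)

lemma p_pow_a: "[int p ^ a = 1] (mod int (q - 1))"
  unfolding int_q1 cong_iff_dvd_diff by (simp add: q)

lemma p_pow_a_mult: "[int p ^ a * d $ j = d $ j] (mod int (q - 1))"
  using cong_scalar_right[OF p_pow_a, of "d $ j"] by simp

lemma twist_order_exists: "a > 0 \<and> (\<forall>j. [int p ^ a * d $ j = d $ j] (mod (int q - 1)))"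
  using a0 p_pow_a_mult unfolding int_q1 by blast

lemma b_props: "b > 0" "\<And>j. [int p ^ b * d $ j = d $ j] (mod int (q - 1))"
  using LeastI[of "\<lambda>b. b > 0 \<and> (\<forall>j. [int p ^ b * d $ j = d $ j] (mod (int q - 1)))", OF twist_order_exists]
  unfolding twist_order_def int_q1 by blast+

lemma b_least: "k > 0 \<Longrightarrow> (\<And>j. [int p ^ k * d $ j = d $ j] (mod int (q - 1))) \<Longrightarrow> b \<le> k"
  unfolding twist_order_def int_q1 by (rule Least_le) blast

lemma cls_cong: "(\<And>j. [int p ^ i * d $ j = int p ^ i' * d $ j] (mod int (q - 1))) \<Longrightarrow> cls i = cls i'"
  unfolding cls_def using cong_trans cong_sym by blast

lemma pow_mult_period:
  assumes "\<And>j. [int p ^ k * d $ j = d $ j] (mod int (q - 1))"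
  shows "[int p ^ (i + n * k) * d $ j = int p ^ i * d $ j] (mod int (q - 1))"
proof (induction n)
  case (Suc n)
  have "[int p ^ (i + n * k) * (int p ^ k * d $ j) = int p ^ (i + n * k) * d $ j] (mod int (q - 1))"
    by (intro cong_scalar_left assms)
  moreover have "int p ^ (i + Suc n * k) * d $ j = int p ^ (i + n * k) * (int p ^ k * d $ j)"
    by (simp add: power_add algebra_simps)
  ultimately show ?case using Suc cong_trans by metis
qed simp

lemma cls_period: "cls (i + b) = cls i"
  using pow_mult_period[OF b_props(2), of i 1] by (intro cls_cong) simp

lemma cls_period_a: "cls (i + a) = cls i"
  using pow_mult_period[OF p_pow_a_mult, of i 1] by (intro cls_cong) simp

text \<open>The exponents $k$ with $p^k d = d$ are the multiples of the least one, and $p^a = q$ is congruent to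
  1 modulo $q-1$.\<close>

lemma b_dvd_a: "b dvd a"
proof (rule ccontr)
  assume nd: "\<not> b dvd a"
  define k where "k = a mod b"
  have k: "k > 0" "k < b" using nd b_props(1) by (auto simp: k_def dvd_eq_mod_eq_0)
  have a: "a = k + (a div b) * b" by (simp add: k_def)
  have "[int p ^ k * d $ j = d $ j] (mod int (q - 1))" for j
  proof -
    have "[int p ^ (k + (a div b) * b) * d $ j = int p ^ k * d $ j] (mod int (q - 1))"
      by (rule pow_mult_period[OF b_props(2)])
    then have "[int p ^ a * d $ j = int p ^ k * d $ j] (mod int (q - 1))" using a by simp
    moreover have "[int p ^ a * d $ j = d $ j] (mod int (q - 1))" by (rule p_pow_a_mult)
    ultimately show ?thesis using cong_trans cong_sym by blast
  qed
  then show False using b_least[OF k(1)] k(2) by simp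
qed

text \<open>As \<open>p\<close> is invertible modulo $q-1$, two equal classes would give a period smaller than \<open>b\<close>.\<close>

lemma cls_disjoint:
  assumes "i < i'" "i' < b"
  shows "cls i \<inter> cls i' = {}"
proof (rule ccontr)
  assume "cls i \<inter> cls i' \<noteq> {}"
  then obtain u where u: "u \<in> cls i" "u \<in> cls i'" by blast
  have "[int p ^ (i' - i) * d $ j = d $ j] (mod int (q - 1))" for j
  proof -
    have "[int p ^ i' * d $ j = int p ^ i * d $ j] (mod int (q - 1))"
      using u cong_trans cong_sym unfolding cls_def by blast
    then have *: "[int p ^ ((a - 1) * i) * (int p ^ i' * d $ j) = int p ^ ((a - 1) * i) * (int p ^ i * d $ j)] (mod int (q - 1))"
      by (rule cong_scalar_left)
    have "(a - 1) * i + i' = (i' - i) + i * a" using assms(1) a0 by (cases a) (auto simp: algebra_simps)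
    then have 1: "int p ^ ((a - 1) * i) * (int p ^ i' * d $ j) = int p ^ ((i' - i) + i * a) * d $ j"
      by (simp flip: mult.assoc power_add)
    have "(a - 1) * i + i = 0 + i * a" using a0 by (cases a) (auto simp: algebra_simps)
    then have 2: "int p ^ ((a - 1) * i) * (int p ^ i * d $ j) = int p ^ (0 + i * a) * d $ j"
      by (simp flip: mult.assoc power_add)
    note per = pow_mult_period[OF p_pow_a_mult]
    from cong_trans[OF cong_trans[OF cong_sym[OF per] *[unfolded 1 2]] per]
    show ?thesis by simp
  qed
  then show False using b_least[of "i' - i"] assms by simp
qed

lemma rho_inj: "\<rho> u = \<rho> v \<longleftrightarrow> u = v"
  using q1 by (simp add: \<rho>_def real_vec_inj)

lemma twisted_points_eq: "twisted_points p q D d = (\<Union>i<b. \<rho> ` cls i)"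
proof -
  have "M_twist q D (\<chi> j. int p ^ i * d $ j) = \<rho> ` cls i" for i
    unfolding M_twist_def cls_def \<rho>_def int_q1 by auto
  then show ?thesis by (simp add: twisted_points_def)
qed

lemma deg_rho: "u \<in> M_set D \<Longrightarrow> deg_fun D (\<rho> u) = w u"
proof -
  assume u: "u \<in> M_set D"
  interpret compact_convex_0 D by (rule D)
  have c: "real_vec u \<in> convex_cone hull D" using u by (simp add: M_set_def)
  have "0 \<le> 1 / (real q - 1)" using q1 by simp
  then have "deg_fun D (\<rho> u) = 1 / (real q - 1) * cone_gauge D (real_vec u)"
    unfolding \<rho>_def using c by (simp only: deg_fun_eq_gauge[OF D] gauge_scale convex_cone_hull_mul)
  then show ?thesis using q1 by (simp add: w_def of_nat_diff)
qed

lemma cls_sub: "cls i \<subseteq> M_set D" by (auto simp: cls_def)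

lemma deg_cls: "u \<in> cls k \<Longrightarrow> deg_fun D (\<rho> u) = w u"
  using deg_rho cls_sub by blast

lemma finite_w: "finite {u \<in> M_set D. w u \<le> c}"
proof -
  have "{u \<in> M_set D. w u \<le> c} \<subseteq> {u \<in> M_set D. cone_gauge D (real_vec u) \<le> c * real (q - 1)}"
    using q1 by (auto simp: w_def field_simps)
  then show ?thesis using finite_le finite_subset by blast
qed

lemma finite_twisted_le: "finite {y \<in> twisted_points p q D d. deg_fun D y \<le> c}"
proof -
  have "{y \<in> twisted_points p q D d. deg_fun D y \<le> c} \<subseteq> \<rho> ` {u \<in> M_set D. w u \<le> c}"
  proof
    fix y assume "y \<in> {y \<in> twisted_points p q D d. deg_fun D y \<le> c}"
    then obtain k u where "u \<in> cls k" "y = \<rho> u" "deg_fun D y \<le> c"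
      unfolding twisted_points_eq by blast
    then have "u \<in> {u \<in> M_set D. w u \<le> c}" using deg_cls cls_sub by auto
    then show "y \<in> \<rho> ` {u \<in> M_set D. w u \<le> c}" using \<open>y = \<rho> u\<close> by blast
  qed
  then show ?thesis using finite_w finite_surj by blast
qed

lemma infinite_twisted_points:
  assumes ne: "twisted_points p q D d \<noteq> {}" and v: "v \<in> M_set D" "v \<noteq> 0"
  shows "infinite (twisted_points p q D d)"
proof -
  obtain i u where i: "i < b" "u \<in> cls i" using ne unfolding twisted_points_eq by blast
  define z where "z k = u + int (k * (q - 1)) *s v" for k
  have zc: "z k \<in> cls i" for k
  proof -
    have "z k \<in> M_set D" unfolding z_def using i(2) cls_sub v(1) by (intro M_add M_scaleI) auto
    moreover have "[z k $ j = u $ j] (mod int (q - 1))" for j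
      by (simp add: z_def cong_iff_dvd_diff)
    ultimately show ?thesis using i(2) cong_trans unfolding cls_def by blast
  qed
  obtain j where j: "v $ j \<noteq> 0" using v(2) by (auto simp: Finite_Cartesian_Product.vec_eq_iff)
  have "inj (\<lambda>k. \<rho> (z k))"
  proof (rule injI)
    fix k k' assume "\<rho> (z k) = \<rho> (z k')"
    then have "z k $ j = z k' $ j" by (simp add: rho_inj)
    then have "int (k * (q - 1)) = int (k' * (q - 1))" using j by (simp add: z_def del: of_nat_mult)
    then show "k = k'" using q1 by simp
  qed
  moreover have "range (\<lambda>k. \<rho> (z k)) \<subseteq> twisted_points p q D d"
    unfolding twisted_points_eq using i(1) zc by blast
  ultimately show ?thesis using infinite_UNIV_nat finite_imageD finite_subset by (metis (no_types, lifting))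
qed

end

locale twisted_nonempty = twisted_setup +
  assumes inf: "infinite (twisted_points p q D d)"
begin

definition e :: "nat \<Rightarrow> real" where
  "e j = deg_fun D (point_enum p q D d j)"

lemma point_enum: "bij_betw (point_enum p q D d) UNIV (twisted_points p q D d)" "incseq e"
proof -
  have "bij_betw (point_enum p q D d) UNIV (twisted_points p q D d) \<and> incseq (\<lambda>i. deg_fun D (point_enum p q D d i))"
    unfolding point_enum_def by (rule someI_ex[OF enumeration_by_degree[OF inf finite_twisted_le]])
  then show "bij_betw (point_enum p q D d) UNIV (twisted_points p q D d)" "incseq e"
    by (simp_all add: e_def[abs_def])
qed

lemma sum_below:
  fixes \<theta> :: real
  shows "(\<Sum>k<b. \<Sum>u\<in>{u \<in> cls k. w u < \<theta>}. w u - \<theta>) = (\<Sum>j\<in>{j. e j < \<theta>}. e j - \<theta>)"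
proof -
  let ?B = "\<lambda>k. {u \<in> cls k. w u < \<theta>}"
  have finB: "finite (?B k)" for k
    by (rule finite_subset[OF _ finite_w[of \<theta>]]) (use cls_sub in auto)
  have "(\<Sum>k<b. \<Sum>u\<in>?B k. w u - \<theta>) = (\<Sum>u\<in>(\<Union>k<b. ?B k). w u - \<theta>)"
  proof (rule sum.UNION_disjoint[symmetric])
    show "\<forall>i\<in>{..<b}. \<forall>j\<in>{..<b}. i \<noteq> j \<longrightarrow> ?B i \<inter> ?B j = {}"
    proof (intro ballI impI)
      fix i j assume "i \<in> {..<b}" "j \<in> {..<b}" "i \<noteq> j"
      then have "cls i \<inter> cls j = {}" using cls_disjoint[of i j] cls_disjoint[of j i] by (cases "i < j") auto
      then show "?B i \<inter> ?B j = {}" by blast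
    qed
  qed (use finB in auto)
  also have "\<dots> = (\<Sum>y\<in>\<rho> ` (\<Union>k<b. ?B k). deg_fun D y - \<theta>)"
  proof (subst sum.reindex)
    show "inj_on \<rho> (\<Union>k<b. ?B k)" by (auto simp: inj_on_def rho_inj)
    show "(\<Sum>u\<in>(\<Union>k<b. ?B k). w u - \<theta>) = sum ((\<lambda>y. deg_fun D y - \<theta>) \<circ> \<rho>) (\<Union>k<b. ?B k)"
      by (intro sum.cong refl) (auto simp: deg_cls)
  qed
  also have "\<rho> ` (\<Union>k<b. ?B k) = {y \<in> twisted_points p q D d. deg_fun D y < \<theta>}"
    unfolding twisted_points_eq by (auto simp: deg_cls intro!: image_eqI[OF refl])
  also have "(\<Sum>y\<in>\<dots>. deg_fun D y - \<theta>) = (\<Sum>j\<in>{j. e j < \<theta>}. e j - \<theta>)"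
  proof (rule sum.reindex_cong[of "point_enum p q D d"])
    show "inj_on (point_enum p q D d) {j. e j < \<theta>}"
      using point_enum(1) by (auto simp: bij_betw_def intro: inj_on_subset)
    show "{y \<in> twisted_points p q D d. deg_fun D y < \<theta>} = point_enum p q D d ` {j. e j < \<theta>}"
      using point_enum(1) by (auto simp: bij_betw_def e_def)
  qed (simp add: e_def)
  finally show ?thesis .
qed

text \<open>Compare all weights with the threshold $\theta$, the next degree after the first $bm$. Subtracting
  $\theta$ from every weight changes both sides by the same amount, and afterwards a sum over \<open>S\<close> is at
  least the sum of all negative terms over all levels. Each class of points occurs in $a/b$ levels, so this
  is $a/b$ times the sum of all negative terms over the twisted points, which are those among the first
  $bm$.\<close>

lemma weight_bound:
  assumes fin: "finite S" and S: "S \<subseteq> {(i, u). i < a \<and> u \<in> cls (a - i)}" and card: "card S = a * m"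
  shows "real a / real b * (\<Sum>j<b * m. e j) \<le> (\<Sum>(i, u)\<in>S. w u)"
proof -
  define \<theta> where "\<theta> = e (b * m)"
  define h where "h k = (\<Sum>u\<in>{u \<in> cls k. w u < \<theta>}. w u - \<theta>)" for k
  have b0: "b > 0" by (rule b_props)
  have finB: "finite {u \<in> cls k. w u < \<theta>}" for k
    by (rule finite_subset[OF _ finite_w[of \<theta>]]) (use cls_sub in auto)
  let ?T = "SIGMA i:{..<a}. {u \<in> cls (a - i). w u < \<theta>}"
  have finT: "finite ?T" using finB by (intro finite_SigmaI) auto
  have "(\<Sum>(i, u)\<in>?T. w u - \<theta>) \<le> (\<Sum>(i, u)\<in>S \<inter> ?T. w u - \<theta>)"
  proof -
    have "(\<Sum>(i, u)\<in>?T - S. w u - \<theta>) \<le> 0" by (rule sum_nonpos) auto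
    moreover have "(\<Sum>(i, u)\<in>?T. w u - \<theta>) = (\<Sum>(i, u)\<in>?T - S. w u - \<theta>) + (\<Sum>(i, u)\<in>?T \<inter> S. w u - \<theta>)"
      by (subst add.commute) (rule sum.Int_Diff[OF finT])
    ultimately show ?thesis by (simp add: Int_commute)
  qed
  also have "\<dots> \<le> (\<Sum>(i, u)\<in>S. w u - \<theta>)"
  proof -
    have "0 \<le> (\<Sum>(i, u)\<in>S - ?T. w u - \<theta>)" by (rule sum_nonneg) (use S in auto)
    moreover have "(\<Sum>(i, u)\<in>S. w u - \<theta>) = (\<Sum>(i, u)\<in>S \<inter> ?T. w u - \<theta>) + (\<Sum>(i, u)\<in>S - ?T. w u - \<theta>)"
      by (rule sum.Int_Diff[OF fin])
    ultimately show ?thesis by simp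
  qed
  also have "\<dots> = (\<Sum>(i, u)\<in>S. w u) - real (a * m) * \<theta>"
    using card by (simp add: case_prod_beta sum_subtractf)
  finally have le: "(\<Sum>(i, u)\<in>?T. w u - \<theta>) + real (a * m) * \<theta> \<le> (\<Sum>(i, u)\<in>S. w u)" by simp
  have per: "h (k + b) = h k" for k unfolding h_def cls_period ..
  have "(\<Sum>(i, u)\<in>?T. w u - \<theta>) = (\<Sum>i<a. h (a - i))"
    unfolding h_def using finB by (subst sum.Sigma) auto
  also have "\<dots> = (\<Sum>k<a. h (Suc k))"
    by (subst sum.nat_diff_reindex[symmetric]) (auto intro!: sum.cong arg_cong[where f = h])
  also have "\<dots> = (\<Sum>k<a. h k)"
  proof -
    have "h a = h 0" using cls_period_a[of 0] by (simp add: h_def)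
    then show ?thesis using sum.lessThan_Suc_shift[of h a] sum.lessThan_Suc[of h a] by simp
  qed
  also have "\<dots> = real (a div b) * (\<Sum>k<b. h k)"
    using periodic_sum[of h b "a div b", OF per] b_dvd_a by simp
  also have "(\<Sum>k<b. h k) = (\<Sum>j\<in>{j. e j < \<theta>}. e j - \<theta>)"
    unfolding h_def by (rule sum_below)
  also have "\<dots> = (\<Sum>j<b * m. e j - \<theta>)"
  proof (rule sum.mono_neutral_left)
    show "{j. e j < \<theta>} \<subseteq> {..<b * m}"
      unfolding \<theta>_def using point_enum(2) by (auto simp: incseq_def intro: ccontr) (meson linorder_not_le)
    show "\<forall>j\<in>{..<b * m} - {j. e j < \<theta>}. e j - \<theta> = 0"
    proof
      fix j assume j: "j \<in> {..<b * m} - {j. e j < \<theta>}"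
      then have "e j \<le> \<theta>" unfolding \<theta>_def using point_enum(2) by (auto simp: incseq_def)
      then show "e j - \<theta> = 0" using j by auto
    qed
  qed simp
  finally have T: "(\<Sum>(i, u)\<in>?T. w u - \<theta>) = real (a div b) * (\<Sum>j<b * m. e j - \<theta>)" .
  have "real (a div b) = real a / real b" using b_dvd_a by (rule real_of_nat_div)
  then have "(\<Sum>(i, u)\<in>?T. w u - \<theta>) + real (a * m) * \<theta> = real a / real b * (\<Sum>j<b * m. e j)"
    unfolding T using b0 by (simp add: sum_subtractf field_simps)
  then show ?thesis using le by simp
qed

lemma hodge_slope_eq: "hodge_slope p q D d i = 1 / real b * (\<Sum>j<b. e (b * i + j))"
  by (simp add: hodge_slope_def Let_def e_def)

lemma sum_hodge_slope: "(\<Sum>i<m. hodge_slope p q D d i) = 1 / real b * (\<Sum>j<b * m. e j)"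
proof -
  have "(\<Sum>j<b * m. e j) = (\<Sum>i<m. \<Sum>j<b. e (b * i + j))"
  proof (induction m)
    case (Suc m)
    have "(\<Sum>j<b * Suc m. e j) = (\<Sum>j<b * m. e j) + (\<Sum>j<b. e (b * m + j))"
      using sum_lessThan_add[of e "b * m" b] by (simp add: add.commute)
    then show ?case using Suc by simp
  qed simp
  then show ?thesis by (simp add: hodge_slope_eq sum_distrib_left)
qed

lemma hodge_slope_mono: "i \<le> i' \<Longrightarrow> hodge_slope p q D d i \<le> hodge_slope p q D d i'"
  unfolding hodge_slope_eq using point_enum(2)
  by (intro mult_left_mono sum_mono) (auto simp: incseq_def)

text \<open>The slopes do not decrease, so the line through the \<open>m\<close>-th segment lies below the polygon.\<close>

lemma hodge_support_line:
  "(\<Sum>l<m. hodge_slope p q D d l) + (real i - real m) * hodge_slope p q D d m \<le> (\<Sum>l<i. hodge_slope p q D d l)"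
proof (cases "m \<le> i")
  case True
  have "(real i - real m) * hodge_slope p q D d m = (\<Sum>l\<in>{m..<i}. hodge_slope p q D d m)"
    using True by (simp add: of_nat_diff)
  also have "\<dots> \<le> (\<Sum>l\<in>{m..<i}. hodge_slope p q D d l)"
    by (intro sum_mono hodge_slope_mono) auto
  finally show ?thesis
    using sum.atLeastLessThan_concat[of 0 m i "hodge_slope p q D d"] True by (simp add: lessThan_atLeast0)
next
  case False
  have "(\<Sum>l\<in>{i..<m}. hodge_slope p q D d l) \<le> (\<Sum>l\<in>{i..<m}. hodge_slope p q D d m)"
    by (intro sum_mono hodge_slope_mono) auto
  also have "\<dots> = (real m - real i) * hodge_slope p q D d m"
    using False by (simp add: of_nat_diff)
  finally show ?thesis
    using sum.atLeastLessThan_concat[of 0 i m "hodge_slope p q D d"] False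
    by (simp add: lessThan_atLeast0 algebra_simps)
qed

end

section \<open>The Newton polygon\<close>

lemma ord_ge_subdegree: "ord_ge F c \<Longrightarrow> F \<noteq> 0 \<Longrightarrow> c \<le> real (subdegree F)"
  using nth_subdegree_nonzero[of F] by (fastforce simp: ord_ge_def not_le[symmetric])

text \<open>The half plane above a line is convex.\<close>

lemma newton_polygon_above_line:
  assumes "\<And>i. fps_nth F i \<noteq> 0 \<Longrightarrow> \<alpha> + \<beta> * real i \<le> real (subdegree (fps_nth F i))"
  shows "ereal (\<alpha> + \<beta> * t) \<le> newton_polygon F t"
  unfolding newton_polygon_def
proof (rule Inf_greatest, clarify)
  let ?V = "{(real i, real (subdegree (fps_nth F i))) |i. fps_nth F i \<noteq> 0}"
  fix y
  assume "(t, y) \<in> convex hull ?V"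
  moreover have "convex hull ?V \<subseteq>
      {z. ((- \<beta>, 1) :: real \<times> real) \<bullet> z \<ge> \<alpha>}"
  proof (rule hull_minimal)
    show "?V \<subseteq> {z. ((- \<beta>, 1) :: real \<times> real) \<bullet> z \<ge> \<alpha>}"
      using assms by (auto simp: algebra_simps)
  qed (rule convex_halfspace_ge)
  ultimately have "\<alpha> \<le> ((- \<beta>, 1) :: real \<times> real) \<bullet> (t, y)" by blast
  then show "ereal (\<alpha> + \<beta> * t) \<le> ereal y" by simp
qed

lemma newton_polygon_constant:
  assumes "\<And>i. i > 0 \<Longrightarrow> fps_nth F i = 0" and "t \<noteq> 0"
  shows "newton_polygon F t = \<infinity>"
proof -
  let ?V = "{(real i, real (subdegree (fps_nth F i))) |i. fps_nth F i \<noteq> 0}"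
  have "convex hull ?V \<subseteq>
      {z. ((1, 0) :: real \<times> real) \<bullet> z = 0}"
  proof (rule hull_minimal)
    show "?V \<subseteq> {z. ((1, 0) :: real \<times> real) \<bullet> z = 0}"
      using assms(1) by fastforce
  qed (rule convex_hyperplane)
  then have empty: "{ereal y |y. (t, y) \<in> convex hull ?V} = {}"
    using assms(2) by auto
  show ?thesis unfolding newton_polygon_def empty by (simp add: top_ereal_def)
qed

theorem theorem3p6:
  fixes f :: "int ^ 'n \<Rightarrow>\<^sub>0 'k::{alg_closed_field, field_prime_char} witt fract"
    and d :: "int ^ 'n"
    and p q a :: nat
  assumes "p = CHAR('k)"
    and "a > 0" and "q = p ^ a"
    and "\<forall>u\<in>Poly_Mapping.keys f. Poly_Mapping.lookup f u \<in> mu q"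
    and "\<exists>u\<in>Poly_Mapping.keys f. u \<noteq> 0"
  shows "\<forall>t\<ge>0. ereal (real a * (real p - 1)) * hodge_polygon p q (newton_polytope f) d t
    \<le> newton_polygon (C_series q d f) t"
proof (intro allI impI)
  fix t :: real assume t: "t \<ge> 0"
  define D where "D = newton_polytope f"
  define \<kappa> where "\<kappa> = real a * (real p - 1)"
  have p2: "p \<ge> 2" using prime_ge_2_nat[of "CHAR('k)"] assms(1) by simp
  have \<kappa>: "\<kappa> \<ge> 0" using p2 by (simp add: \<kappa>_def)
  have D: "compact_convex_0 D" unfolding D_def by (rule compact_convex_0_newton_polytope)
  interpret compact_convex_0 D by (rule D)
  interpret twisted_setup p a q D d by standard (use p2 assms D in auto)
  have keysD: "real_vec u \<in> D" if "u \<in> Poly_Mapping.keys f" for u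
    unfolding D_def newton_polytope_def using that by (intro hull_inc) auto
  have keysM: "u \<in> M_set D \<and> cone_gauge D (real_vec u) \<le> 1" if "u \<in> Poly_Mapping.keys f" for u
    using in_cone[OF keysD[OF that]] gauge_le[of 1 "real_vec u"] keysD[OF that] by (simp add: M_set_def)
  have ord: "ord_ge (fps_nth (C_series q d f) m) c"
    if "\<And>S. finite S \<Longrightarrow> card S = a * m \<Longrightarrow> S \<subseteq> {(i, u). i < a \<and> u \<in> cls (a - i)} \<Longrightarrow> c \<le> (real p - 1) * (\<Sum>(i, u)\<in>S. w u)" for m c
  proof (rule ord_C_series[OF assms(1-3)])
    fix S :: "(nat \<times> (int ^ 'n)) set"
    assume "finite S" "card S = a * m"
      and "S \<subseteq> {(i, u). i < a \<and> u \<in> M_set D \<and> (\<forall>j. [u $ j = int p ^ (a - i) * d $ j] (mod int (q - 1)))}"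
    then have "c \<le> (real p - 1) * (\<Sum>(i, u)\<in>S. w u)" by (intro that) (auto simp: cls_def)
    also have "\<dots> = (real p - 1) / real (q - 1) * (\<Sum>(i, u)\<in>S. cone_gauge D (real_vec u))"
      by (simp add: w_def case_prod_beta flip: sum_divide_distrib)
    finally show "c \<le> (real p - 1) / real (q - 1) * (\<Sum>(i, u)\<in>S. cone_gauge D (real_vec u))" .
  qed (use assms(4) keysM in auto)
  show "ereal (real a * (real p - 1)) * hodge_polygon p q (newton_polytope f) d t \<le> newton_polygon (C_series q d f) t"
    unfolding \<kappa>_def[symmetric] D_def[symmetric]
  proof (cases "twisted_points p q D d = {}")
    case True
    \<comment> \<open>Without twisted points there is no index for B, so all coefficients of positive degree vanish.\<close>
    have cls_empty: "cls k = {}" for k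
    proof -
      have "cls k = cls (k mod b)"
        using pow_mult_period[OF b_props(2), of "k mod b" "k div b"] by (intro cls_cong) simp
      moreover have "cls (k mod b) = {}"
      proof -
        have "k mod b < b" using b_props(1) by simp
        then have "\<rho> ` cls (k mod b) \<subseteq> twisted_points p q D d" unfolding twisted_points_eq by blast
        then show ?thesis using True by simp
      qed
      ultimately show ?thesis by simp
    qed
    have C0: "fps_nth (C_series q d f) m = 0" if "m > 0" for m
    proof -
      have "ord_ge (fps_nth (C_series q d f) m) c" for c
      proof (rule ord)
        fix S :: "(nat \<times> (int ^ 'n)) set" assume "card S = a * m" "S \<subseteq> {(i, u). i < a \<and> u \<in> cls (a - i)}"
        then have "S = {}" using cls_empty by auto
        then show "c \<le> (real p - 1) * (\<Sum>(i, u)\<in>S. w u)" using \<open>card S = a * m\<close> a0 that by simp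
      qed
      then have "fps_nth (fps_nth (C_series q d f) m) i = 0" for i
        by (metis ord_ge_def lessI of_nat_less_iff)
      then show ?thesis by (intro fps_ext) simp
    qed
    show "ereal \<kappa> * hodge_polygon p q D d t \<le> newton_polygon (C_series q d f) t"
    proof (cases "t = 0")
      case True
      then show ?thesis using newton_polygon_above_line[of "C_series q d f" 0 0 t] \<open>twisted_points p q D d = {}\<close>
        by (simp add: hodge_polygon_def zero_ereal_def)
    next
      case False
      then show ?thesis using newton_polygon_constant[OF C0] by simp
    qed
  next
    case False
    \<comment> \<open>A nonzero exponent yields infinitely many points of the cone in the same class.\<close>
    obtain v where v: "v \<in> Poly_Mapping.keys f" "v \<noteq> 0" using assms(5) by blast
    interpret twisted_nonempty p a q D d
      by standard (rule infinite_twisted_points[OF False _ v(2)], use keysM v(1) in blast)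
    define m where "m = nat \<lfloor>t\<rfloor>"
    define H where "H i = (\<Sum>l<i. hodge_slope p q D d l)" for i
    let ?s = "hodge_slope p q D d m"
    have ordH: "ord_ge (fps_nth (C_series q d f) i) (\<kappa> * H i)" for i
    proof (rule ord)
      fix S :: "(nat \<times> (int ^ 'n)) set"
      assume S: "finite S" "card S = a * i" "S \<subseteq> {(i, u). i < a \<and> u \<in> cls (a - i)}"
      have "\<kappa> * H i = (real p - 1) * (real a / real b * (\<Sum>j<b * i. e j))"
        by (simp add: \<kappa>_def H_def sum_hodge_slope)
      also have "\<dots> \<le> (real p - 1) * (\<Sum>(i, u)\<in>S. w u)"
        using weight_bound[OF S(1,3,2)] p2 by (intro mult_left_mono) auto
      finally show "\<kappa> * H i \<le> (real p - 1) * (\<Sum>(i, u)\<in>S. w u)" .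
    qed
    have "ereal ((\<kappa> * H m - \<kappa> * ?s * real m) + (\<kappa> * ?s) * t) \<le> newton_polygon (C_series q d f) t"
    proof (rule newton_polygon_above_line)
      fix i assume nz: "fps_nth (C_series q d f) i \<noteq> 0"
      have "\<kappa> * (H m + (real i - real m) * ?s) \<le> \<kappa> * H i"
        unfolding H_def by (intro mult_left_mono hodge_support_line \<kappa>)
      also have "\<dots> \<le> real (subdegree (fps_nth (C_series q d f) i))"
        by (rule ord_ge_subdegree[OF ordH nz])
      finally show "(\<kappa> * H m - \<kappa> * ?s * real m) + (\<kappa> * ?s) * real i \<le> real (subdegree (fps_nth (C_series q d f) i))"
        by (simp add: algebra_simps)
    qed
    moreover have "ereal \<kappa> * hodge_polygon p q D d t = ereal ((\<kappa> * H m - \<kappa> * ?s * real m) + (\<kappa> * ?s) * t)"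
      using False by (simp add: hodge_polygon_def Let_def m_def H_def algebra_simps)
    ultimately show "ereal \<kappa> * hodge_polygon p q D d t \<le> newton_polygon (C_series q d f) t" by simp
  qed
qed

end
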